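(* Consider the Bradley–Terry–Luce model described in the context, with $\theta^*\in\Theta(\kappa)$. Suppose that $\kappa=\mathcal{O}(1)$ and $np\gg(\log n)^{3/2}$. Let $\tilde\theta$ be the spectral estimator and $\pi^*$ the vector with $\pi_i^*=e^{\theta_i^*}/\sum_{k=1}^n e^{\theta_k^*}$. Define, for $i\in[n]$, $$\tilde b_i=\sum_{j:j\neq i}A_{ij}(\pi_i^*+\pi_j^* )\big(\bar y_{ij}-\psi(\theta_i^*-\theta_j^* )\big),\qquad \tilde d_i=\pi_i^*\sum_{j:j\neq i}A_{ij}\psi(\theta_j^*-\theta_i^* ).$$ Then for every $i\in[n]$, $$\tilde\theta_i-\theta_i^*=(1+\tilde\epsilon_{1,i})\frac{\tilde b_i}{\tilde d_i}+\tilde\epsilon_{2,i},$$ where $\tilde\epsilon_1,\tilde\epsilon_2\in\mathbb{R}^n$ are vectors such that, with probability $1-\mathcal{O}(n^{-10})$, $\|\tilde\epsilon_1\|_\infty=\mathfrak{o}(1)$ and $\|\tilde\epsilon_2\|_\infty=\mathfrak{o}(1/\sqrt{npL})$.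
   Context: Let $n\ge2$, $\psi(t)=e^t/(1+e^t)$. For $\kappa>0$ let $\Theta(\kappa)=\{\theta\in\mathbb{R}^n:\max_i\theta_i-\min_i\theta_i\le\kappa,\ \sum_{i}\theta_i=0\}$. BTL model: given $\theta^*\in\Theta(\kappa)$, $p\in(0,1]$ and a positive integer $L$, the variables $\{A_{ij}\}_{i<j}$ are i.i.d. Bernoulli$(p)$, with $A_{ji}=A_{ij}$, $A_{ii}=0$; for each $i<j$ with $A_{ij}=1$ one observes $y_{ij\ell}$, $\ell=1,\dots,L$, i.i.d. Bernoulli$(\psi(\theta_i^*-\theta_j^* ))$, independent across pairs and of $A$. Put $\bar y_{ij}=L^{-1}\sum_{\ell}y_{ij\ell}$ and $\bar y_{ji}=1-\bar y_{ij}$ for $i<j$. Spectral estimator: with $d=2np$, let $P\in\mathbb{R}^{n\times n}$ have $P_{ij}=A_{ij}\bar y_{ji}/d$ for $i\ne j$ and $P_{ii}=1-\sum_{k\neq i}A_{ik}\bar y_{ki}/d$; let $\hat\pi$ be a stationary probability vector, $\hat\pi^\top P=\hat\pi^\top$; set $\tilde\theta_i=\log\hat\pi_i-\frac1n\sum_{k=1}^n\log\hat\pi_k$. Asymptotics: $n\to\infty$; $p,L,\kappa,\theta^*$ may depend on $n$; $a_n\ll b_n$ means $a_n/b_n\to0$; $\mathfrak{o}(\cdot)$ is the corresponding little-o; $\kappa=\mathcal{O}(1)$ means $\kappa$ bounded by a constant independent of $n$. "With probability $1-\mathcal{O}(n^{-10})$" means with probability at least $1-Cn^{-10}$ for a constant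 $C$ independent of $n$. *)

theory Defs
  imports "HOL-Probability.Probability"
begin

definition psi :: "real \<Rightarrow> real" where
  "psi t = exp t / (1 + exp t)"

definition Theta :: "nat \<Rightarrow> real \<Rightarrow> (nat \<Rightarrow> real) set" where
  "Theta n \<kappa> = {\<theta>. (\<forall>i<n. \<forall>j<n. \<theta> i - \<theta> j \<le> \<kappa>) \<and> (\<Sum>i<n. \<theta> i) = 0}"

definition Pairs :: "nat \<Rightarrow> (nat \<times> nat) set" where
  "Pairs n = {(i, j). i < j \<and> j < n}"

text \<open>A sample: comparison graph (on pairs i<j) and the L outcomes y_{ij l} (for i<j, A_ij = 1).\<close>
type_synonym btl_data = "((nat \<times> nat) \<Rightarrow> bool) \<times> ((nat \<times> nat \<times> nat) \<Rightarrow> bool)"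

definition btl_pmf :: "nat \<Rightarrow> real \<Rightarrow> nat \<Rightarrow> (nat \<Rightarrow> real) \<Rightarrow> btl_data pmf" where
  "btl_pmf n p L \<theta> =
     do { A \<leftarrow> Pi_pmf (Pairs n) False (\<lambda>_. bernoulli_pmf p);
          Y \<leftarrow> Pi_pmf {(i, j, l). (i, j) \<in> Pairs n \<and> A (i, j) \<and> l < L} False
                 (\<lambda>(i, j, l). bernoulli_pmf (psi (\<theta> i - \<theta> j)));
          return_pmf (A, Y) }"

definition Aij :: "btl_data \<Rightarrow> nat \<Rightarrow> nat \<Rightarrow> real" where
  "Aij \<omega> i j = (if i < j then of_bool (fst \<omega> (i, j))
                 else if j < i then of_bool (fst \<omega> (j, i)) else 0)"

definition ybar :: "nat \<Rightarrow> btl_data \<Rightarrow> nat \<Rightarrow> nat \<Rightarrow> real" where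
  "ybar L \<omega> i j = (if i < j then (\<Sum>l<L. of_bool (snd \<omega> (i, j, l))) / real L
                   else if j < i then 1 - (\<Sum>l<L. of_bool (snd \<omega> (j, i, l))) / real L
                   else 0)"

definition Pmat :: "nat \<Rightarrow> real \<Rightarrow> nat \<Rightarrow> btl_data \<Rightarrow> nat \<Rightarrow> nat \<Rightarrow> real" where
  "Pmat n p L \<omega> i j =
     (let d = 2 * real n * p in
      if i \<noteq> j then Aij \<omega> i j * ybar L \<omega> j i / d
      else 1 - (\<Sum>k\<in>{0..<n} - {i}. Aij \<omega> i k * ybar L \<omega> k i) / d)"

definition stationary_prob :: "nat \<Rightarrow> (nat \<Rightarrow> nat \<Rightarrow> real) \<Rightarrow> (nat \<Rightarrow> real) \<Rightarrow> bool" where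
  "stationary_prob n P \<pi> \<longleftrightarrow>
     (\<forall>i<n. 0 \<le> \<pi> i) \<and> (\<Sum>i<n. \<pi> i) = 1 \<and> (\<forall>j<n. (\<Sum>i<n. \<pi> i * P i j) = \<pi> j)"

definition spectral_theta :: "nat \<Rightarrow> (nat \<Rightarrow> real) \<Rightarrow> nat \<Rightarrow> real" where
  "spectral_theta n \<pi> i = ln (\<pi> i) - (\<Sum>k<n. ln (\<pi> k)) / real n"

definition pi_star :: "nat \<Rightarrow> (nat \<Rightarrow> real) \<Rightarrow> nat \<Rightarrow> real" where
  "pi_star n \<theta> i = exp (\<theta> i) / (\<Sum>k<n. exp (\<theta> k))"

definition b_tilde :: "nat \<Rightarrow> nat \<Rightarrow> (nat \<Rightarrow> real) \<Rightarrow> btl_data \<Rightarrow> nat \<Rightarrow> real" where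
  "b_tilde n L \<theta> \<omega> i =
     (\<Sum>j\<in>{0..<n} - {i}. Aij \<omega> i j * (pi_star n \<theta> i + pi_star n \<theta> j)
                          * (ybar L \<omega> i j - psi (\<theta> i - \<theta> j)))"

definition d_tilde :: "nat \<Rightarrow> (nat \<Rightarrow> real) \<Rightarrow> btl_data \<Rightarrow> nat \<Rightarrow> real" where
  "d_tilde n \<theta> \<omega> i =
     pi_star n \<theta> i * (\<Sum>j\<in>{0..<n} - {i}. Aij \<omega> i j * psi (\<theta> j - \<theta> i))"

end

theory Submission
  imports Defs
begin

text \<open>
  Write \<open>a i = n * pi_star i\<close> and \<open>\<pi>hat i = c * a i * (1 + x i)\<close> with \<open>\<Sum>i. x i = 0\<close>. Stationarity is the linear
  system \<open>M x = B\<close>, where \<open>B i / D i\<close> is the leading term of the theorem and \<open>M\<close> is a perturbed graph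
  Laplacian. Cuts of the comparison graph have the expected order (union bound over vertex sets),
  so Cheeger's inequality yields a spectral gap and \<open>x\<close> is small in mean square. For a single entry, solve row
  \<open>i\<close> of the system: \<open>x i - B i / D i\<close> is an average of \<open>x\<close> over the neighbours of \<open>i\<close>. Comparing \<open>x\<close> in \<open>\<ell>\<^sub>2\<close> with
  the solution for the data without item \<open>i\<close>, which is independent of row \<open>i\<close>, replaces this neighbourhood
  average by the average \<open>g i\<close> of \<open>x\<close> with the deterministic weights \<open>h i j = a i * a j / (a i + a j)\<close>; Bernstein's
  inequality costs \<open>(ln n) powr (3/2) / (n p)\<close> here, which is where the sparsity assumption enters. Finally
  \<open>g\<close> is almost a fixed point of the averaging operator with weights \<open>h\<close>, which contracts oscillations
  (Doeblin), so \<open>g\<close> is almost constant, and it is negligible because \<open>x\<close> has mean zero.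
\<close>

section \<open>Cheeger's inequality for weighted graphs\<close>

text \<open>The remainder has to be small against \<open>r = (n p L) powr (-1/2)\<close>, which
  carries no logarithm, while single entries of \<open>x\<close> are only known to be of order
  \<open>sqrt (ln n) * r\<close>. The Bernstein error of a neighbourhood average has a range part,
  \<open>ln n / (n p)\<close> times the maximum of \<open>x\<close>, and a variance part,
  \<open>sqrt (ln n / (n p))\<close> times its root mean square. The range part is
  \<open>(ln n) powr (3/2) / (n p)\<close> times \<open>r\<close>, just what the hypothesis permits.
  For the variance part, bounding the mean square by the squared maximum would require
  \<open>n p\<close> to exceed the order of \<open>(ln n)^2\<close>. The mean of
  \<open>\<bar>B i\<bar>\<close> is therefore bounded without a logarithm, so that only one of the
  two factors of \<open>(B i)^2\<close> pays for the maximum. A second obstacle is circularity: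
  every estimate of row \<open>i\<close> involves the maximum of \<open>x\<close>, the quantity
  being bounded. It returns with a small coefficient and is absorbed. Errors proportional to
  \<open>\<bar>x i\<bar>\<close> itself need not be small against \<open>r\<close>; they are kept as
  relative errors and become the factor \<open>1 + \<epsilon>1\<close>.\<close>

lemma coarea_isoperimetric:
  fixes A :: "'a \<Rightarrow> 'a \<Rightarrow> real" and f :: "'a \<Rightarrow> real"
  assumes fin: "finite V"
    and iso: "\<And>S. S \<subseteq> V \<Longrightarrow> 2 * card S \<le> card V \<Longrightarrow> \<phi> * real (card S) \<le> (\<Sum>i\<in>S. \<Sum>j\<in>V-S. A i j)"
    and nonneg: "\<And>i. i \<in> V \<Longrightarrow> 0 \<le> f i"
    and half: "2 * card {i\<in>V. 0 < f i} \<le> card V"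
  shows "\<phi> * (\<Sum>i\<in>V. f i) \<le> (\<Sum>i\<in>V. \<Sum>j\<in>V. A i j * max 0 (f i - f j))"
  using nonneg half
proof (induction "card {i\<in>V. 0 < f i}" arbitrary: f rule: less_induct)
  case less
  define S where "S = {i\<in>V. 0 < f i}"
  have finS: "finite S" using fin by (simp add: S_def)
  have SV: "S \<subseteq> V" by (auto simp: S_def)
  have out: "f i = 0" if "i \<in> V" "i \<notin> S" for i
    using less.prems(1)[OF that(1)] that by (auto simp: S_def)
  show ?case
  proof (cases "S = {}")
    case True
    then have "f i = 0" if "i \<in> V" for i using out that by auto
    then show ?thesis by simp
  next
    case False
    \<comment> \<open>The lowest positive level is peeled off. The cut of the support
      \<open>S\<close> pays for the slab of height \<open>t\<close> over \<open>S\<close>, and what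
      lies above has strictly smaller support.\<close>
    define t where "t = Min (f ` S)"
    have tin: "t \<in> f ` S" using finS False by (simp add: t_def)
    then obtain i0 where i0: "i0 \<in> S" "f i0 = t" by auto
    have tpos: "t > 0" using i0 by (auto simp: S_def)
    have tle: "t \<le> f i" if "i \<in> S" for i using finS that by (simp add: t_def)
    define g where "g i = (if i \<in> S then f i - t else 0)" for i
    have gnn: "0 \<le> g i" for i using tle by (auto simp: g_def)
    have gS: "{i\<in>V. 0 < g i} \<subset> S"
    proof -
      have "{i\<in>V. 0 < g i} \<subseteq> S" by (auto simp: g_def split: if_splits)
      moreover have "i0 \<notin> {i\<in>V. 0 < g i}" using i0 by (simp add: g_def)
      ultimately show ?thesis using i0 by blast
    qed
    have lt: "card {i\<in>V. 0 < g i} < card S"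
      by (rule psubset_card_mono[OF finS gS])
    have IH: "\<phi> * (\<Sum>i\<in>V. g i) \<le> (\<Sum>i\<in>V. \<Sum>j\<in>V. A i j * max 0 (g i - g j))"
      by (rule less.hyps) (use lt gnn less.prems(2) in \<open>auto simp: S_def\<close>)
    have fg: "f i = g i + t * of_bool (i \<in> S)" if "i \<in> V" for i
      using out[OF that] by (auto simp: g_def)
    have sumf: "(\<Sum>i\<in>V. f i) = (\<Sum>i\<in>V. g i) + t * real (card S)"
    proof -
      have "(\<Sum>i\<in>V. f i) = (\<Sum>i\<in>V. g i + t * of_bool (i \<in> S))"
        by (rule sum.cong) (auto simp: fg)
      also have "\<dots> = (\<Sum>i\<in>V. g i) + t * (\<Sum>i\<in>V. of_bool (i \<in> S))"
        by (simp add: sum.distrib sum_distrib_left)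
      also have "(\<Sum>i\<in>V. of_bool (i \<in> S) :: real) = real (card S)"
        using fin SV by (simp add: of_bool_def sum.If_cases Int_absorb1)
      finally show ?thesis .
    qed
    have mx: "max 0 (f i - f j) = max 0 (g i - g j) + t * of_bool (i \<in> S \<and> j \<notin> S)"
      if "i \<in> V" "j \<in> V" for i j
      using out[OF that(1)] out[OF that(2)] gnn[of i] gnn[of j] tpos tle[of i]
      by (cases "i \<in> S"; cases "j \<in> S") (auto simp: g_def)
    have "(\<Sum>i\<in>V. \<Sum>j\<in>V. A i j * max 0 (f i - f j))
        = (\<Sum>i\<in>V. \<Sum>j\<in>V. A i j * max 0 (g i - g j) + t * (A i j * of_bool (i \<in> S \<and> j \<notin> S)))"
      by (intro sum.cong refl) (simp add: mx algebra_simps)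
    also have "\<dots> = (\<Sum>i\<in>V. \<Sum>j\<in>V. A i j * max 0 (g i - g j))
        + t * (\<Sum>i\<in>V. \<Sum>j\<in>V. A i j * of_bool (i \<in> S \<and> j \<notin> S))"
      by (simp add: sum.distrib sum_distrib_left)
    also have "(\<Sum>i\<in>V. \<Sum>j\<in>V. A i j * of_bool (i \<in> S \<and> j \<notin> S)) = (\<Sum>i\<in>S. \<Sum>j\<in>V-S. A i j)"
    proof -
      have "(\<Sum>i\<in>S. \<Sum>j\<in>V-S. A i j) = (\<Sum>i\<in>S. \<Sum>j\<in>V. A i j * of_bool (i \<in> S \<and> j \<notin> S))"
        by (intro sum.cong refl sum.mono_neutral_cong_left) (use fin in auto)
      also have "\<dots> = (\<Sum>i\<in>V. \<Sum>j\<in>V. A i j * of_bool (i \<in> S \<and> j \<notin> S))"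
        by (intro sum.mono_neutral_cong_left) (use fin SV in auto)
      finally show ?thesis by simp
    qed
    finally have eq: "(\<Sum>i\<in>V. \<Sum>j\<in>V. A i j * max 0 (f i - f j))
      = (\<Sum>i\<in>V. \<Sum>j\<in>V. A i j * max 0 (g i - g j)) + t * (\<Sum>i\<in>S. \<Sum>j\<in>V-S. A i j)" .
    have "t * (\<phi> * real (card S)) \<le> t * (\<Sum>i\<in>S. \<Sum>j\<in>V-S. A i j)"
      using iso[OF SV] less.prems(2) tpos by (intro mult_left_mono) (auto simp: S_def)
    then show ?thesis unfolding eq sumf using IH by (simp add: algebra_simps)
  qed
qed

text \<open>Isoperimetry is applied to the squares of \<open>y\<close>; the difference of squares
  factors into \<open>\<bar>y i - y j\<bar> * (y i + y j)\<close> and is split by a weighted AM-GM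
  inequality. The half-support condition makes all level sets admissible in
  \<open>iso\<close>.\<close>

lemma cheeger_half_support:
  fixes A :: "'a \<Rightarrow> 'a \<Rightarrow> real" and y :: "'a \<Rightarrow> real"
  assumes fin: "finite V" and sym: "\<And>i j. A i j = A j i" and A0: "\<And>i j. 0 \<le> A i j"
    and iso: "\<And>S. S \<subseteq> V \<Longrightarrow> 2 * card S \<le> card V \<Longrightarrow> \<phi> * real (card S) \<le> (\<Sum>i\<in>S. \<Sum>j\<in>V-S. A i j)"
    and deg: "\<And>i. i \<in> V \<Longrightarrow> (\<Sum>j\<in>V. A i j) \<le> \<Delta>"
    and pos: "0 < \<phi>" "0 < \<Delta>"
    and nonneg: "\<And>i. i \<in> V \<Longrightarrow> 0 \<le> y i"
    and half: "2 * card {i\<in>V. 0 < y i} \<le> card V"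
  shows "\<phi>\<^sup>2 * (\<Sum>i\<in>V. (y i)\<^sup>2) \<le> \<Delta> * (\<Sum>i\<in>V. \<Sum>j\<in>V. A i j * (y i - y j)\<^sup>2)"
proof -
  define E where "E = (\<Sum>i\<in>V. \<Sum>j\<in>V. A i j * (y i - y j)\<^sup>2)"
  define S2 where "S2 = (\<Sum>i\<in>V. (y i)\<^sup>2)"
  \<comment> \<open>Chosen so that the part of the AM-GM bound with
    \<open>(y i)\<^sup>2 + (y j)\<^sup>2\<close> adds up to exactly half of
    \<open>\<phi> * S2\<close> and can be moved to the left side.\<close>
  define c where "c = 2 * \<Delta> / \<phi>"
  have c0: "c > 0" using pos by (simp add: c_def)
  have eqs: "{i\<in>V. 0 < (y i)\<^sup>2} = {i\<in>V. 0 < y i}"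
    using nonneg by (auto simp: order.strict_iff_order)
  have "\<phi> * S2 \<le> (\<Sum>i\<in>V. \<Sum>j\<in>V. A i j * max 0 ((y i)\<^sup>2 - (y j)\<^sup>2))"
    unfolding S2_def by (rule coarea_isoperimetric[OF fin iso]) (use half eqs in auto)
  also have "\<dots> = (1/2) * (\<Sum>i\<in>V. \<Sum>j\<in>V. A i j * \<bar>(y i)\<^sup>2 - (y j)\<^sup>2\<bar>)"
  proof -
    have "(\<Sum>i\<in>V. \<Sum>j\<in>V. A i j * max 0 ((y i)\<^sup>2 - (y j)\<^sup>2)) = (\<Sum>i\<in>V. \<Sum>j\<in>V. A i j * max 0 ((y j)\<^sup>2 - (y i)\<^sup>2))"
      by (subst sum.swap) (simp add: sym)
    moreover have "(\<Sum>i\<in>V. \<Sum>j\<in>V. A i j * \<bar>(y i)\<^sup>2 - (y j)\<^sup>2\<bar>) =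
       (\<Sum>i\<in>V. \<Sum>j\<in>V. A i j * max 0 ((y i)\<^sup>2 - (y j)\<^sup>2)) + (\<Sum>i\<in>V. \<Sum>j\<in>V. A i j * max 0 ((y j)\<^sup>2 - (y i)\<^sup>2))"
      unfolding sum.distrib[symmetric] by (intro sum.cong refl) (auto simp: max_def abs_if algebra_simps)
    ultimately show ?thesis by simp
  qed
  also have "\<dots> \<le> (1/2) * (\<Sum>i\<in>V. \<Sum>j\<in>V. A i j * (c/2 * (y i - y j)\<^sup>2 + 1/c * ((y i)\<^sup>2 + (y j)\<^sup>2)))"
  proof (intro mult_left_mono sum_mono A0)
    fix i j assume ij: "i \<in> V" "j \<in> V"
    have "\<bar>(y i)\<^sup>2 - (y j)\<^sup>2\<bar> = \<bar>y i - y j\<bar> * (y i + y j)"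
      using nonneg[OF ij(1)] nonneg[OF ij(2)]
      by (simp add: power2_eq_square square_diff_square_factored abs_mult)
    also have "\<dots> \<le> c/2 * (y i - y j)\<^sup>2 + 1/(2*c) * (y i + y j)\<^sup>2"
    proof -
      have "0 \<le> (c * \<bar>y i - y j\<bar> - (y i + y j))\<^sup>2 / (2*c)" using c0 by simp
      also have "\<dots> = c/2 * (y i - y j)\<^sup>2 + 1/(2*c) * (y i + y j)\<^sup>2 - \<bar>y i - y j\<bar> * (y i + y j)"
        using c0 by (simp add: power2_diff power_mult_distrib field_simps power2_eq_square)
      finally show ?thesis by simp
    qed
    also have "\<dots> \<le> c/2 * (y i - y j)\<^sup>2 + 1/c * ((y i)\<^sup>2 + (y j)\<^sup>2)"
    proof -
      have "(y i + y j)\<^sup>2 \<le> 2 * ((y i)\<^sup>2 + (y j)\<^sup>2)"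
        using zero_le_power2[of "y i - y j"] by (simp add: power2_eq_square algebra_simps)
      then have "1/(2*c) * (y i + y j)\<^sup>2 \<le> 1/(2*c) * (2 * ((y i)\<^sup>2 + (y j)\<^sup>2))"
        using c0 by (intro mult_left_mono) auto
      moreover have "1/(2*c) * (2 * ((y i)\<^sup>2 + (y j)\<^sup>2)) = 1/c * ((y i)\<^sup>2 + (y j)\<^sup>2)" using c0 by (simp add: field_simps)
      ultimately show ?thesis by linarith
    qed
    finally show "\<bar>(y i)\<^sup>2 - (y j)\<^sup>2\<bar> \<le> c/2 * (y i - y j)\<^sup>2 + 1/c * ((y i)\<^sup>2 + (y j)\<^sup>2)" .
  qed auto
  also have "\<dots> = c/4 * E + 1/(2*c) * ((\<Sum>i\<in>V. \<Sum>j\<in>V. A i j * (y i)\<^sup>2) + (\<Sum>i\<in>V. \<Sum>j\<in>V. A i j * (y j)\<^sup>2))"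
    unfolding E_def by (simp add: sum.distrib sum_distrib_left algebra_simps)
  also have "(\<Sum>i\<in>V. \<Sum>j\<in>V. A i j * (y j)\<^sup>2) = (\<Sum>i\<in>V. \<Sum>j\<in>V. A i j * (y i)\<^sup>2)"
    by (subst sum.swap) (simp add: sym)
  also have "(\<Sum>i\<in>V. \<Sum>j\<in>V. A i j * (y i)\<^sup>2) = (\<Sum>i\<in>V. (\<Sum>j\<in>V. A i j) * (y i)\<^sup>2)"
    by (simp add: sum_distrib_right)
  also have "c/4 * E + 1/(2*c) * ((\<Sum>i\<in>V. (\<Sum>j\<in>V. A i j) * (y i)\<^sup>2) + (\<Sum>i\<in>V. (\<Sum>j\<in>V. A i j) * (y i)\<^sup>2))
     \<le> c/4 * E + 1/(2*c) * (\<Delta> * S2 + \<Delta> * S2)"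
  proof -
    have "(\<Sum>i\<in>V. (\<Sum>j\<in>V. A i j) * (y i)\<^sup>2) \<le> \<Delta> * S2"
      unfolding S2_def sum_distrib_left by (intro sum_mono mult_right_mono deg) auto
    then show ?thesis using c0 by (intro add_left_mono mult_left_mono add_mono) auto
  qed
  also have "\<dots> = \<Delta> * E / (2 * \<phi>) + \<phi> * S2 / 2"
    using pos by (simp add: c_def field_simps)
  finally have "\<phi> * S2 \<le> \<Delta> * E / \<phi>" by (simp add: field_simps)
  then show ?thesis using pos unfolding E_def S2_def
    by (simp add: pos_le_divide_eq power2_eq_square mult.commute mult.left_commute)
qed

lemma exists_median:
  fixes x :: "'a \<Rightarrow> real"
  assumes fin: "finite V"
  shows "\<exists>c. 2 * card {i\<in>V. c < x i} \<le> card V \<and> 2 * card {i\<in>V. x i < c} \<le> card V"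
proof (cases "V = {}")
  case False
  define P where "P = {c \<in> x ` V. card V \<le> 2 * card {i\<in>V. x i \<le> c}}"
  have finP: "finite P" using fin by (simp add: P_def)
  have "Max (x ` V) \<in> P"
  proof -
    have "{i\<in>V. x i \<le> Max (x ` V)} = V" using fin by auto
    then show ?thesis using fin False by (simp add: P_def)
  qed
  then have Pne: "P \<noteq> {}" by auto
  define c where "c = Min P"
  have cP: "c \<in> P" using finP Pne by (simp add: c_def)
  have "card V = card {i\<in>V. x i \<le> c} + card {i\<in>V. c < x i}"
    by (subst card_Un_disjoint[symmetric]) (use fin in \<open>auto intro!: arg_cong[where f=card]\<close>)
  then have 1: "2 * card {i\<in>V. c < x i} \<le> card V" using cP by (auto simp: P_def)
  have 2: "2 * card {i\<in>V. x i < c} \<le> card V"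
  proof (cases "{i\<in>V. x i < c} = {}")
    case ne: False
    \<comment> \<open>The largest attained value below \<open>c\<close>. Being attained, it could
      fail to lie in \<open>P\<close> only by having too few points at or below it, and minimality
      of \<open>c\<close> forces this failure.\<close>
    define d where "d = Max (x ` {i\<in>V. x i < c})"
    have "d \<in> x ` {i\<in>V. x i < c}" unfolding d_def using fin ne by (intro Max_in) auto
    then have d: "d \<in> x ` V" "d < c" by auto
    have "{i\<in>V. x i < c} \<subseteq> {i\<in>V. x i \<le> d}" using fin by (auto simp: d_def)
    then have le: "card {i\<in>V. x i < c} \<le> card {i\<in>V. x i \<le> d}" using fin by (intro card_mono) auto
    have "d \<notin> P" using d(2) Min_le[OF finP, of d] by (auto simp: c_def)
    then have "2 * card {i\<in>V. x i \<le> d} < card V" using d(1) by (auto simp: P_def)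
    then show ?thesis using le by linarith
  qed (simp only: card.empty)
  show ?thesis using 1 2 by blast
qed auto

text \<open>The positive and the negative part of \<open>x\<close> about a median are each supported
  on at most half of the vertices. Recentring from mean to median only increases the sum of squares,
  and the cross terms of the two parts in the Dirichlet form have a favourable sign, since one part
  increases and the other decreases with \<open>x\<close>.\<close>

lemma cheeger_spectral_gap:
  fixes A :: "'a \<Rightarrow> 'a \<Rightarrow> real" and x :: "'a \<Rightarrow> real"
  assumes fin: "finite V" and sym: "\<And>i j. A i j = A j i" and A0: "\<And>i j. 0 \<le> A i j"
    and iso: "\<And>S. S \<subseteq> V \<Longrightarrow> 2 * card S \<le> card V \<Longrightarrow> \<phi> * real (card S) \<le> (\<Sum>i\<in>S. \<Sum>j\<in>V-S. A i j)"
    and deg: "\<And>i. i \<in> V \<Longrightarrow> (\<Sum>j\<in>V. A i j) \<le> \<Delta>"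
    and pos: "0 < \<phi>" "0 < \<Delta>"
    and mean0: "(\<Sum>i\<in>V. x i) = 0"
  shows "\<phi>\<^sup>2 * (\<Sum>i\<in>V. (x i)\<^sup>2) \<le> \<Delta> * (\<Sum>i\<in>V. \<Sum>j\<in>V. A i j * (x i - x j)\<^sup>2)"
proof -
  obtain c where c: "2 * card {i\<in>V. c < x i} \<le> card V" "2 * card {i\<in>V. x i < c} \<le> card V"
    using exists_median[OF fin] by blast
  define u where "u i = max 0 (x i - c)" for i
  define v where "v i = max 0 (c - x i)" for i
  have U: "\<phi>\<^sup>2 * (\<Sum>i\<in>V. (u i)\<^sup>2) \<le> \<Delta> * (\<Sum>i\<in>V. \<Sum>j\<in>V. A i j * (u i - u j)\<^sup>2)"
    by (rule cheeger_half_support[OF fin sym A0 iso deg pos])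
       (use c in \<open>auto simp: u_def less_max_iff_disj\<close>)
  have W: "\<phi>\<^sup>2 * (\<Sum>i\<in>V. (v i)\<^sup>2) \<le> \<Delta> * (\<Sum>i\<in>V. \<Sum>j\<in>V. A i j * (v i - v j)\<^sup>2)"
    by (rule cheeger_half_support[OF fin sym A0 iso deg pos])
       (use c in \<open>auto simp: v_def less_max_iff_disj\<close>)
  have "(\<Sum>i\<in>V. (x i)\<^sup>2) \<le> (\<Sum>i\<in>V. (x i)\<^sup>2) + real (card V) * c\<^sup>2" by simp
  also have "\<dots> = (\<Sum>i\<in>V. (x i - c)\<^sup>2)"
    using mean0 by (simp add: power2_diff sum.distrib sum_subtractf sum_distrib_left[symmetric] sum_distrib_right[symmetric] mult.assoc)
  also have "\<dots> = (\<Sum>i\<in>V. (u i)\<^sup>2) + (\<Sum>i\<in>V. (v i)\<^sup>2)"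
    unfolding sum.distrib[symmetric] by (intro sum.cong refl) (auto simp: u_def v_def max_def power2_eq_square algebra_simps)
  finally have "\<phi>\<^sup>2 * (\<Sum>i\<in>V. (x i)\<^sup>2) \<le> \<phi>\<^sup>2 * ((\<Sum>i\<in>V. (u i)\<^sup>2) + (\<Sum>i\<in>V. (v i)\<^sup>2))"
    by (rule mult_left_mono) simp
  also have "\<dots> \<le> \<Delta> * ((\<Sum>i\<in>V. \<Sum>j\<in>V. A i j * (u i - u j)\<^sup>2) + (\<Sum>i\<in>V. \<Sum>j\<in>V. A i j * (v i - v j)\<^sup>2))"
    using U W by (simp add: algebra_simps)
  also have "\<dots> \<le> \<Delta> * (\<Sum>i\<in>V. \<Sum>j\<in>V. A i j * (x i - x j)\<^sup>2)"
  proof (rule mult_left_mono)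
    have "(u i - u j)\<^sup>2 + (v i - v j)\<^sup>2 \<le> (x i - x j)\<^sup>2" for i j
    proof -
      have e: "x i - x j = (u i - u j) - (v i - v j)" by (simp add: u_def v_def max_def)
      have "(u i - u j) * (v i - v j) \<le> 0"
        by (auto simp: u_def v_def max_def mult_le_0_iff zero_le_mult_iff)
      then show ?thesis unfolding e power2_diff[of "u i - u j"] by linarith
    qed
    then have "A i j * ((u i - u j)\<^sup>2 + (v i - v j)\<^sup>2) \<le> A i j * (x i - x j)\<^sup>2" for i j
      using A0 by (intro mult_left_mono)
    then show "(\<Sum>i\<in>V. \<Sum>j\<in>V. A i j * (u i - u j)\<^sup>2) + (\<Sum>i\<in>V. \<Sum>j\<in>V. A i j * (v i - v j)\<^sup>2) \<le> (\<Sum>i\<in>V. \<Sum>j\<in>V. A i j * (x i - x j)\<^sup>2)"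
      unfolding sum.distrib[symmetric] by (intro sum_mono) (simp add: algebra_simps)
  qed (use pos in simp)
  finally show ?thesis .
qed

section \<open>The linear system of the balance equations\<close>

lemma L2_set_sq: "(L2_set f V)\<^sup>2 = (\<Sum>i\<in>V. (f i)\<^sup>2)"
  by (simp add: L2_set_def sum_nonneg)

lemma abs_sum_mult_le_L2_set:
  "\<bar>\<Sum>i\<in>V. f i * g i\<bar> \<le> L2_set f V * L2_set g V"
  by (rule order_trans[OF sum_abs]) (simp add: abs_mult L2_set_mult_ineq)

lemma L2_set_const_le:
  assumes "finite V" "\<And>i. i \<in> V \<Longrightarrow> \<bar>f i\<bar> \<le> c" "c \<ge> 0"
  shows "L2_set f V \<le> sqrt (real (card V)) * c"
proof -
  have "(\<Sum>i\<in>V. (f i)\<^sup>2) \<le> (\<Sum>i\<in>V. c\<^sup>2)"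
    by (intro sum_mono) (use assms in \<open>auto simp: abs_le_square_iff[symmetric]\<close>)
  then have "L2_set f V \<le> sqrt (real (card V) * c\<^sup>2)"
    unfolding L2_set_def by (intro real_sqrt_le_mono) simp
  then show ?thesis using assms(3) by (simp add: real_sqrt_mult)
qed

lemma L2_set_uminus: "L2_set (\<lambda>i. - f i) V = L2_set f V"
  by (simp add: L2_set_def)

lemma L2_set_diff_le: "L2_set (\<lambda>i. f i - g i) V \<le> L2_set f V + L2_set g V"
  using L2_set_triangle_ineq[of f "\<lambda>i. - g i" V] by (simp add: L2_set_uminus)

locale comparison_data =
  fixes A \<eta> :: "nat \<Rightarrow> nat \<Rightarrow> real" and a :: "nat \<Rightarrow> real" and K :: real
  assumes A_sym: "A i j = A j i" and A01: "A i j = 0 \<or> A i j = 1" and A_diag: "A i i = 0"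
    and eta_nonneg: "0 \<le> \<eta> i j" and eta_add: "i \<noteq> j \<Longrightarrow> \<eta> i j + \<eta> j i = 1"
    and K1: "1 \<le> K" and a_lower: "1 / K \<le> a i" and a_upper: "a i \<le> K"
begin

text \<open>Expected flow across a comparison: the mass \<open>a j\<close> times the probability
  that \<open>i\<close> beats \<open>j\<close>. Its symmetry is detailed balance of the noiseless
  chain.\<close>

definition h :: "nat \<Rightarrow> nat \<Rightarrow> real" where "h i j = a i * a j / (a i + a j)"
definition \<xi> :: "nat \<Rightarrow> nat \<Rightarrow> real" where "\<xi> i j = \<eta> i j - a i / (a i + a j)"
definition B :: "nat set \<Rightarrow> nat \<Rightarrow> real" where "B V i = (\<Sum>j\<in>V. A i j * (a i + a j) * \<xi> i j)"
text \<open>Outflow minus inflow at \<open>i\<close> when item \<open>j\<close> carries mass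
  \<open>a j * x j\<close>. Stationary vectors divided by \<open>a\<close> are annihilated.\<close>

definition M :: "nat set \<Rightarrow> (nat \<Rightarrow> real) \<Rightarrow> nat \<Rightarrow> real" where
  "M V x i = (\<Sum>j\<in>V. A i j * (\<eta> j i * a i * x i - \<eta> i j * a j * x j))"

lemma A_nonneg: "0 \<le> A i j" using A01[of i j] by auto
lemma A_le1: "A i j \<le> 1" using A01[of i j] by auto
lemma A_sq: "(A i j)\<^sup>2 = A i j" using A01[of i j] by auto
lemma Kpos: "K > 0" using K1 by simp
lemma a_pos: "0 < a i"
  using a_lower[of i] Kpos by (meson less_le_trans zero_less_divide_1_iff)

lemma eta_le1: "i \<noteq> j \<Longrightarrow> \<eta> i j \<le> 1"
  using eta_add[of i j] eta_nonneg[of j i] by linarith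

lemma weights_add: "a i / (a i + a j) + a j / (a j + a i) = 1"
  using a_pos[of i] a_pos[of j] by (simp add: add.commute[of "a j"] add_divide_distrib[symmetric])

lemma xi_antisym: "i \<noteq> j \<Longrightarrow> \<xi> j i = - \<xi> i j"
  using eta_add[of i j] weights_add[of i j] by (simp add: \<xi>_def)

lemma h_sym: "h i j = h j i" by (simp add: h_def algebra_simps)

lemma h_pos: "0 < h i j"
  using a_pos[of i] a_pos[of j] by (simp add: h_def)

lemma h_lower: "1 / (2 * K) \<le> h i j"
proof -
  have "1 / h i j = 1 / a i + 1 / a j"
    using a_pos[of i] a_pos[of j] by (simp add: h_def field_simps)
  also have "\<dots> \<le> K + K"
    using a_lower[of i] a_lower[of j] a_pos[of i] a_pos[of j] Kpos
    by (intro add_mono) (auto simp: field_simps)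
  finally show ?thesis using h_pos[of i j] Kpos by (simp add: field_simps)
qed

lemma h_upper: "h i j \<le> K"
proof -
  have "h i j \<le> a i"
    using a_pos[of i] a_pos[of j] by (simp add: h_def field_simps)
  then show ?thesis using a_upper[of i] by linarith
qed

lemma eta_mult: "\<eta> i j * a j = h i j + \<xi> i j * a j"
  by (simp add: \<xi>_def h_def algebra_simps)

lemma balance_defect:
  assumes "i \<noteq> j"
  shows "\<eta> j i * a i - \<eta> i j * a j = - ((a i + a j) * \<xi> i j)"
  using eta_mult[of i j] eta_mult[of j i] xi_antisym[OF assms] h_sym[of i j]
  by (simp add: algebra_simps)

text \<open>The vector \<open>a\<close> violates the balance equations only through the noise. Hence
  \<open>M (1 + x) = 0\<close> for the true stationary vector turns into
  \<open>M x = B\<close>.\<close>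

lemma M_one: "M V (\<lambda>_. 1) i = - B V i"
proof -
  have "A i j * (\<eta> j i * a i - \<eta> i j * a j) = - (A i j * (a i + a j) * \<xi> i j)" for j
    using balance_defect[of i j] A_diag[of i] by (cases "i = j") auto
  then show ?thesis by (simp add: M_def B_def sum_negf)
qed

lemma M_add: "M V (\<lambda>j. x j + y j) i = M V x i + M V y i"
  by (simp add: M_def sum.distrib[symmetric] algebra_simps)

lemma M_scale: "M V (\<lambda>j. c * x j) i = c * M V x i"
  by (simp add: M_def sum_distrib_left algebra_simps)

lemma M_shift: "M V (\<lambda>j. x j - y j - c) i = M V x i - M V y i + c * B V i"
proof -
  have "M V (\<lambda>j. x j - y j - c) i = M V (\<lambda>j. x j + ((-1) * y j + (-c) * 1)) i"
    by (intro arg_cong[where f = "\<lambda>z. M V z i"]) auto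
  also have "\<dots> = M V x i + ((-1) * M V y i + (-c) * M V (\<lambda>_. 1) i)"
    by (simp only: M_add M_scale)
  finally show ?thesis by (simp add: M_one)
qed

text \<open>Up to a diagonal term, the symmetric part of \<open>M\<close> is a weighted graph Laplacian whose weights are
  at least \<open>A i j / K\<close> whatever the noise, because \<open>\<eta> i j + \<eta> j i = 1\<close>. No bound on the operator
  norm of the noise is needed.\<close>
lemma energy_identity:
  "(\<Sum>i\<in>V. x i * M V x i) =
     (1/4) * (\<Sum>i\<in>V. \<Sum>j\<in>V. A i j * (\<eta> i j * a j + \<eta> j i * a i) * (x i - x j)\<^sup>2)
     - (1/2) * (\<Sum>i\<in>V. (x i)\<^sup>2 * B V i)"
proof -
  define F where "F i j = A i j * (\<eta> i j * a j)" for i j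
  have swap: "(\<Sum>i\<in>V. \<Sum>j\<in>V. f j i) = (\<Sum>i\<in>V. \<Sum>j\<in>V. f i j)" for f :: "nat \<Rightarrow> nat \<Rightarrow> real"
    by (rule sum.swap)
  have FA: "A i j * (\<eta> j i * a i) = F j i" for i j by (simp add: F_def A_sym)
  have M': "M V x i = (\<Sum>j\<in>V. F j i * x i - F i j * x j)" for i
    unfolding M_def by (rule sum.cong) (auto simp: F_def A_sym[of _ i] algebra_simps)
  have B': "B V i = (\<Sum>j\<in>V. F i j - F j i)" for i
  proof -
    have "- B V i = (\<Sum>j\<in>V. F j i - F i j)"
      unfolding M_one[symmetric] M_def by (rule sum.cong) (auto simp: F_def A_sym[of _ i] algebra_simps)
    then show ?thesis by (simp add: sum_subtractf)
  qed
  define P where "P = (\<Sum>i\<in>V. \<Sum>j\<in>V. F i j * (x i)\<^sup>2)"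
  define R where "R = (\<Sum>i\<in>V. \<Sum>j\<in>V. F i j * (x j)\<^sup>2)"
  define W where "W = (\<Sum>i\<in>V. \<Sum>j\<in>V. F i j * (x i * x j))"
  have P2: "(\<Sum>i\<in>V. \<Sum>j\<in>V. F j i * (x i)\<^sup>2) = R" unfolding R_def by (subst swap[symmetric]) simp
  have R2: "(\<Sum>i\<in>V. \<Sum>j\<in>V. F j i * (x j)\<^sup>2) = P" unfolding P_def by (subst swap[symmetric]) simp
  have W2: "(\<Sum>i\<in>V. \<Sum>j\<in>V. F j i * (x i * x j)) = W"
    unfolding W_def by (subst swap[symmetric]) (simp add: mult.commute[of "x _" "x _"])
  have 1: "(\<Sum>i\<in>V. x i * M V x i) = R - W"
  proof -
    have "(\<Sum>i\<in>V. x i * M V x i) = (\<Sum>i\<in>V. \<Sum>j\<in>V. F j i * (x i)\<^sup>2 - F i j * (x i * x j))"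
      unfolding M' sum_distrib_left by (intro sum.cong refl) (simp add: power2_eq_square algebra_simps)
    then show ?thesis by (simp add: sum_subtractf P2 W_def)
  qed
  have 2: "(\<Sum>i\<in>V. (x i)\<^sup>2 * B V i) = P - R"
  proof -
    have "(\<Sum>i\<in>V. (x i)\<^sup>2 * B V i) = (\<Sum>i\<in>V. \<Sum>j\<in>V. F i j * (x i)\<^sup>2 - F j i * (x i)\<^sup>2)"
      unfolding B' sum_distrib_left by (intro sum.cong refl) (simp add: algebra_simps)
    then show ?thesis by (simp add: sum_subtractf P2 P_def)
  qed
  have 3: "(\<Sum>i\<in>V. \<Sum>j\<in>V. A i j * (\<eta> i j * a j + \<eta> j i * a i) * (x i - x j)\<^sup>2) = 2 * P + 2 * R - 4 * W"
  proof -
    have "(\<Sum>i\<in>V. \<Sum>j\<in>V. A i j * (\<eta> i j * a j + \<eta> j i * a i) * (x i - x j)\<^sup>2)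
       = (\<Sum>i\<in>V. \<Sum>j\<in>V. (F i j * (x i)\<^sup>2 + F i j * (x j)\<^sup>2 - 2 * (F i j * (x i * x j)))
            + (F j i * (x i)\<^sup>2 + F j i * (x j)\<^sup>2 - 2 * (F j i * (x i * x j))))"
    proof (intro sum.cong refl)
      fix i j
      have "A i j * (\<eta> i j * a j + \<eta> j i * a i) = F i j + F j i"
        by (simp add: F_def A_sym[of j i] algebra_simps)
      then show "A i j * (\<eta> i j * a j + \<eta> j i * a i) * (x i - x j)\<^sup>2 =
          (F i j * (x i)\<^sup>2 + F i j * (x j)\<^sup>2 - 2 * (F i j * (x i * x j)))
          + (F j i * (x i)\<^sup>2 + F j i * (x j)\<^sup>2 - 2 * (F j i * (x i * x j)))"
        by (simp only:) (simp add: power2_eq_square algebra_simps)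
    qed
    then show ?thesis
      by (simp add: sum.distrib sum_subtractf sum_distrib_left[symmetric] P2 R2 W2 P_def[symmetric] R_def[symmetric] W_def[symmetric])
  qed
  show ?thesis unfolding 1 2 3 by (simp add: field_simps)
qed

text \<open>In the energy identity the Laplacian part contributes at least
  \<open>\<gamma> / (4 * K)\<close> times the squared norm and the diagonal noise removes at most
  half of that; Cauchy-Schwarz turns the remaining coercivity into a bound by
  \<open>M V x\<close>.\<close>

lemma L2_stability:
  assumes fin: "finite V" and gam: "0 < \<gamma>"
    and gap: "\<gamma> * (\<Sum>i\<in>V. (x i)\<^sup>2) \<le> (\<Sum>i\<in>V. \<Sum>j\<in>V. A i j * (x i - x j)\<^sup>2)"
    and small: "\<And>i. i \<in> V \<Longrightarrow> \<bar>B V i\<bar> \<le> \<gamma> / (4 * K)"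
  shows "L2_set x V \<le> 8 * K / \<gamma> * L2_set (M V x) V"
proof -
  define S where "S = (\<Sum>i\<in>V. (x i)\<^sup>2)"
  have S: "S = (L2_set x V)\<^sup>2" by (simp add: L2_set_sq S_def)
  have "\<gamma> / K * S \<le> 1 / K * (\<Sum>i\<in>V. \<Sum>j\<in>V. A i j * (x i - x j)\<^sup>2)"
    using gap Kpos by (simp add: S_def field_simps)
  also have "\<dots> \<le> (\<Sum>i\<in>V. \<Sum>j\<in>V. A i j * (\<eta> i j * a j + \<eta> j i * a i) * (x i - x j)\<^sup>2)"
    unfolding sum_distrib_left
  proof (intro sum_mono)
    fix i j
    show "1 / K * (A i j * (x i - x j)\<^sup>2) \<le> A i j * (\<eta> i j * a j + \<eta> j i * a i) * (x i - x j)\<^sup>2"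
    proof (cases "i = j")
      case False
      have "1 / K = 1 / K * (\<eta> i j + \<eta> j i)" using eta_add[OF False] by simp
      also have "\<dots> \<le> \<eta> i j * a j + \<eta> j i * a i"
        using mult_left_mono[OF a_lower[of j] eta_nonneg[of i j]] mult_left_mono[OF a_lower[of i] eta_nonneg[of j i]]
        by (simp add: algebra_simps)
      finally have "1 / K * (A i j * (x i - x j)\<^sup>2) \<le> (\<eta> i j * a j + \<eta> j i * a i) * (A i j * (x i - x j)\<^sup>2)"
        using A_nonneg by (intro mult_right_mono) auto
      then show ?thesis by (simp add: algebra_simps)
    qed simp
  qed
  finally have lower: "\<gamma> / (4 * K) * S \<le> (1/4) * (\<Sum>i\<in>V. \<Sum>j\<in>V. A i j * (\<eta> i j * a j + \<eta> j i * a i) * (x i - x j)\<^sup>2)"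
    by simp
  have "(\<Sum>i\<in>V. (x i)\<^sup>2 * B V i) \<le> (\<Sum>i\<in>V. (x i)\<^sup>2 * (\<gamma> / (4 * K)))"
    using small by (intro sum_mono mult_left_mono) (auto simp: abs_le_iff)
  then have upper: "(\<Sum>i\<in>V. (x i)\<^sup>2 * B V i) \<le> S * (\<gamma> / (4 * K))" by (simp only: S_def sum_distrib_right)
  have "\<gamma> / (8 * K) * S \<le> (\<Sum>i\<in>V. x i * M V x i)"
    unfolding energy_identity using lower upper by (simp add: algebra_simps)
  also have "\<dots> \<le> L2_set x V * L2_set (M V x) V"
    using abs_sum_mult_le_L2_set[of x "M V x" V] by linarith
  finally have fin1: "\<gamma> / (8 * K) * (L2_set x V * L2_set x V) \<le> L2_set x V * L2_set (M V x) V"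
    by (simp add: S power2_eq_square)
  show ?thesis
  proof (cases "L2_set x V = 0")
    case True
    then show ?thesis using Kpos gam by simp
  next
    case False
    then have "L2_set x V > 0" using L2_set_nonneg[of x V] by linarith
    then have "\<gamma> / (8 * K) * L2_set x V \<le> L2_set (M V x) V"
      using fin1 by (simp add: mult.left_commute[of _ "L2_set x V"] del: times_divide_eq_left)
    then show ?thesis using Kpos gam by (simp add: field_simps)
  qed
qed

end

section \<open>Entrywise analysis on a good sample\<close>

text \<open>Here \<open>m = n p\<close> is the expected degree, \<open>\<nu> = m powr (-1/2)\<close>, \<open>r = (m L) powr (-1/2)\<close> the noise scale and
  \<open>lam = sqrt (ln n)\<close>; \<open>x\<close> is the relative error of the normalised stationary vector and \<open>x' i\<close> its
  analogue for the graph without vertex \<open>i\<close>. All constants of the probabilistic estimates are merged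
  into \<open>K\<close>.\<close>
locale good_sample = comparison_data A \<eta> a K
  for A \<eta> :: "nat \<Rightarrow> nat \<Rightarrow> real" and a :: "nat \<Rightarrow> real" and K :: real +
  fixes n :: nat and p m r lam \<nu> \<sigma> :: real and x :: "nat \<Rightarrow> real" and x' :: "nat \<Rightarrow> nat \<Rightarrow> real"
    and V :: "nat set" and e \<tau> :: real and D Hs G Q' X' :: "nat \<Rightarrow> real"
  defines "V \<equiv> {..<n}" and "e \<equiv> lam * r" and "\<tau> \<equiv> lam * \<nu>"
    and "D \<equiv> \<lambda>i. \<Sum>j\<in>V. A i j * h i j"
    and "Hs \<equiv> \<lambda>i. \<Sum>j\<in>V-{i}. h i j"
    and "G \<equiv> \<lambda>i. \<Sum>j\<in>V. A i j * \<xi> i j"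
    and "Q' \<equiv> \<lambda>i. L2_set (x' i) (V-{i}) / sqrt (real n)"
    and "X' \<equiv> \<lambda>i. Max ((\<lambda>j. \<bar>x' i j\<bar>) ` (V-{i}))"
  assumes n2: "2 \<le> n" and lam1: "1 \<le> lam" and r0: "0 < r" and r_le: "r \<le> \<nu>"
    and m_nu: "m * \<nu>\<^sup>2 = 1" and m_n: "m \<le> real n" and m_p: "m = real n * p" and p0: "0 \<le> p"
    and sig: "\<sigma>\<^sup>2 = lam^3 * \<nu>\<^sup>2" and sig0: "0 \<le> \<sigma>" and sig_small: "1000 * K^6 * \<sigma> \<le> 1"
    and deg: "i < n \<Longrightarrow> (\<Sum>j\<in>V. A i j) \<le> 2 * m"
    and D_low: "i < n \<Longrightarrow> m / K \<le> D i"
    and D_conc: "i < n \<Longrightarrow> \<bar>D i - p * Hs i\<bar> \<le> K * \<tau> * m"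
    and gap: "(\<Sum>i\<in>V. z i) = 0 \<Longrightarrow> m / K * (\<Sum>i\<in>V. (z i)\<^sup>2) \<le> (\<Sum>i\<in>V. \<Sum>j\<in>V. A i j * (z i - z j)\<^sup>2)"
    and gap': "k < n \<Longrightarrow> (\<Sum>i\<in>V-{k}. z i) = 0 \<Longrightarrow>
       m / K * (\<Sum>i\<in>V-{k}. (z i)\<^sup>2) \<le> (\<Sum>i\<in>V-{k}. \<Sum>j\<in>V-{k}. A i j * (z i - z j)\<^sup>2)"
    and B_sup: "i < n \<Longrightarrow> \<bar>B V i\<bar> \<le> K * m * e"
    and G_sup: "i < n \<Longrightarrow> \<bar>G i\<bar> \<le> K * m * e"
    and B_sum: "(\<Sum>i\<in>V. \<bar>B V i\<bar>) \<le> K * real n * m * r"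
    and xi_sup: "i < n \<Longrightarrow> j < n \<Longrightarrow> A i j * \<bar>\<xi> i j\<bar> \<le> K * e / \<nu>"
    and avg_h: "i < n \<Longrightarrow> \<bar>\<Sum>j\<in>V-{i}. h i j / Hs i * (B V j / D j)\<bar> \<le> K * \<tau> * r"
    and avg_u: "\<bar>\<Sum>j\<in>V. B V j / D j\<bar> / real n \<le> K * \<tau> * r"
    and T1: "i < n \<Longrightarrow> \<bar>\<Sum>j\<in>V-{i}. A i j * \<xi> i j * a j * x' i j\<bar> \<le> K * m * (\<tau> * Q' i + \<tau>\<^sup>2 * X' i)"
    and T2: "i < n \<Longrightarrow> \<bar>\<Sum>j\<in>V-{i}. (A i j - p) * h i j * x' i j\<bar> \<le> K * m * (\<tau> * Q' i + \<tau>\<^sup>2 * X' i)"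
    and Mx: "i < n \<Longrightarrow> M V x i = B V i" and x_mean: "(\<Sum>i\<in>V. x i) = 0"
    and Mx': "i < n \<Longrightarrow> j < n \<Longrightarrow> j \<noteq> i \<Longrightarrow> M (V-{i}) (x' i) j = B (V-{i}) j"
    and x'_mean: "i < n \<Longrightarrow> (\<Sum>j\<in>V-{i}. x' i j) = 0"
begin

lemma finV: "finite V" by (simp add: V_def)
lemma iV: "i \<in> V \<longleftrightarrow> i < n" by (simp add: V_def)
lemma cardV: "card V = n" by (simp add: V_def)
lemma npos: "0 < real n" using n2 by simp
lemma nu0: "0 < \<nu>" using r0 r_le by linarith
lemma m_eq: "m = 1 / \<nu>\<^sup>2" using m_nu nu0 by (simp add: field_simps)
lemma m0: "0 < m" using nu0 by (simp add: m_eq)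
lemma e0: "0 < e" using r0 lam1 by (simp add: e_def)
lemma tau0: "0 < \<tau>" using nu0 lam1 by (simp add: \<tau>_def)
lemma r_e: "r \<le> e" using r0 lam1 by (simp add: e_def)
lemma nu_tau: "\<nu> \<le> \<tau>" using nu0 lam1 by (simp add: \<tau>_def)
lemma e_tau: "e \<le> \<tau>" unfolding e_def \<tau>_def using r_le lam1 by (intro mult_left_mono) auto

lemma lam_tau: "lam * \<tau>\<^sup>2 = \<sigma>\<^sup>2"
  unfolding sig \<tau>_def by (simp add: power3_eq_cube power2_eq_square)

lemma tau_sig: "\<tau> \<le> \<sigma>"
proof -
  have "\<tau>\<^sup>2 \<le> \<sigma>\<^sup>2" unfolding lam_tau[symmetric] using lam1 mult_right_mono[of 1 lam "\<tau>\<^sup>2"] by simp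
  then show ?thesis using sig0 by (rule power2_le_imp_le)
qed

lemma K_pow: "1 \<le> K ^ k" using K1 by (rule one_le_power)

lemma K_sig: assumes "k \<le> 6" shows "1000 * (K ^ k * \<sigma>) \<le> 1"
proof -
  have "K ^ k * \<sigma> \<le> K ^ 6 * \<sigma>" using K1 assms sig0 by (intro mult_right_mono power_increasing) auto
  then show ?thesis using sig_small by linarith
qed

lemma sig1: "1000 * \<sigma> \<le> 1" using K_sig[of 0] by simp

lemma K_e: assumes "k \<le> 6" shows "1000 * (K ^ k * e) \<le> 1"
proof -
  have "K ^ k * e \<le> K ^ k * \<sigma>" using Kpos e_tau tau_sig by (intro mult_left_mono) auto
  then show ?thesis using K_sig[OF assms] by linarith
qed

lemma K_nu2: assumes "k \<le> 6" shows "1000 * (K ^ k * \<nu>\<^sup>2) \<le> 1"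
proof -
  have "\<nu>\<^sup>2 \<le> \<sigma>" using nu0 nu_tau tau_sig sig1 mult_mono[of \<nu> \<sigma> \<nu> 1] by (simp add: power2_eq_square)
  then have "K ^ k * \<nu>\<^sup>2 \<le> K ^ k * \<sigma>" using Kpos by (intro mult_left_mono) auto
  then show ?thesis using K_sig[OF assms] by linarith
qed

lemma inv_n: "1 / real n \<le> \<nu>\<^sup>2"
  using m_n m0 npos nu0 by (simp add: m_eq field_simps)

lemma inv_sqrt_n: "1 / sqrt (real n) \<le> \<nu>"
proof -
  have "sqrt (1 / real n) \<le> sqrt (\<nu>\<^sup>2)" using inv_n by (rule real_sqrt_le_mono)
  then show ?thesis using nu0 by (simp add: real_sqrt_divide)
qed

section \<open>Mean-square bound and stability under leaving out one item\<close>

definition X where "X = Max ((\<lambda>j. \<bar>x j\<bar>) ` V)"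
definition Q where "Q = L2_set x V / sqrt (real n)"
text \<open>Recentring constant: \<open>x\<close> sums to zero over \<open>V\<close> and hence to
  \<open>- x i\<close> over \<open>V - {i}\<close>, so subtracting \<open>\<alpha> i\<close> makes
  the difference \<open>y i\<close> orthogonal to constants, as the spectral gap requires.\<close>

definition \<alpha> where "\<alpha> i = - x i / (real n - 1)"
definition y where "y i j = x j - x' i j - \<alpha> i"

lemma x_le_X: "i < n \<Longrightarrow> \<bar>x i\<bar> \<le> X"
  unfolding X_def by (rule Max_ge) (auto simp: V_def)
lemma X0: "0 \<le> X" using x_le_X[of 0] n2 by force
lemma X_attained: "\<exists>i<n. X = \<bar>x i\<bar>"
proof -
  have "X \<in> (\<lambda>j. \<bar>x j\<bar>) ` V" unfolding X_def using n2 by (intro Max_in) (auto simp: V_def lessThan_empty_iff)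
  then show ?thesis by (auto simp: V_def)
qed
lemma Q0: "0 \<le> Q" by (simp add: Q_def L2_set_nonneg)

lemma Bsmall: "i < n \<Longrightarrow> \<bar>B V i\<bar> \<le> m / (8 * K\<^sup>2)"
proof -
  assume i: "i < n"
  have "8 * (K ^ 3 * e) \<le> 1" using K_e[of 3] e0 Kpos by simp
  then have "m * (8 * (K ^ 3 * e)) \<le> m * 1" using m0 by (intro mult_left_mono) auto
  then have "K * m * e \<le> m / (8 * K\<^sup>2)" using Kpos by (simp add: field_simps power2_eq_square power3_eq_cube)
  then show ?thesis using B_sup[OF i] by linarith
qed

text \<open>One factor of \<open>(B V i)\<^sup>2\<close> is bounded by the maximum, of order
  \<open>m * e\<close>, the other is summed with \<open>B_sum\<close>, which has \<open>r\<close> in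
  place of \<open>e\<close>. The resulting \<open>e * r\<close> instead of \<open>e\<^sup>2\<close>
  is what \<open>tauQ\<close> needs.\<close>

lemma rms_bound: "Q\<^sup>2 \<le> 64 * K^6 * e * r"
proof -
  have "L2_set x V \<le> 8 * K / (m / K) * L2_set (M V x) V"
  proof (rule L2_stability[OF finV _ gap[OF x_mean]])
    show "0 < m / K" using m0 Kpos by simp
    fix i assume "i \<in> V"
    then have "\<bar>B V i\<bar> \<le> m / (8 * K\<^sup>2)" using Bsmall by (simp add: V_def)
    also have "\<dots> \<le> m / K / (4 * K)" using m0 Kpos by (simp add: field_simps power2_eq_square)
    finally show "\<bar>B V i\<bar> \<le> m / K / (4 * K)" .
  qed
  also have "L2_set (M V x) V = L2_set (B V) V"
    by (rule L2_set_cong) (auto simp: Mx iV)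
  finally have L: "L2_set x V \<le> 8 * K\<^sup>2 / m * L2_set (B V) V"
    using Kpos m0 by (simp add: power2_eq_square)
  have "(L2_set (B V) V)\<^sup>2 = (\<Sum>i\<in>V. \<bar>B V i\<bar> * \<bar>B V i\<bar>)"
    unfolding L2_set_sq by (simp add: power2_eq_square)
  also have "\<dots> \<le> (\<Sum>i\<in>V. K * m * e * \<bar>B V i\<bar>)"
    by (intro sum_mono mult_right_mono) (auto simp: V_def B_sup[unfolded V_def])
  also have "\<dots> = K * m * e * (\<Sum>i\<in>V. \<bar>B V i\<bar>)" by (simp add: sum_distrib_left)
  also have "\<dots> \<le> K * m * e * (K * real n * m * r)"
    using B_sum Kpos m0 e0 by (intro mult_left_mono) auto
  finally have BB: "(L2_set (B V) V)\<^sup>2 \<le> K * m * e * (K * real n * m * r)" .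
  have "(L2_set x V)\<^sup>2 \<le> (8 * K\<^sup>2 / m * L2_set (B V) V)\<^sup>2"
    using L by (intro power_mono) (auto simp: L2_set_nonneg)
  also have "\<dots> = 64 * K^4 / m\<^sup>2 * (L2_set (B V) V)\<^sup>2"
    by (simp add: power_mult_distrib power_divide flip: power_mult)
  also have "\<dots> \<le> 64 * K^4 / m\<^sup>2 * (K * m * e * (K * real n * m * r))"
    using BB by (intro mult_left_mono) auto
  also have "\<dots> = 64 * K^6 * e * r * real n"
    using m0 by (simp add: field_simps eval_nat_numeral)
  finally show ?thesis using npos by (simp add: Q_def power_divide divide_le_eq)
qed

lemma alpha_le: assumes "i < n" shows "\<bar>\<alpha> i\<bar> \<le> 2 * X / real n"
proof -
  have "\<bar>\<alpha> i\<bar> = \<bar>x i\<bar> / (real n - 1)" using n2 by (simp add: \<alpha>_def)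
  also have "\<dots> \<le> X / (real n / 2)"
    using x_le_X[OF assms] n2 X0 by (intro frac_le) auto
  finally show ?thesis by (simp add: mult.commute)
qed

lemma y_mean: assumes "i < n" shows "(\<Sum>j\<in>V-{i}. y i j) = 0"
proof -
  have "(\<Sum>j\<in>V-{i}. x j) = - x i" using x_mean assms finV by (simp add: sum_diff1 V_def)
  moreover have "real (card (V - {i})) = real n - 1" using assms n2 by (simp add: V_def of_nat_diff)
  ultimately show ?thesis using n2 unfolding y_def sum_subtractf by (simp add: x'_mean[OF assms] \<alpha>_def)
qed

lemma B_minus: assumes "i < n" "j \<noteq> i" shows "B (V-{i}) j = B V j - A j i * (a j + a i) * \<xi> j i"
  using assms finV by (simp add: B_def sum_diff1 V_def)

lemma Bsmall': assumes "i < n" "j < n" "j \<noteq> i" shows "\<bar>B (V-{i}) j\<bar> \<le> m / K / (4 * K)"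
proof -
  have xi1: "\<bar>\<xi> j i\<bar> \<le> 1"
  proof -
    have "0 \<le> a j / (a j + a i)" "a j / (a j + a i) \<le> 1" using a_pos[of i] a_pos[of j] by (auto simp: field_simps)
    then show ?thesis using eta_nonneg[of j i] eta_le1[OF assms(3)] by (simp add: \<xi>_def abs_le_iff)
  qed
  have "\<bar>A j i * (a j + a i) * \<xi> j i\<bar> = A j i * (a j + a i) * \<bar>\<xi> j i\<bar>"
    using A_nonneg a_pos[of i] a_pos[of j] by (simp add: abs_mult)
  also have "\<dots> \<le> 1 * (K + K) * 1"
    using A_nonneg A_le1 a_pos[of i] a_pos[of j] a_upper xi1 Kpos by (intro mult_mono add_mono) (auto simp: less_imp_le)
  finally have 1: "\<bar>A j i * (a j + a i) * \<xi> j i\<bar> \<le> 2 * K" by simp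
  have "16 * (K^3 * \<nu>\<^sup>2) \<le> 1" using K_nu2[of 3] Kpos by simp
  then have "2 * K \<le> m / (8 * K\<^sup>2)" using Kpos nu0 by (simp add: m_eq field_simps eval_nat_numeral)
  then have "\<bar>B (V-{i}) j\<bar> \<le> m / (8 * K\<^sup>2) + m / (8 * K\<^sup>2)"
    unfolding B_minus[OF assms(1,3)] using 1 Bsmall[OF assms(2)] by linarith
  then show ?thesis using Kpos by (simp add: field_simps power2_eq_square)
qed

lemma M_minus: assumes "i < n" "j \<noteq> i"
  shows "M (V-{i}) x j = M V x j - A j i * (\<eta> i j * a j * x j - \<eta> j i * a i * x i)"
  using assms finV by (simp add: M_def sum_diff1 V_def)

lemma sum_A_row: assumes "i < n" shows "L2_set (\<lambda>j. A i j) (V-{i}) \<le> sqrt 2 / \<nu>"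
proof -
  have "(\<Sum>j\<in>V-{i}. (A i j)\<^sup>2) \<le> (\<Sum>j\<in>V. A i j)"
    using finV A_nonneg by (simp add: A_sq) (intro sum_mono2, auto)
  also have "\<dots> \<le> 2 / \<nu>\<^sup>2" using deg[OF assms] by (simp add: m_eq)
  finally have "L2_set (\<lambda>j. A i j) (V-{i}) \<le> sqrt (2 / \<nu>\<^sup>2)" unfolding L2_set_def by (rule real_sqrt_le_mono)
  then show ?thesis using nu0 by (simp add: real_sqrt_divide)
qed

lemma sqrt2_le: "sqrt 2 \<le> (3/2 :: real)" by (rule real_le_lsqrt) (auto simp: power2_eq_square)

text \<open>On \<open>V - {i}\<close> both \<open>x\<close> and \<open>x' i\<close> solve nearly the
  same system; it differs only in the edges at \<open>i\<close> and in the recentring. The edge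
  terms live on at most \<open>2 * m\<close> neighbours and have size of order
  \<open>e / \<nu> + X\<close>, so their norm is of order \<open>m * (e + \<nu> * X)\<close>, and
  the gap divides by \<open>m\<close>. The norm is not normalised by \<open>sqrt n\<close>: the
  whole vector \<open>y i\<close> is as small as one entry of \<open>x\<close> was hoped to
  be.\<close>

lemma loo_bound: assumes i: "i < n" shows "L2_set (y i) (V-{i}) \<le> 32 * K^4 * (e + \<nu> * X)"
proof -
  define f where "f j = A i j * ((a j + a i) * \<xi> j i - (\<eta> i j * a j * x j - \<eta> j i * a i * x i))" for j
  \<comment> \<open>Bound for one edge at \<open>i\<close>: the noise of a single comparison is of
    order \<open>e / \<nu>\<close> and has weight \<open>a j + a i\<close>, at most
    \<open>2 * K\<close>; the flows of \<open>x\<close> across the edge add at most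
    \<open>K * X\<close>, since \<open>\<eta> i j + \<eta> j i = 1\<close>.\<close>
  define c where "c = 2 * K\<^sup>2 * e / \<nu> + K * X"
  have c0: "0 \<le> c" using Kpos e0 nu0 X0 by (simp add: c_def)
  have My: "M (V-{i}) (y i) j = f j + \<alpha> i * B (V-{i}) j" if j: "j \<in> V - {i}" for j
  proof -
    have jn: "j < n" "j \<noteq> i" using j by (auto simp: V_def)
    have "M (V-{i}) (y i) j = M (V-{i}) x j - M (V-{i}) (x' i) j + \<alpha> i * B (V-{i}) j"
      unfolding y_def by (rule M_shift)
    then show ?thesis
      unfolding M_minus[OF i jn(2)] Mx'[OF i jn] Mx[OF jn(1)] B_minus[OF i jn(2)] f_def
      by (simp add: A_sym[of j i] algebra_simps)
  qed
  have f_le: "\<bar>f j\<bar> \<le> A i j * c" if j: "j \<in> V - {i}" for j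
  proof -
    have jn: "j < n" "j \<noteq> i" using j by (auto simp: V_def)
    have 1: "A i j * \<bar>(a j + a i) * \<xi> j i\<bar> \<le> 2 * K * (K * e / \<nu>)"
    proof -
      have "A i j * \<bar>(a j + a i) * \<xi> j i\<bar> = (a j + a i) * (A j i * \<bar>\<xi> j i\<bar>)"
        using a_pos[of i] a_pos[of j] by (simp add: abs_mult A_sym[of i j])
      also have "\<dots> \<le> (K + K) * (K * e / \<nu>)"
        using a_upper xi_sup[OF jn(1) i] A_nonneg a_pos[of i] a_pos[of j] Kpos by (intro mult_mono add_mono) auto
      finally show ?thesis by simp
    qed
    have 2: "\<bar>\<eta> i j * a j * x j - \<eta> j i * a i * x i\<bar> \<le> K * X"
    proof -
      have "\<bar>\<eta> i j * a j * x j\<bar> \<le> \<eta> i j * K * X"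
        using eta_nonneg a_pos[of j] a_upper x_le_X[OF jn(1)] Kpos unfolding abs_mult
        by (intro mult_mono) auto
      moreover have "\<bar>\<eta> j i * a i * x i\<bar> \<le> \<eta> j i * K * X"
        using eta_nonneg a_pos[of i] a_upper x_le_X[OF i] Kpos unfolding abs_mult
        by (intro mult_mono) auto
      ultimately have "\<bar>\<eta> i j * a j * x j - \<eta> j i * a i * x i\<bar> \<le> (\<eta> i j + \<eta> j i) * (K * X)"
        by (simp add: algebra_simps)
      then show ?thesis using eta_add[of i j] jn by simp
    qed
    show ?thesis
    proof (cases "A i j = 0")
      case True then show ?thesis by (simp add: f_def)
    next
      case False
      then have "A i j = 1" using A01[of i j] by auto
      then show ?thesis using 1 2 unfolding f_def c_def by (simp add: power2_eq_square algebra_simps)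
    qed
  qed
  have Lf: "L2_set f (V-{i}) \<le> sqrt 2 / \<nu> * c"
  proof -
    have "L2_set f (V-{i}) = L2_set (\<lambda>j. \<bar>f j\<bar>) (V-{i})" by (simp add: L2_set_def)
    also have "\<dots> \<le> L2_set (\<lambda>j. A i j * c) (V-{i})"
      using f_le by (intro L2_set_mono) auto
    also have "\<dots> = L2_set (\<lambda>j. A i j) (V-{i}) * c"
      using c0 by (rule L2_set_left_distrib[symmetric])
    also have "\<dots> \<le> sqrt 2 / \<nu> * c" using sum_A_row[OF i] c0 by (rule mult_right_mono)
    finally show ?thesis .
  qed
  have LB: "L2_set (\<lambda>j. \<alpha> i * B (V-{i}) j) (V-{i}) \<le> X / (2 * \<nu>)"
  proof -
    have "L2_set (\<lambda>j. \<alpha> i * B (V-{i}) j) (V-{i}) \<le> sqrt (real (card (V-{i}))) * (2 * X / real n * (m / 4))"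
    proof (rule L2_set_const_le)
      fix j assume "j \<in> V - {i}"
      then have "\<bar>B (V-{i}) j\<bar> \<le> m / K / (4 * K)" using Bsmall'[OF i] by (auto simp: V_def)
      also have "\<dots> \<le> m / 4"
      proof -
        have "1 \<le> K * K" using K_pow[of 2] by (simp add: power2_eq_square)
        then show ?thesis using m0 Kpos by (simp add: field_simps)
      qed
      finally show "\<bar>\<alpha> i * B (V-{i}) j\<bar> \<le> 2 * X / real n * (m / 4)"
        unfolding abs_mult using alpha_le[OF i] X0 by (intro mult_mono) auto
    qed (use finV X0 m0 in auto)
    also have "\<dots> \<le> sqrt (real n) * (2 * X / real n * (m / 4))"
      using X0 m0 finV cardV by (intro mult_right_mono real_sqrt_le_mono) (auto intro!: card_Diff1_le order_trans[OF card_Diff1_le])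
    also have "\<dots> = X * m / 2 * (1 / sqrt (real n))"
      using npos by (simp add: field_simps flip: real_sqrt_mult)
    also have "\<dots> \<le> X * m / 2 * \<nu>" using inv_sqrt_n X0 m0 by (intro mult_left_mono) auto
    also have "\<dots> = X / (2 * \<nu>)" using nu0 by (simp add: m_eq power2_eq_square)
    finally show ?thesis .
  qed
  have "L2_set (y i) (V-{i}) \<le> 8 * K / (m / K) * L2_set (M (V-{i}) (y i)) (V-{i})"
    by (rule L2_stability[OF _ _ gap'[OF i y_mean[OF i]]])
       (use finV m0 Kpos Bsmall'[OF i] in \<open>auto simp: V_def\<close>)
  also have "L2_set (M (V-{i}) (y i)) (V-{i}) = L2_set (\<lambda>j. f j + \<alpha> i * B (V-{i}) j) (V-{i})"
    by (rule L2_set_cong) (auto simp: My)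
  also have "8 * K / (m / K) * L2_set (\<lambda>j. f j + \<alpha> i * B (V-{i}) j) (V-{i})
     \<le> 8 * K / (m / K) * (sqrt 2 / \<nu> * c + X / (2 * \<nu>))"
    using L2_set_triangle_ineq[of f "\<lambda>j. \<alpha> i * B (V-{i}) j" "V-{i}"] Lf LB Kpos m0
    by (intro mult_left_mono) auto
  also have "8 * K / (m / K) = 8 * K\<^sup>2 * \<nu>\<^sup>2" using Kpos nu0 by (simp add: m_eq power2_eq_square)
  also have "8 * K\<^sup>2 * \<nu>\<^sup>2 * (sqrt 2 / \<nu> * c + X / (2 * \<nu>)) = 8 * K\<^sup>2 * (sqrt 2 * (\<nu> * c) + \<nu> * X / 2)"
    using nu0 by (simp add: field_simps power2_eq_square)
  also have "\<dots> \<le> 8 * K\<^sup>2 * (4 * K\<^sup>2 * (e + \<nu> * X))"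
  proof (rule mult_left_mono)
    have nc: "\<nu> * c = 2 * K\<^sup>2 * e + K * (\<nu> * X)" using nu0 by (simp add: c_def field_simps)
    have "K \<le> K\<^sup>2" using K1 by (simp add: power2_eq_square)
    then have "K * (\<nu> * X) \<le> K\<^sup>2 * (\<nu> * X)" using nu0 X0 by (intro mult_right_mono) auto
    moreover have "1 * (\<nu> * X) \<le> K\<^sup>2 * (\<nu> * X)" using nu0 X0 K_pow[of 2] by (intro mult_right_mono) auto
    moreover have "sqrt 2 * (\<nu> * c) \<le> 3/2 * (\<nu> * c)" using sqrt2_le nu0 c0 by (intro mult_right_mono) auto
    moreover have "0 \<le> K\<^sup>2 * e" "0 \<le> \<nu> * X" using Kpos e0 nu0 X0 by simp_all
    ultimately show "sqrt 2 * (\<nu> * c) + \<nu> * X / 2 \<le> 4 * K\<^sup>2 * (e + \<nu> * X)"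
      unfolding nc by (simp add: algebra_simps)
  qed simp
  finally show ?thesis by (simp add: power2_eq_square eval_nat_numeral algebra_simps)
qed

section \<open>First-order expansion of a single row\<close>

definition g where "g i = (\<Sum>j\<in>V-{i}. h i j * x j) / Hs i"

lemma Hs_lower: assumes "i < n" shows "real n / (4 * K) \<le> Hs i"
proof -
  have "(\<Sum>j\<in>V-{i}. 1 / (2 * K)) \<le> Hs i" unfolding Hs_def by (intro sum_mono h_lower)
  moreover have "(\<Sum>j\<in>V-{i}. 1 / (2 * K)) = (real n - 1) / (2 * K)"
    using assms n2 by (simp add: iV cardV finV of_nat_diff)
  moreover have "real n / (4 * K) \<le> (real n - 1) / (2 * K)"
    using n2 Kpos by (simp add: field_simps)
  ultimately show ?thesis by linarith
qed

lemma Hs0: assumes "i < n" shows "0 < Hs i"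
  using Hs_lower[OF assms] npos Kpos by (auto intro: less_le_trans[rotated])

lemma Hs_g: assumes "i < n" shows "Hs i * g i = (\<Sum>j\<in>V-{i}. h i j * x j)"
  using Hs0[OF assms] by (simp add: g_def)

lemma D0: assumes "i < n" shows "0 < D i"
  using D_low[OF assms] m0 Kpos by (auto intro: less_le_trans[rotated])

text \<open>The two sums over \<open>x' i\<close> have coefficients independent of row
  \<open>i\<close> and are controlled by \<open>T1\<close> and \<open>T2\<close>. The vector
  \<open>y i\<close> does depend on row \<open>i\<close>, but it is small enough for Cauchy-Schwarz.
  The rest is the diagonal noise, which is proportional to \<open>x i\<close>, and the recentring
  constant.\<close>

definition Err where "Err i = x i * a i * G i + (\<Sum>j\<in>V-{i}. A i j * \<xi> i j * a j * x' i j)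
   + (\<Sum>j\<in>V-{i}. (A i j - p) * h i j * x' i j) + \<alpha> i * (\<Sum>j\<in>V-{i}. A i j * (\<eta> i j * a j))
   + (\<Sum>j\<in>V-{i}. A i j * (\<eta> i j * a j) * y i j) - p * (\<Sum>j\<in>V-{i}. h i j * (\<alpha> i + y i j))"

lemma expansion_identity:
  assumes i: "i < n"
  shows "x i * D i = B V i + p * Hs i * g i + Err i"
proof -
  have 1: "(\<Sum>j\<in>V. A i j * (\<eta> j i * a i)) = D i - a i * G i"
  proof -
    have "A i j * (\<eta> j i * a i) = A i j * h i j - a i * (A i j * \<xi> i j)" for j
      using A_diag[of i] xi_antisym[of i j] h_sym[of i j] unfolding eta_mult[of j i]
      by (cases "i = j") (auto simp: algebra_simps)
    then show ?thesis by (simp add: D_def G_def sum_subtractf sum_distrib_left)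
  qed
  have 2: "(\<Sum>j\<in>V. A i j * (\<eta> i j * a j) * x j) = (\<Sum>j\<in>V-{i}. A i j * (\<eta> i j * a j) * x j)"
    using finV i A_diag[of i] by (simp add: sum.remove[of V i] iV)
  have "B V i = (\<Sum>j\<in>V. A i j * (\<eta> j i * a i) * x i - A i j * (\<eta> i j * a j) * x j)"
    unfolding Mx[OF i, symmetric] M_def by (intro sum.cong refl) (simp add: algebra_simps)
  also have "\<dots> = (D i - a i * G i) * x i - (\<Sum>j\<in>V-{i}. A i j * (\<eta> i j * a j) * x j)"
    by (simp add: sum_subtractf 1[symmetric] 2 sum_distrib_right)
  also have "(\<Sum>j\<in>V-{i}. A i j * (\<eta> i j * a j) * x j)
     = (\<Sum>j\<in>V-{i}. A i j * (\<eta> i j * a j) * x' i j) + \<alpha> i * (\<Sum>j\<in>V-{i}. A i j * (\<eta> i j * a j))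
       + (\<Sum>j\<in>V-{i}. A i j * (\<eta> i j * a j) * y i j)"
    unfolding sum_distrib_left sum.distrib[symmetric]
    by (intro sum.cong refl) (simp add: y_def algebra_simps)
  also have "(\<Sum>j\<in>V-{i}. A i j * (\<eta> i j * a j) * x' i j) =
      (\<Sum>j\<in>V-{i}. A i j * \<xi> i j * a j * x' i j) + (\<Sum>j\<in>V-{i}. (A i j - p) * h i j * x' i j)
      + p * (\<Sum>j\<in>V-{i}. h i j * x' i j)"
    unfolding sum_distrib_left sum.distrib[symmetric] eta_mult
    by (intro sum.cong refl) (simp add: algebra_simps)
  also have "(\<Sum>j\<in>V-{i}. h i j * x' i j) = Hs i * g i - (\<Sum>j\<in>V-{i}. h i j * (\<alpha> i + y i j))"
    unfolding Hs_g[OF i] sum_subtractf[symmetric]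
    by (intro sum.cong refl) (simp add: y_def algebra_simps)
  finally show ?thesis unfolding Err_def by (simp add: algebra_simps)
qed

definition Y where "Y = 32 * K^4 * (e + \<nu> * X)"

lemma Y0: "0 \<le> Y" using Kpos e0 nu0 X0 by (simp add: Y_def)

lemma Q'_le: assumes i: "i < n" shows "Q' i \<le> Q + 2 * X * \<nu>\<^sup>2 + \<nu> * Y"
proof -
  have sq: "0 < sqrt (real n)" using npos by simp
  have "L2_set (x' i) (V-{i}) = L2_set (\<lambda>j. (x j - y i j) - \<alpha> i) (V-{i})"
    by (rule L2_set_cong) (auto simp: y_def)
  also have "\<dots> \<le> L2_set x (V-{i}) + L2_set (y i) (V-{i}) + L2_set (\<lambda>_. \<alpha> i) (V-{i})"
    using L2_set_diff_le[of "\<lambda>j. x j - y i j" "\<lambda>_. \<alpha> i" "V-{i}"] L2_set_diff_le[of x "y i" "V-{i}"] by linarith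
  also have "\<dots> \<le> L2_set x V + Y + sqrt (real n) * (2 * X / real n)"
  proof (intro add_mono)
    show "L2_set x (V-{i}) \<le> L2_set x V"
      unfolding L2_set_def using finV by (intro real_sqrt_le_mono sum_mono2) auto
    show "L2_set (y i) (V-{i}) \<le> Y" unfolding Y_def by (rule loo_bound[OF i])
    have "L2_set (\<lambda>_. \<alpha> i) (V-{i}) \<le> sqrt (real (card (V-{i}))) * (2 * X / real n)"
      using alpha_le[OF i] X0 finV by (intro L2_set_const_le) auto
    also have "\<dots> \<le> sqrt (real n) * (2 * X / real n)"
      using X0 finV cardV by (intro mult_right_mono real_sqrt_le_mono) (auto intro!: order_trans[OF card_Diff1_le])
    finally show "L2_set (\<lambda>_. \<alpha> i) (V-{i}) \<le> sqrt (real n) * (2 * X / real n)" .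
  qed
  finally have "Q' i \<le> (L2_set x V + Y + sqrt (real n) * (2 * X / real n)) / sqrt (real n)"
    unfolding Q'_def using sq by (intro divide_right_mono) auto
  also have "\<dots> = Q + Y * (1 / sqrt (real n)) + 2 * X * (1 / real n)"
    using sq by (simp add: Q_def field_simps)
  also have "\<dots> \<le> Q + Y * \<nu> + 2 * X * \<nu>\<^sup>2"
    using inv_sqrt_n inv_n Y0 X0 by (intro add_mono mult_left_mono) auto
  finally show ?thesis by (simp add: algebra_simps)
qed

text \<open>Every entry of \<open>y i\<close> is bounded by the \<open>\<ell>\<^sub>2\<close> norm.
  This is crude, but \<open>X'\<close> only ever occurs with the factor
  \<open>\<tau>\<^sup>2\<close>.\<close>

lemma X'_le: assumes i: "i < n" shows "X' i \<le> 2 * X + Y"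
proof -
  have "V - {i} \<noteq> {}"
  proof -
    have "(if i = 0 then 1 else 0) \<in> V - {i}" using n2 i by (auto simp: iV)
    then show ?thesis by blast
  qed
  moreover have "\<bar>x' i j\<bar> \<le> 2 * X + Y" if j: "j \<in> V - {i}" for j
  proof -
    have "\<bar>x j\<bar> \<le> X" using j x_le_X by (auto simp: iV)
    moreover have "\<bar>y i j\<bar> \<le> Y"
    proof -
      have "\<bar>y i j\<bar> \<le> L2_set (\<lambda>j. \<bar>y i j\<bar>) (V-{i})"
        using j finV by (intro member_le_L2_set) auto
      also have "\<dots> = L2_set (y i) (V-{i})" by (simp add: L2_set_def)
      also have "\<dots> \<le> Y" unfolding Y_def by (rule loo_bound[OF i])
      finally show ?thesis .
    qed
    moreover have "\<bar>\<alpha> i\<bar> \<le> X"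
    proof -
      have "2 * X / real n \<le> X" using n2 X0 mult_right_mono[of 2 "real n" X] by (simp add: field_simps)
      then show ?thesis using alpha_le[OF i] by linarith
    qed
    moreover have "x' i j = x j - y i j - \<alpha> i" by (simp add: y_def)
    ultimately show ?thesis by linarith
  qed
  ultimately show ?thesis unfolding X'_def using finV by (subst Max_le_iff) auto
qed

lemma sum_abs_x: "(\<Sum>j\<in>V. \<bar>x j\<bar>) \<le> real n * Q"
proof -
  have "(\<Sum>j\<in>V. \<bar>x j\<bar> * \<bar>1\<bar>) \<le> L2_set x V * L2_set (\<lambda>_. 1) V" by (rule L2_set_mult_ineq)
  also have "L2_set (\<lambda>_. 1) V = sqrt (real n)" by (simp add: L2_set_def cardV)
  also have "L2_set x V * sqrt (real n) = L2_set x V * (real n / sqrt (real n))"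
    using npos by (simp add: real_div_sqrt)
  finally show ?thesis by (simp add: Q_def mult.commute)
qed

lemma H_average_le:
  assumes i: "i < n" and f: "\<And>j. 0 \<le> f j"
  shows "(\<Sum>j\<in>V-{i}. h i j * f j) / Hs i \<le> 4 * K\<^sup>2 / real n * (\<Sum>j\<in>V. f j)"
proof -
  have "(\<Sum>j\<in>V-{i}. h i j * f j) \<le> (\<Sum>j\<in>V-{i}. K * f j)"
    using h_upper f by (intro sum_mono mult_right_mono) auto
  also have "\<dots> \<le> (\<Sum>j\<in>V. K * f j)"
    using finV f Kpos by (intro sum_mono2) auto
  finally have 1: "(\<Sum>j\<in>V-{i}. h i j * f j) \<le> K * (\<Sum>j\<in>V. f j)" by (simp add: sum_distrib_left)
  have "(\<Sum>j\<in>V-{i}. h i j * f j) / Hs i \<le> K * (\<Sum>j\<in>V. f j) / (real n / (4 * K))"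
    using 1 Hs_lower[OF i] npos Kpos f h_pos by (intro frac_le) (auto intro!: mult_nonneg_nonneg sum_nonneg simp: less_imp_le)
  also have "\<dots> = 4 * K\<^sup>2 / real n * (\<Sum>j\<in>V. f j)" using Kpos npos by (simp add: field_simps power2_eq_square)
  finally show ?thesis .
qed

lemma g_le: assumes i: "i < n" shows "\<bar>g i\<bar> \<le> 4 * K\<^sup>2 * Q"
proof -
  have "\<bar>g i\<bar> \<le> (\<Sum>j\<in>V-{i}. h i j * \<bar>x j\<bar>) / Hs i"
    unfolding g_def abs_divide using Hs0[OF i] h_pos
    by (auto intro!: divide_right_mono order_trans[OF sum_abs] simp: abs_mult less_imp_le)
  also have "\<dots> \<le> 4 * K\<^sup>2 / real n * (\<Sum>j\<in>V. \<bar>x j\<bar>)" by (rule H_average_le[OF i]) simp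
  also have "\<dots> \<le> 4 * K\<^sup>2 / real n * (real n * Q)" using sum_abs_x by (intro mult_left_mono) auto
  finally show ?thesis using npos by simp
qed

lemma Err_le:
  assumes i: "i < n"
  shows "\<bar>Err i\<bar> \<le> m * (K\<^sup>2 * e * \<bar>x i\<bar> + 2 * K * (\<tau> * Q' i + \<tau>\<^sup>2 * X' i) + 6 * K * X * \<nu>\<^sup>2 + 3 * K * \<nu> * Y)"
proof -
  have y: "L2_set (y i) (V-{i}) \<le> Y" unfolding Y_def by (rule loo_bound[OF i])
  have eta_a: "\<bar>A i j * (\<eta> i j * a j)\<bar> \<le> K * A i j" for j
  proof (cases "i = j")
    case False
    have "\<eta> i j * a j \<le> 1 * K" using eta_le1[OF False] a_upper a_pos[of j] eta_nonneg
      by (intro mult_mono) (auto simp: less_imp_le)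
    then have "A i j * (\<eta> i j * a j) \<le> A i j * K" using A_nonneg by (intro mult_left_mono) auto
    then show ?thesis using A_nonneg[of i j] eta_nonneg[of i j] a_pos[of j] by (simp add: mult.commute)
  qed (simp add: A_diag)
  have t0: "\<bar>x i * a i * G i\<bar> \<le> m * (K\<^sup>2 * e * \<bar>x i\<bar>)"
  proof -
    have "\<bar>x i * a i * G i\<bar> = \<bar>x i\<bar> * (a i * \<bar>G i\<bar>)" using a_pos[of i] by (simp add: abs_mult)
    also have "\<dots> \<le> \<bar>x i\<bar> * (K * (K * m * e))"
      using a_pos[of i] a_upper G_sup[OF i] Kpos by (intro mult_left_mono mult_mono) auto
    finally show ?thesis by (simp add: power2_eq_square algebra_simps)
  qed
  have t3: "\<bar>\<alpha> i * (\<Sum>j\<in>V-{i}. A i j * (\<eta> i j * a j))\<bar> \<le> m * (4 * K * X * \<nu>\<^sup>2)"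
  proof -
    have "\<bar>\<Sum>j\<in>V-{i}. A i j * (\<eta> i j * a j)\<bar> \<le> (\<Sum>j\<in>V-{i}. K * A i j)"
      using eta_a by (intro order_trans[OF sum_abs] sum_mono) auto
    also have "\<dots> \<le> (\<Sum>j\<in>V. K * A i j)" using finV A_nonneg Kpos by (intro sum_mono2) auto
    also have "\<dots> \<le> K * (2 * m)" unfolding sum_distrib_left[symmetric] using deg[OF i] Kpos by (intro mult_left_mono) auto
    finally have "\<bar>\<alpha> i * (\<Sum>j\<in>V-{i}. A i j * (\<eta> i j * a j))\<bar> \<le> 2 * X / real n * (K * (2 * m))"
      unfolding abs_mult using alpha_le[OF i] X0 by (intro mult_mono) auto
    also have "\<dots> = 4 * K * X * m * (1 / real n)" by simp
    also have "\<dots> \<le> 4 * K * X * m * \<nu>\<^sup>2" using inv_n Kpos X0 m0 by (intro mult_left_mono) auto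
    finally show ?thesis by (simp add: algebra_simps)
  qed
  have t4: "\<bar>\<Sum>j\<in>V-{i}. A i j * (\<eta> i j * a j) * y i j\<bar> \<le> m * (2 * K * \<nu> * Y)"
  proof -
    have "\<bar>\<Sum>j\<in>V-{i}. A i j * (\<eta> i j * a j) * y i j\<bar> \<le> L2_set (\<lambda>j. A i j * (\<eta> i j * a j)) (V-{i}) * L2_set (y i) (V-{i})"
      by (rule abs_sum_mult_le_L2_set)
    also have "\<dots> \<le> (K * (sqrt 2 / \<nu>)) * Y"
    proof (rule mult_mono[OF _ y])
      have "L2_set (\<lambda>j. A i j * (\<eta> i j * a j)) (V-{i}) = L2_set (\<lambda>j. \<bar>A i j * (\<eta> i j * a j)\<bar>) (V-{i})"
        by (simp add: L2_set_def)
      also have "\<dots> \<le> L2_set (\<lambda>j. K * A i j) (V-{i})" using eta_a by (intro L2_set_mono) auto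
      also have "\<dots> = K * L2_set (\<lambda>j. A i j) (V-{i})" using Kpos by (intro L2_set_right_distrib[symmetric]) auto
      also have "\<dots> \<le> K * (sqrt 2 / \<nu>)" using sum_A_row[OF i] Kpos by (intro mult_left_mono) auto
      finally show "L2_set (\<lambda>j. A i j * (\<eta> i j * a j)) (V-{i}) \<le> K * (sqrt 2 / \<nu>)" .
    qed (use Kpos nu0 in \<open>auto simp: L2_set_nonneg\<close>)
    also have "\<dots> \<le> (K * (2 / \<nu>)) * Y"
      using sqrt2_le Kpos nu0 Y0 by (intro mult_right_mono mult_left_mono divide_right_mono) auto
    finally show ?thesis using nu0 by (simp add: m_eq field_simps power2_eq_square)
  qed
  have t5: "\<bar>p * (\<Sum>j\<in>V-{i}. h i j * (\<alpha> i + y i j))\<bar> \<le> m * (K * (2 * X * \<nu>\<^sup>2 + \<nu> * Y))"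
  proof -
    have c: "real (card (V-{i})) \<le> real n" using finV cardV by (auto intro!: order_trans[OF card_Diff1_le])
    have ys: "(\<Sum>j\<in>V-{i}. \<bar>y i j\<bar>) \<le> sqrt (real n) * Y"
    proof -
      have "(\<Sum>j\<in>V-{i}. \<bar>y i j\<bar> * \<bar>1\<bar>) \<le> L2_set (y i) (V-{i}) * L2_set (\<lambda>_. 1) (V-{i})" by (rule L2_set_mult_ineq)
      also have "\<dots> \<le> Y * sqrt (real n)"
        using y c Y0 by (intro mult_mono) (auto simp: L2_set_def)
      finally show ?thesis by (simp add: mult.commute)
    qed
    have "\<bar>\<Sum>j\<in>V-{i}. h i j * (\<alpha> i + y i j)\<bar> \<le> (\<Sum>j\<in>V-{i}. K * (2 * X / real n + \<bar>y i j\<bar>))"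
    proof (intro order_trans[OF sum_abs] sum_mono)
      fix j
      have "\<bar>\<alpha> i + y i j\<bar> \<le> 2 * X / real n + \<bar>y i j\<bar>" using alpha_le[OF i] by linarith
      then show "\<bar>h i j * (\<alpha> i + y i j)\<bar> \<le> K * (2 * X / real n + \<bar>y i j\<bar>)"
        unfolding abs_mult using h_upper[of i j] h_pos[of i j] Kpos by (intro mult_mono) auto
    qed
    also have "\<dots> = K * (real (card (V-{i})) * (2 * X / real n) + (\<Sum>j\<in>V-{i}. \<bar>y i j\<bar>))"
      by (simp only: sum_distrib_left[symmetric] sum.distrib sum_constant)
    also have "\<dots> \<le> K * (real n * (2 * X / real n) + sqrt (real n) * Y)"
      using c ys X0 Kpos by (intro mult_left_mono add_mono mult_right_mono) auto
    finally have "\<bar>p * (\<Sum>j\<in>V-{i}. h i j * (\<alpha> i + y i j))\<bar> \<le> p * (K * (real n * (2 * X / real n) + sqrt (real n) * Y))"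
      unfolding abs_mult using p0 by (auto intro!: mult_left_mono)
    also have "\<dots> = m * (K * (2 * X * (1 / real n) + (1 / sqrt (real n)) * Y))"
      using npos by (simp add: m_p field_simps flip: real_sqrt_mult)
    also have "\<dots> \<le> m * (K * (2 * X * \<nu>\<^sup>2 + \<nu> * Y))"
      using inv_n inv_sqrt_n m0 Kpos X0 Y0 by (intro mult_left_mono add_mono mult_right_mono) auto
    finally show ?thesis .
  qed
  have "\<bar>Err i\<bar> \<le> m * (K\<^sup>2 * e * \<bar>x i\<bar>) + K * m * (\<tau> * Q' i + \<tau>\<^sup>2 * X' i) + K * m * (\<tau> * Q' i + \<tau>\<^sup>2 * X' i)
     + m * (4 * K * X * \<nu>\<^sup>2) + m * (2 * K * \<nu> * Y) + m * (K * (2 * X * \<nu>\<^sup>2 + \<nu> * Y))"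
    unfolding Err_def using t0 t3 t4 t5 T1[OF i] T2[OF i] by linarith
  then show ?thesis by (simp add: algebra_simps)
qed

text \<open>Error of a row in units of \<open>m\<close>: the variance part and the range part of the
  Bernstein bounds, and the leave-one-out difference seen through a row, of order
  \<open>\<nu> * Y\<close>.\<close>

definition rem where "rem = \<tau> * Q + \<tau>\<^sup>2 * (X + e) + \<nu> * e"

lemma rem0: "0 \<le> rem" using tau0 Q0 X0 e0 nu0 by (simp add: rem_def)

lemma Err_le':
  assumes i: "i < n"
  shows "\<bar>Err i\<bar> \<le> m * (K\<^sup>2 * e * \<bar>x i\<bar> + 240 * K^5 * rem)"
proof -
  have tau1: "\<tau> \<le> 1" using tau_sig sig1 sig0 by linarith
  have nt2: "\<nu>\<^sup>2 \<le> \<tau>\<^sup>2" using nu_tau nu0 by (intro power_mono) auto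
  have KK: "K \<le> K^5" "1 \<le> K^4" using power_increasing[of 1 5 K] K1 K_pow by auto
  have tnu: "\<tau> * \<nu> \<le> \<tau>\<^sup>2" using nu_tau tau0 by (simp add: power2_eq_square)
  have nX: "e + \<nu> * X \<le> X + e" using nu_tau tau1 X0 nu0 mult_right_mono[of \<nu> 1 X] by simp
  have tY: "\<tau>\<^sup>2 * Y \<le> 32 * K^4 * (\<tau>\<^sup>2 * (X + e))"
    unfolding Y_def using nX Kpos mult_left_mono[OF nX, of "32 * K^4 * \<tau>\<^sup>2"] by (simp add: algebra_simps)
  have a: "\<tau> * Q' i + \<tau>\<^sup>2 * X' i \<le> \<tau> * Q + 68 * K^4 * (\<tau>\<^sup>2 * (X + e))"
  proof -
    have "\<tau> * Q' i \<le> \<tau> * (Q + 2 * X * \<nu>\<^sup>2 + \<nu> * Y)" using Q'_le[OF i] tau0 by (intro mult_left_mono) auto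
    also have "\<dots> = \<tau> * Q + \<tau> * \<nu>\<^sup>2 * (2 * X) + \<tau> * \<nu> * Y" by (simp add: algebra_simps)
    also have "\<dots> \<le> \<tau> * Q + \<tau>\<^sup>2 * (2 * X) + \<tau>\<^sup>2 * Y"
    proof (intro add_mono mult_right_mono)
      show "\<tau> * \<nu>\<^sup>2 \<le> \<tau>\<^sup>2" using nt2 tau1 tau0 mult_mono[of \<tau> 1 "\<nu>\<^sup>2" "\<tau>\<^sup>2"] by simp
    qed (use tnu X0 Y0 Q0 in auto)
    finally have 1: "\<tau> * Q' i \<le> \<tau> * Q + \<tau>\<^sup>2 * (2 * X) + \<tau>\<^sup>2 * Y" .
    have 2: "\<tau>\<^sup>2 * X' i \<le> \<tau>\<^sup>2 * (2 * X) + \<tau>\<^sup>2 * Y"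
      using mult_left_mono[OF X'_le[OF i], of "\<tau>\<^sup>2"] by (simp add: algebra_simps)
    have 3: "\<tau>\<^sup>2 * X \<le> K^4 * (\<tau>\<^sup>2 * (X + e))"
    proof -
      have "\<tau>\<^sup>2 * X \<le> \<tau>\<^sup>2 * (X + e)" using e0 by (intro mult_left_mono) auto
      also have "\<dots> \<le> K^4 * (\<tau>\<^sup>2 * (X + e))" using mult_right_mono[OF KK(2), of "\<tau>\<^sup>2 * (X + e)"] X0 e0 by simp
      finally show ?thesis .
    qed
    show ?thesis using 1 2 3 tY by linarith
  qed
  define S where "S = \<tau>\<^sup>2 * (X + e)"
  have S0: "0 \<le> S" using X0 e0 by (simp add: S_def)
  have ne0: "0 \<le> \<nu> * e" using nu0 e0 by simp
  have tQ0: "0 \<le> \<tau> * Q" using tau0 Q0 by simp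
  have c: "X * \<nu>\<^sup>2 \<le> S" unfolding S_def using nt2 X0 e0 by (subst mult.commute) (intro mult_mono, auto)
  have b: "\<nu> * Y \<le> 32 * K^4 * (\<nu> * e + S)"
  proof -
    have "\<nu> * Y = 32 * K^4 * (\<nu> * e + \<nu>\<^sup>2 * X)" by (simp add: Y_def algebra_simps power2_eq_square)
    also have "\<dots> \<le> 32 * K^4 * (\<nu> * e + S)"
      using Kpos c by (intro mult_left_mono add_left_mono) (auto simp: mult.commute)
    finally show ?thesis .
  qed
  have "2 * K * (\<tau> * Q' i + \<tau>\<^sup>2 * X' i) \<le> 2 * K * (\<tau> * Q + 68 * K^4 * S)"
    using a Kpos unfolding S_def by (intro mult_left_mono) auto
  also have "\<dots> = 2 * (K * (\<tau> * Q)) + 136 * (K^5 * S)" by (simp add: eval_nat_numeral algebra_simps)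
  also have "\<dots> \<le> 2 * (K^5 * (\<tau> * Q)) + 136 * (K^5 * S)"
    using mult_right_mono[OF KK(1) tQ0] by simp
  finally have A1: "2 * K * (\<tau> * Q' i + \<tau>\<^sup>2 * X' i) \<le> 2 * (K^5 * (\<tau> * Q)) + 136 * (K^5 * S)" .
  have "6 * K * (X * \<nu>\<^sup>2) \<le> 6 * K^5 * S" using c KK Kpos X0 by (intro mult_mono) auto
  then have A2: "6 * K * X * \<nu>\<^sup>2 \<le> 6 * (K^5 * S)" by (simp add: algebra_simps)
  have "3 * K * (\<nu> * Y) \<le> 3 * K * (32 * K^4 * (\<nu> * e + S))" using b Kpos by (intro mult_left_mono) auto
  then have A3: "3 * K * \<nu> * Y \<le> 96 * (K^5 * (\<nu> * e)) + 96 * (K^5 * S)"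
    by (simp add: eval_nat_numeral algebra_simps)
  have nn: "0 \<le> K^5 * (\<tau> * Q)" "0 \<le> K^5 * S" "0 \<le> K^5 * (\<nu> * e)" using Kpos S0 ne0 tQ0 by auto
  have R: "240 * K^5 * rem = 240 * (K^5 * (\<tau> * Q)) + 240 * (K^5 * S) + 240 * (K^5 * (\<nu> * e))"
    by (simp add: rem_def S_def algebra_simps)
  \<comment> \<open>The coefficients of \<open>K^5 * S\<close> add up to 136 + 6 + 96 = 238, rounded
    up to 240.\<close>
  have "K\<^sup>2 * e * \<bar>x i\<bar> + 2 * K * (\<tau> * Q' i + \<tau>\<^sup>2 * X' i) + 6 * K * X * \<nu>\<^sup>2 + 3 * K * \<nu> * Y
     \<le> K\<^sup>2 * e * \<bar>x i\<bar> + 240 * K^5 * rem"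
    using A1 A2 A3 nn unfolding R by linarith
  then show ?thesis using m0 by (intro order_trans[OF Err_le[OF i]] mult_left_mono) auto
qed

end

text \<open>At a maximiser of \<open>g\<close>, split the uniform weight \<open>c / N\<close> off
  every entry of the row. The other weights stay nonnegative, so the row average is at most
  \<open>1 - c\<close> times the maximum plus \<open>c\<close> times the mean, and the maximum
  exceeds the mean by at most \<open>s / c\<close>. The lower bound is the same statement for
  \<open>- g\<close>.\<close>

lemma doeblin_deviation:
  fixes W :: "'a \<Rightarrow> 'a \<Rightarrow> real" and g :: "'a \<Rightarrow> real"
  assumes fin: "finite V" and c0: "0 < c"
    and row: "\<And>i. i \<in> V \<Longrightarrow> (\<Sum>j\<in>V-{i}. W i j) = 1"
    and low: "\<And>i j. i \<in> V \<Longrightarrow> j \<in> V \<Longrightarrow> j \<noteq> i \<Longrightarrow> c / real (card V) \<le> W i j"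
    and fixpt: "\<And>i. i \<in> V \<Longrightarrow> \<bar>g i - (\<Sum>j\<in>V-{i}. W i j * g j)\<bar> \<le> s"
    and i: "i \<in> V"
  shows "\<bar>g i - (\<Sum>j\<in>V. g j) / real (card V)\<bar> \<le> s / c"
proof -
  have upper: "g i \<le> (\<Sum>j\<in>V. g j) / real (card V) + s / c"
    if fixpt: "\<And>i. i \<in> V \<Longrightarrow> g i - (\<Sum>j\<in>V-{i}. W i j * g j) \<le> s" and i: "i \<in> V" for g :: "'a \<Rightarrow> real" and i
  proof -
    define N where "N = real (card V)"
    have N: "N > 0" using i fin by (auto simp: N_def card_gt_0_iff)
    have "Max (g ` V) \<in> g ` V" using i fin by (intro Max_in) auto
    then obtain k where k: "k \<in> V" "g k = Max (g ` V)" by auto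
    have mx: "g j \<le> g k" if "j \<in> V" for j using k that fin by auto
    have Nk: "real (card (V-{k})) = N - 1"
      using k fin N by (simp add: N_def of_nat_diff Suc_leI card_gt_0_iff)
    have "(\<Sum>j\<in>V-{k}. W k j * g j) = (\<Sum>j\<in>V-{k}. (W k j - c / N) * g j) + c / N * (\<Sum>j\<in>V-{k}. g j)"
      by (simp add: sum_distrib_left sum.distrib[symmetric] algebra_simps)
    also have "(\<Sum>j\<in>V-{k}. (W k j - c / N) * g j) \<le> (\<Sum>j\<in>V-{k}. (W k j - c / N) * g k)"
      using low[OF k(1)] mx by (intro sum_mono mult_left_mono) (auto simp: N_def)
    also have "\<dots> = (1 - c / N * (N - 1)) * g k"
      using row[OF k(1)] Nk by (simp add: sum_subtractf flip: sum_distrib_right)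
    also have "(\<Sum>j\<in>V-{k}. g j) = (\<Sum>j\<in>V. g j) - g k" using k fin by (simp add: sum_diff1)
    finally have "(\<Sum>j\<in>V-{k}. W k j * g j) \<le> (1 - c / N * (N - 1)) * g k + c / N * ((\<Sum>j\<in>V. g j) - g k)"
      by simp
    \<comment> \<open>The row has no diagonal entry, so the uniform part misses the summand of
      \<open>k\<close>. The two resulting terms \<open>c / N * g k\<close> cancel, which leaves the
      full mean over \<open>V\<close>.\<close>
    also have "\<dots> = (1 - c) * g k + c / N * (\<Sum>j\<in>V. g j)" using N by (simp add: field_simps)
    finally have "c * g k \<le> s + c / N * (\<Sum>j\<in>V. g j)" using fixpt[OF k(1)] by (simp add: algebra_simps)
    then have "g k \<le> (\<Sum>j\<in>V. g j) / N + s / c" using c0 N by (simp add: field_simps)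
    then show ?thesis using mx[OF i] by (simp add: N_def)
  qed
  have 1: "g i \<le> (\<Sum>j\<in>V. g j) / real (card V) + s / c"
    using fixpt by (intro upper i) (auto simp: abs_le_iff)
  have 2: "- g i \<le> (\<Sum>j\<in>V. - g j) / real (card V) + s / c"
  proof (rule upper[OF _ i])
    fix i assume "i \<in> V"
    then show "- g i - (\<Sum>j\<in>V-{i}. W i j * - g j) \<le> s" using fixpt[of i] by (simp add: sum_negf abs_le_iff)
  qed
  show ?thesis using 1 2 by (simp add: abs_le_iff sum_negf)
qed

section \<open>Removal of the neighbourhood averages and passage to logarithms\<close>

context good_sample begin

text \<open>Divide the row identity by \<open>D i\<close>. Replacing \<open>p * Hs i\<close> by
  \<open>D i\<close> has relative cost \<open>\<tau>\<close> and only affects the term with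
  \<open>g i\<close>, itself of order \<open>Q\<close>, so it is covered by the part
  \<open>\<tau> * Q\<close> of \<open>rem\<close>.\<close>

lemma first_order:
  assumes i: "i < n"
  shows "\<bar>x i - B V i / D i - g i\<bar> \<le> 244 * K^6 * (e * \<bar>x i\<bar> + rem)"
proof -
  have Di: "0 < D i" by (rule D0[OF i])
  have eq: "x i - B V i / D i - g i = g i * (p * Hs i - D i) / D i + Err i / D i"
    using expansion_identity[OF i] Di by (simp add: field_simps)
  have inv: "\<bar>u / D i\<bar> \<le> K * c" if "\<bar>u\<bar> \<le> m * c" "0 \<le> c" for u c
  proof -
    have "\<bar>u / D i\<bar> \<le> m * c / (m / K)" unfolding abs_divide using that Di D_low[OF i] m0 Kpos
      by (intro frac_le) auto
    then show ?thesis using m0 Kpos by (simp add: field_simps)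
  qed
  have "\<bar>g i * (p * Hs i - D i)\<bar> \<le> (4 * K\<^sup>2 * Q) * (K * \<tau> * m)"
    unfolding abs_mult using g_le[OF i] D_conc[OF i] Q0 by (intro mult_mono) auto
  also have "\<dots> = m * (4 * K^3 * (\<tau> * Q))" by (simp add: eval_nat_numeral algebra_simps)
  finally have 1: "\<bar>g i * (p * Hs i - D i) / D i\<bar> \<le> K * (4 * K^3 * (\<tau> * Q))"
    using tau0 Q0 Kpos by (intro inv) auto
  have 2: "\<bar>Err i / D i\<bar> \<le> K * (K\<^sup>2 * e * \<bar>x i\<bar> + 240 * K^5 * rem)"
    using e0 rem0 Kpos by (intro inv[OF Err_le'[OF i]]) auto
  have tQ: "0 \<le> \<tau> * Q" "\<tau> * Q \<le> rem" using tau0 Q0 X0 e0 nu0 by (auto simp: rem_def)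
  have "K^4 * (\<tau> * Q) \<le> K^6 * rem" using K1 tQ by (intro mult_mono power_increasing) auto
  then have one: "\<bar>g i * (p * Hs i - D i) / D i\<bar> \<le> 4 * (K^6 * rem)"
    using 1 by (simp add: eval_nat_numeral algebra_simps)
  have "K^3 * (e * \<bar>x i\<bar>) \<le> K^6 * (e * \<bar>x i\<bar>)" using K1 e0 by (intro mult_right_mono power_increasing) auto
  moreover have "0 \<le> K^6 * (e * \<bar>x i\<bar>)" using Kpos e0 by simp
  moreover have "\<bar>Err i / D i\<bar> \<le> K^3 * (e * \<bar>x i\<bar>) + 240 * (K^6 * rem)"
    using 2 by (simp add: eval_nat_numeral algebra_simps)
  ultimately have "\<bar>g i * (p * Hs i - D i) / D i\<bar> + \<bar>Err i / D i\<bar> \<le> 244 * (K^6 * (e * \<bar>x i\<bar>)) + 244 * (K^6 * rem)"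
    using one by simp
  then have "\<bar>x i - B V i / D i - g i\<bar> \<le> 244 * (K^6 * (e * \<bar>x i\<bar>)) + 244 * (K^6 * rem)"
    unfolding eq by (rule order_trans[OF abs_triangle_ineq])
  then show ?thesis by (simp add: algebra_simps)
qed

lemma BD_le: assumes i: "i < n" shows "\<bar>B V i / D i\<bar> \<le> K\<^sup>2 * e"
proof -
  have "\<bar>B V i / D i\<bar> \<le> K * m * e / (m / K)"
    unfolding abs_divide using B_sup[OF i] D_low[OF i] D0[OF i] m0 Kpos e0 by (intro frac_le) auto
  then show ?thesis using m0 Kpos by (simp add: power2_eq_square field_simps)
qed

lemma Q_e: "Q \<le> 8 * K^3 * e"
proof (rule power2_le_imp_le)
  have "Q\<^sup>2 \<le> 64 * K^6 * e * r" by (rule rms_bound)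
  also have "\<dots> \<le> 64 * K^6 * e * e" using r_e Kpos e0 by (intro mult_left_mono) auto
  finally show "Q\<^sup>2 \<le> (8 * K^3 * e)\<^sup>2" by (simp add: power2_eq_square eval_nat_numeral algebra_simps)
qed (use Kpos e0 in auto)

text \<open>A self-bounding estimate at an index where the maximum is attained: since
  \<open>1000 * K^6 * \<sigma> \<le> 1\<close>, each of the two occurrences of \<open>X\<close> on
  the right has a coefficient of at most 1/4.\<close>

lemma sup_bound: "X \<le> 81 * K^5 * e"
proof -
  obtain i where i: "i < n" "X = \<bar>x i\<bar>" using X_attained by blast
  have tau1: "\<tau> \<le> 1" using tau_sig sig1 sig0 by linarith
  have K6: "1000 * (K^6 * \<tau>) \<le> 1"
  proof -
    have "K^6 * \<tau> \<le> K^6 * \<sigma>" using tau_sig Kpos by (intro mult_left_mono) auto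
    then show ?thesis using K_sig[of 6] by simp
  qed
  have shrink: "244 * K^6 * (t * z) \<le> z / 4" if "0 \<le> t" "t \<le> \<tau>" "0 \<le> z" for t z
  proof -
    have "K^6 * t \<le> K^6 * \<tau>" using that Kpos by (intro mult_left_mono) auto
    then have "K^6 * t \<le> 1/1000" using K6 by linarith
    then have "K^6 * t * z \<le> 1/1000 * z" using that by (intro mult_right_mono) auto
    then show ?thesis using that by (simp add: algebra_simps)
  qed
  have e: "244 * K^6 * (e * X) \<le> X / 4" using e0 e_tau X0 by (intro shrink) auto
  have t: "244 * K^6 * (\<tau> * Q) \<le> Q / 4" using tau0 Q0 by (intro shrink) auto
  have t2: "244 * K^6 * (\<tau>\<^sup>2 * (X + e)) \<le> (X + e) / 4"
    using tau0 tau1 X0 e0 by (intro shrink) (auto simp: power2_eq_square mult_left_le)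
  have ne: "244 * K^6 * (\<nu> * e) \<le> e / 4" using nu0 nu_tau e0 by (intro shrink) auto
  have rm: "244 * K^6 * rem = 244 * K^6 * (\<tau> * Q) + 244 * K^6 * (\<tau>\<^sup>2 * (X + e)) + 244 * K^6 * (\<nu> * e)"
    by (simp add: rem_def algebra_simps)
  have fo: "\<bar>x i - B V i / D i - g i\<bar> \<le> 244 * K^6 * (e * X + rem)"
    using first_order[OF i(1)] i(2) by simp
  have "244 * K^6 * (e * X + rem) = 244 * K^6 * (e * X) + 244 * K^6 * rem" by (simp add: algebra_simps)
  then have "X \<le> K\<^sup>2 * e + 4 * (K\<^sup>2 * Q) + (X / 4 + (Q / 4 + (X + e) / 4 + e / 4))"
    using fo BD_le[OF i(1)] g_le[OF i(1), unfolded mult.assoc] e t t2 ne rm i(2) by linarith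
  then have X1: "X \<le> 2 * (K\<^sup>2 * e) + 8 * (K\<^sup>2 * Q) + Q / 2 + e" by (simp add: field_simps)
  have "1 * e \<le> K\<^sup>2 * e" using K_pow[of 2] e0 by (intro mult_right_mono) auto
  moreover have "1 * Q \<le> K\<^sup>2 * Q" using K_pow[of 2] Q0 by (intro mult_right_mono) auto
  ultimately have X2: "X \<le> 3 * (K\<^sup>2 * e) + (17/2) * (K\<^sup>2 * Q)" using X1 by linarith
  have "K\<^sup>2 * Q \<le> K\<^sup>2 * (8 * K^3 * e)" using Q_e by (intro mult_left_mono) auto
  then have q: "K\<^sup>2 * Q \<le> 8 * (K^5 * e)" by (simp add: eval_nat_numeral algebra_simps)
  have "K\<^sup>2 * e \<le> K^5 * e" using K1 e0 by (intro mult_right_mono power_increasing) auto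
  then have "X \<le> 71 * (K^5 * e)" using X2 q by linarith
  moreover have "0 \<le> K^5 * e" using Kpos e0 by simp
  ultimately show ?thesis by linarith
qed

lemma x_half: assumes "i < n" shows "\<bar>x i\<bar> \<le> 1/2"
  using x_le_X[OF assms] sup_bound K_e[of 5] e0 Kpos by simp

text \<open>With \<open>Q\<^sup>2\<close> of order \<open>e * r\<close> and
  \<open>e = lam * r\<close>, the square of the left side is of order
  \<open>lam * \<tau>\<^sup>2 * r\<^sup>2\<close>, and \<open>lam * \<tau>\<^sup>2\<close> is
  \<open>\<sigma>\<^sup>2\<close>. The weaker \<open>Q_e\<close> would leave an additional factor
  \<open>sqrt lam\<close>.\<close>

lemma tauQ: "\<tau> * Q \<le> 8 * K^3 * (\<sigma> * r)"
proof (rule power2_le_imp_le)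
  have "(\<tau> * Q)\<^sup>2 \<le> \<tau>\<^sup>2 * (64 * K^6 * e * r)"
    unfolding power_mult_distrib using rms_bound by (intro mult_left_mono) auto
  also have "\<dots> = 64 * K^6 * (lam * \<tau>\<^sup>2) * r\<^sup>2" by (simp add: e_def power2_eq_square algebra_simps)
  also have "\<dots> = (8 * K^3 * (\<sigma> * r))\<^sup>2" unfolding lam_tau by (simp add: power2_eq_square eval_nat_numeral algebra_simps)
  finally show "(\<tau> * Q)\<^sup>2 \<le> (8 * K^3 * (\<sigma> * r))\<^sup>2" .
qed (use Kpos sig0 r0 in auto)

lemma rem_le: "rem \<le> 91 * K^5 * (\<sigma> * r)"
proof -
  have "\<tau>\<^sup>2 * (X + e) \<le> \<tau>\<^sup>2 * (82 * K^5 * e)"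
  proof (rule mult_left_mono)
    have "1 * e \<le> K^5 * e" using K_pow[of 5] e0 by (intro mult_right_mono) auto
    then show "X + e \<le> 82 * K^5 * e" using sup_bound by linarith
  qed simp
  also have "\<dots> = 82 * K^5 * (lam * \<tau>\<^sup>2) * r" by (simp add: e_def)
  also have "\<dots> = 82 * K^5 * (\<sigma> * r) * \<sigma>" unfolding lam_tau by (simp add: power2_eq_square)
  also have "\<dots> \<le> 82 * K^5 * (\<sigma> * r) * 1" using sig1 sig0 Kpos r0 by (intro mult_left_mono) auto
  finally have 1: "\<tau>\<^sup>2 * (X + e) \<le> 82 * (K^5 * (\<sigma> * r))" by simp
  have "\<nu> * e = \<tau> * r" by (simp add: e_def \<tau>_def)
  also have "\<dots> \<le> \<sigma> * r" using tau_sig r0 by (intro mult_right_mono) auto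
  also have "\<dots> \<le> K^5 * (\<sigma> * r)" using mult_right_mono[OF K_pow[of 5], of "\<sigma> * r"] sig0 r0 by simp
  finally have 2: "\<nu> * e \<le> K^5 * (\<sigma> * r)" .
  have "K^3 * (\<sigma> * r) \<le> K^5 * (\<sigma> * r)" using K1 sig0 r0 by (intro mult_right_mono power_increasing) auto
  then show ?thesis unfolding rem_def using 1 2 tauQ by linarith
qed

text \<open>The numeral rounds up 7808 + 22204 + 1, the constants of \<open>eQ\<close>,
  \<open>first_order'\<close> and \<open>tau_r_le\<close>.\<close>

definition s where "s = 31000 * (K^11 * (\<sigma> * r))"

lemma s0: "0 \<le> s" using Kpos sig0 r0 by (simp add: s_def)

lemma first_order':
  assumes i: "i < n"
  shows "\<bar>x i - B V i / D i - g i\<bar> \<le> 244 * K^6 * (e * \<bar>x i\<bar>) + 22204 * (K^11 * (\<sigma> * r))"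
proof -
  have "K^6 * rem \<le> K^6 * (91 * K^5 * (\<sigma> * r))" using rem_le Kpos by (intro mult_left_mono) auto
  then have "K^6 * rem \<le> 91 * (K^11 * (\<sigma> * r))" by (simp add: eval_nat_numeral algebra_simps)
  then show ?thesis using first_order[OF i] by (simp add: algebra_simps)
qed

text \<open>Averaging over items turns the factor \<open>\<bar>x i\<bar>\<close> of the relative
  error into \<open>Q\<close>, and the product drops to the order \<open>\<sigma> * r\<close>. For a
  single item \<open>e * X\<close> may be of order \<open>e\<^sup>2\<close>, which sparsity alone
  does not make small against \<open>r\<close>; there the error stays relative.\<close>

lemma eQ: "244 * K^6 * (e * (4 * K\<^sup>2 * Q)) \<le> 7808 * (K^11 * (\<sigma> * r))"
proof -
  have "e * Q \<le> \<tau> * Q" using e_tau Q0 by (intro mult_right_mono) auto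
  then have "e * Q \<le> 8 * K^3 * (\<sigma> * r)" using tauQ by linarith
  then have "976 * K^8 * (e * Q) \<le> 976 * K^8 * (8 * K^3 * (\<sigma> * r))" using Kpos by (intro mult_left_mono) auto
  then show ?thesis by (simp add: eval_nat_numeral algebra_simps)
qed

lemma tau_r_le: "K * \<tau> * r \<le> K^11 * (\<sigma> * r)"
proof -
  have "K * (\<tau> * r) \<le> K^11 * (\<sigma> * r)"
    using tau_sig tau0 r0 K1 power_increasing[of 1 11 K] by (intro mult_mono mult_right_mono) auto
  then show ?thesis by (simp add: algebra_simps)
qed

lemma Hs_upper: assumes "i < n" shows "Hs i \<le> real n * K"
proof -
  have "Hs i \<le> (\<Sum>j\<in>V-{i}. K)" unfolding Hs_def by (intro sum_mono h_upper)
  also have "\<dots> \<le> real n * K" using Kpos finV cardV by (auto intro!: mult_right_mono order_trans[OF card_Diff1_le])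
  finally show ?thesis .
qed

text \<open>Average \<open>x j = B V j / D j + g j + E j\<close> with the weights of row
  \<open>i\<close>. The leading terms cancel among many items and lose a factor \<open>\<nu>\<close>
  by \<open>avg_h\<close>; the errors average by \<open>eQ\<close>.\<close>

lemma g_fixpoint:
  assumes i: "i < n"
  shows "\<bar>g i - (\<Sum>j\<in>V-{i}. h i j / Hs i * g j)\<bar> \<le> s"
proof -
  define E where "E j = x j - B V j / D j - g j" for j
  have "g i - (\<Sum>j\<in>V-{i}. h i j / Hs i * g j) = (\<Sum>j\<in>V-{i}. h i j / Hs i * (B V j / D j)) + (\<Sum>j\<in>V-{i}. h i j * E j) / Hs i"
    unfolding g_def[of i] sum_divide_distrib sum_subtractf[symmetric] sum.distrib[symmetric]
    by (intro sum.cong refl) (simp add: E_def algebra_simps diff_divide_distrib add_divide_distrib)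
  moreover have "\<bar>(\<Sum>j\<in>V-{i}. h i j * E j) / Hs i\<bar> \<le> 7808 * (K^11 * (\<sigma> * r)) + 22204 * (K^11 * (\<sigma> * r))"
  proof -
    define F where "F j = 244 * K^6 * (e * \<bar>x j\<bar>) + 22204 * (K^11 * (\<sigma> * r))" for j
    have EF: "\<bar>E j\<bar> \<le> F j" if "j \<in> V" for j using first_order'[of j] that by (simp add: E_def F_def iV)
    have "\<bar>\<Sum>j\<in>V-{i}. h i j * E j\<bar> \<le> (\<Sum>j\<in>V-{i}. h i j * F j)"
    proof (intro order_trans[OF sum_abs] sum_mono)
      fix j assume "j \<in> V - {i}"
      then show "\<bar>h i j * E j\<bar> \<le> h i j * F j" using EF[of j] h_pos[of i j] by (simp add: abs_mult)
    qed
    also have "\<dots> = 244 * K^6 * (e * (\<Sum>j\<in>V-{i}. h i j * \<bar>x j\<bar>)) + 22204 * (K^11 * (\<sigma> * r)) * Hs i"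
      unfolding F_def Hs_def sum_distrib_left sum.distrib[symmetric] by (intro sum.cong refl) (simp add: algebra_simps)
    finally have "\<bar>(\<Sum>j\<in>V-{i}. h i j * E j) / Hs i\<bar> \<le>
        (244 * K^6 * (e * (\<Sum>j\<in>V-{i}. h i j * \<bar>x j\<bar>)) + 22204 * (K^11 * (\<sigma> * r)) * Hs i) / Hs i"
      unfolding abs_divide using Hs0[OF i] by (auto intro!: divide_right_mono)
    also have "\<dots> = 244 * K^6 * (e * ((\<Sum>j\<in>V-{i}. h i j * \<bar>x j\<bar>) / Hs i)) + 22204 * (K^11 * (\<sigma> * r))"
      using Hs0[OF i] by (simp add: field_simps)
    also have "\<dots> \<le> 244 * K^6 * (e * (4 * K\<^sup>2 * Q)) + 22204 * (K^11 * (\<sigma> * r))"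
    proof (intro add_right_mono mult_left_mono)
      have "(\<Sum>j\<in>V-{i}. h i j * \<bar>x j\<bar>) / Hs i \<le> 4 * K\<^sup>2 / real n * (\<Sum>j\<in>V. \<bar>x j\<bar>)" by (rule H_average_le[OF i]) simp
      also have "\<dots> \<le> 4 * K\<^sup>2 / real n * (real n * Q)" using sum_abs_x by (intro mult_left_mono) auto
      finally show "(\<Sum>j\<in>V-{i}. h i j * \<bar>x j\<bar>) / Hs i \<le> 4 * K\<^sup>2 * Q" using npos by simp
    qed (use e0 Kpos in auto)
    finally show ?thesis using eQ by linarith
  qed
  moreover have "0 \<le> K^11 * (\<sigma> * r)" using Kpos sig0 r0 by simp
  ultimately show ?thesis using avg_h[OF i] tau_r_le unfolding s_def by linarith
qed

lemma g_mean: "\<bar>(\<Sum>j\<in>V. g j) / real n\<bar> \<le> s"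
proof -
  define E where "E j = x j - B V j / D j - g j" for j
  have "(\<Sum>j\<in>V. g j) = - (\<Sum>j\<in>V. B V j / D j) - (\<Sum>j\<in>V. E j)"
    using x_mean by (simp add: E_def sum_subtractf)
  moreover have "\<bar>\<Sum>j\<in>V. E j\<bar> \<le> real n * (7808 * (K^11 * (\<sigma> * r)) + 22204 * (K^11 * (\<sigma> * r)))"
  proof -
    have "\<bar>\<Sum>j\<in>V. E j\<bar> \<le> (\<Sum>j\<in>V. 244 * K^6 * (e * \<bar>x j\<bar>) + 22204 * (K^11 * (\<sigma> * r)))"
      using first_order' by (intro order_trans[OF sum_abs] sum_mono) (auto simp: E_def iV)
    also have "\<dots> = 244 * K^6 * (e * (\<Sum>j\<in>V. \<bar>x j\<bar>)) + real n * (22204 * (K^11 * (\<sigma> * r)))"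
      by (simp add: sum.distrib cardV sum_distrib_left mult.assoc)
    also have "\<dots> \<le> 244 * K^6 * (e * (real n * (4 * K\<^sup>2 * Q))) + real n * (22204 * (K^11 * (\<sigma> * r)))"
    proof (intro add_right_mono mult_left_mono)
      have "1 * Q \<le> 4 * K\<^sup>2 * Q" using K_pow[of 2] Q0 by (intro mult_right_mono) auto
      then have "real n * Q \<le> real n * (4 * K\<^sup>2 * Q)" using npos by (intro mult_left_mono) auto
      then show "(\<Sum>j\<in>V. \<bar>x j\<bar>) \<le> real n * (4 * K\<^sup>2 * Q)" using sum_abs_x by linarith
    qed (use e0 Kpos in auto)
    also have "\<dots> = real n * (244 * K^6 * (e * (4 * K\<^sup>2 * Q)) + 22204 * (K^11 * (\<sigma> * r)))" by (simp add: algebra_simps)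
    also have "\<dots> \<le> real n * (7808 * (K^11 * (\<sigma> * r)) + 22204 * (K^11 * (\<sigma> * r)))"
      using eQ by (intro mult_left_mono) auto
    finally show ?thesis .
  qed
  moreover have "\<bar>\<Sum>j\<in>V. B V j / D j\<bar> \<le> real n * (K * \<tau> * r)" using avg_u npos by (simp add: field_simps)
  moreover have "real n * (K * \<tau> * r) \<le> real n * (K^11 * (\<sigma> * r))" using tau_r_le by (intro mult_left_mono) auto
  ultimately have "\<bar>\<Sum>j\<in>V. g j\<bar> \<le> real n * (K^11 * (\<sigma> * r)) + real n * (7808 * (K^11 * (\<sigma> * r)) + 22204 * (K^11 * (\<sigma> * r)))"
    by linarith
  also have "\<dots> = real n * (30013 * (K^11 * (\<sigma> * r)))" by (simp add: algebra_simps)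
  also have "\<dots> \<le> real n * s" unfolding s_def using Kpos sig0 r0 by (intro mult_left_mono) auto
  finally show ?thesis using npos by (simp add: field_simps)
qed

text \<open>The weights of \<open>g\<close> are not uniform, so the vanishing mean of
  \<open>x\<close> says nothing about one \<open>g i\<close> directly, only about the mean of
  \<open>g\<close>. The bounds on \<open>h\<close> and \<open>Hs\<close> give the uniform lower
  bound \<open>1 / (2 * K\<^sup>2)\<close> over \<open>n\<close> for the weights, and contraction
  transfers the bound to every entry.\<close>

lemma g_small: assumes i: "i < n" shows "\<bar>g i\<bar> \<le> 3 * K\<^sup>2 * s"
proof -
  have "\<bar>g i - (\<Sum>j\<in>V. g j) / real (card V)\<bar> \<le> s / (1 / (2 * K\<^sup>2))"
  proof (rule doeblin_deviation[where W = "\<lambda>i j. h i j / Hs i"])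
    fix i assume "i \<in> V" then have i: "i < n" by (simp add: iV)
    show "(\<Sum>j\<in>V-{i}. h i j / Hs i) = 1"
      using Hs0[OF i] by (simp add: Hs_def flip: sum_divide_distrib)
    show "\<bar>g i - (\<Sum>j\<in>V-{i}. h i j / Hs i * g j)\<bar> \<le> s" by (rule g_fixpoint[OF i])
    fix j
    have "1 / (2 * K) / (real n * K) \<le> h i j / Hs i"
      using Hs_upper[OF i] Hs0[OF i] h_lower[of i j] h_pos[of i j] by (intro frac_le) (auto simp: less_imp_le)
    then show "1 / (2 * K\<^sup>2) / real (card V) \<le> h i j / Hs i"
      unfolding cardV by (simp add: power2_eq_square algebra_simps)
  qed (use finV Kpos i in \<open>auto simp: iV\<close>)
  moreover have "s / (1 / (2 * K\<^sup>2)) = 2 * (K\<^sup>2 * s)" by simp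
  ultimately have "\<bar>g i\<bar> \<le> s + 2 * (K\<^sup>2 * s)" using g_mean unfolding cardV by linarith
  moreover have "1 * s \<le> K\<^sup>2 * s" using K_pow[of 2] s0 by (intro mult_right_mono) auto
  ultimately show ?thesis by linarith
qed

lemma x_expansion:
  assumes i: "i < n"
  shows "\<bar>x i - B V i / D i\<bar> \<le> 244 * K^6 * (e * \<bar>x i\<bar>) + 120000 * (K^13 * (\<sigma> * r))"
proof -
  have 1: "3 * K\<^sup>2 * s = 93000 * (K^13 * (\<sigma> * r))" by (simp add: s_def eval_nat_numeral algebra_simps)
  have 2: "K^11 * (\<sigma> * r) \<le> K^13 * (\<sigma> * r)" using K1 sig0 r0 by (intro mult_right_mono power_increasing) auto
  have 3: "0 \<le> K^13 * (\<sigma> * r)" using Kpos sig0 r0 by simp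
  show ?thesis using first_order'[OF i] g_small[OF i] 1 2 3 by linarith
qed

text \<open>The quadratic remainder of the logarithm is at most a multiple of
  \<open>X * \<bar>x i\<bar>\<close>, hence a relative error, while in the mean over all items it is
  of order \<open>Q\<^sup>2\<close> and thus of order \<open>\<sigma> * r\<close>. Finally
  \<open>\<bar>x i\<bar>\<close> is exchanged for the leading term.\<close>

lemma log_expansion:
  assumes i: "i < n"
  shows "\<bar>ln (1 + x i) - (\<Sum>k\<in>V. ln (1 + x k)) / real n - B V i / D i\<bar>
     \<le> 812 * K^6 * \<sigma> * \<bar>B V i / D i\<bar> + 300000 * K^13 * \<sigma> * r"
proof -
  define \<beta> where "\<beta> = B V i / D i"
  define u where "u = K^13 * (\<sigma> * r)"
  have u0: "0 \<le> u" using Kpos sig0 r0 by (simp add: u_def)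
  have X12: "X \<le> 1/2" using sup_bound K_e[of 5] e0 Kpos by simp
  have ln: "\<bar>ln (1 + x k) - x k\<bar> \<le> 2 * (x k)\<^sup>2" if "k < n" for k
    using x_le_X[OF that] X12 by (intro abs_ln_one_plus_x_minus_x_bound) auto
  have nQ: "real n * Q\<^sup>2 = (\<Sum>k\<in>V. (x k)\<^sup>2)" using npos by (simp add: Q_def power_divide L2_set_sq)
  have "\<bar>\<Sum>k\<in>V. ln (1 + x k)\<bar> = \<bar>\<Sum>k\<in>V. (ln (1 + x k) - x k)\<bar>" using x_mean by (simp add: sum_subtractf)
  also have "\<dots> \<le> (\<Sum>k\<in>V. 2 * (x k)\<^sup>2)" using ln by (intro order_trans[OF sum_abs] sum_mono) (auto simp: iV)
  also have "\<dots> = 2 * (real n * Q\<^sup>2)" using nQ by (simp add: sum_distrib_left)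
  finally have "\<bar>(\<Sum>k\<in>V. ln (1 + x k)) / real n\<bar> \<le> 2 * Q\<^sup>2" using npos by (simp add: field_simps)
  moreover have "Q\<^sup>2 \<le> 64 * u"
  proof -
    have "Q\<^sup>2 \<le> 64 * (K^6 * (e * r))" using rms_bound by (simp add: algebra_simps)
    also have "K^6 * (e * r) \<le> u" unfolding u_def
      using e_tau tau_sig r0 e0 K1 by (intro mult_mono power_increasing mult_right_mono) auto
    finally show ?thesis by simp
  qed
  ultimately have mean: "\<bar>(\<Sum>k\<in>V. ln (1 + x k)) / real n\<bar> \<le> 128 * u" by linarith
  have "(x i)\<^sup>2 = \<bar>x i\<bar> * \<bar>x i\<bar>" by (simp add: power2_eq_square)
  also have "\<dots> \<le> (81 * K^5 * e) * \<bar>x i\<bar>" using x_le_X[OF i] sup_bound by (intro mult_right_mono) auto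
  also have "\<dots> \<le> 81 * K^6 * e * \<bar>x i\<bar>"
    using K1 e0 by (intro mult_right_mono mult_left_mono power_increasing) auto
  finally have sq: "(x i)\<^sup>2 \<le> 81 * (K^6 * e * \<bar>x i\<bar>)" by simp
  define w where "w = K^6 * e * \<bar>x i\<bar>"
  have xe: "\<bar>x i - \<beta>\<bar> \<le> 244 * w + 120000 * u"
    using x_expansion[OF i] by (simp add: \<beta>_def u_def w_def mult.assoc)
  have "w \<le> 1/1000 * \<bar>x i\<bar>" unfolding w_def using K_e[of 6] by (intro mult_right_mono) auto
  \<comment> \<open>The coefficient of \<open>\<bar>x i\<bar>\<close> on the right is 244/1000,
    below 1/2, so it is absorbed at the price of a factor 2.\<close>
  then have xb: "\<bar>x i\<bar> \<le> 2 * \<bar>\<beta>\<bar> + 240000 * u" using xe u0 by linarith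
  have w: "w \<le> 2 * (K^6 * \<sigma> * \<bar>\<beta>\<bar>) + 240 * u"
  proof -
    have "w \<le> K^6 * e * (2 * \<bar>\<beta>\<bar> + 240000 * u)" unfolding w_def using xb Kpos e0 by (intro mult_left_mono) auto
    also have "\<dots> = 2 * (K^6 * e * \<bar>\<beta>\<bar>) + 240000 * ((K^6 * e) * u)" by (simp add: algebra_simps)
    also have "\<dots> \<le> 2 * (K^6 * \<sigma> * \<bar>\<beta>\<bar>) + 240000 * (1/1000 * u)"
      using K_e[of 6] u0 e_tau tau_sig Kpos by (intro add_mono mult_left_mono mult_right_mono) auto
    finally show ?thesis by simp
  qed
  \<comment> \<open>Here 406 = 244 + 2 * 81 joins the expansion of \<open>x i\<close> with the
    quadratic remainder, and 120128 = 120000 + 128 includes the mean of the logarithms.\<close>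
  have "\<bar>ln (1 + x i) - (\<Sum>k\<in>V. ln (1 + x k)) / real n - \<beta>\<bar> \<le> 406 * w + 120128 * u"
    using ln[OF i] sq xe mean unfolding w_def by linarith
  also have "\<dots> \<le> 812 * (K^6 * \<sigma> * \<bar>\<beta>\<bar>) + 300000 * u" using w u0 by linarith
  finally show ?thesis by (simp add: \<beta>_def u_def mult.assoc)
qed

end

section \<open>Tail bounds for products of Bernoulli variables\<close>

lemma prob_bind_pmf_le:
  assumes "\<And>x. x \<in> set_pmf M \<Longrightarrow> measure_pmf.prob (N x) E \<le> c" "0 \<le> c"
  shows "measure_pmf.prob (bind_pmf M N) E \<le> c"
proof -
  have "emeasure (bind_pmf M N) E = (\<integral>\<^sup>+x. emeasure (N x) E \<partial>M)" by simp
  also have "\<dots> \<le> (\<integral>\<^sup>+x. ennreal c \<partial>M)"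
    using assms by (intro nn_integral_mono_AE AE_pmfI) (auto simp: measure_pmf.emeasure_eq_measure)
  also have "\<dots> = ennreal c" by simp
  finally show ?thesis using assms(2) by (simp add: measure_pmf.emeasure_eq_measure)
qed

lemma prob_pair_pmf_le_fst:
  fixes M :: "'a pmf" and N :: "'b pmf"
  assumes "\<And>x. measure_pmf.prob N {y. (x, y) \<in> E} \<le> c" "0 \<le> c"
  shows "measure_pmf.prob (pair_pmf M N) E \<le> c"
  unfolding pair_pmf_def
proof (rule prob_bind_pmf_le)
  fix x :: 'a
  have "bind_pmf N (\<lambda>y. return_pmf (x, y)) = map_pmf (Pair x) N" by (simp add: map_pmf_def)
  then show "measure_pmf.prob (bind_pmf N (\<lambda>y. return_pmf (x, y))) E \<le> c"
    using assms(1)[of x] by (simp add: vimage_def)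
qed (use assms in auto)

lemma prob_pair_pmf_le_snd:
  assumes "\<And>y. measure_pmf.prob M {x. (x, y) \<in> E} \<le> c" "0 \<le> c"
  shows "measure_pmf.prob (pair_pmf M N) E \<le> c"
proof -
  have "measure_pmf.prob (pair_pmf M N) E = measure_pmf.prob (pair_pmf N M) ((\<lambda>(x, y). (y, x)) -` E)"
    by (subst pair_commute_pmf) simp
  also have "\<dots> \<le> c" using assms by (intro prob_pair_pmf_le_fst) auto
  finally show ?thesis .
qed

text \<open>Fubini for the two blocks of coordinates: those outside \<open>R\<close> are frozen at
  \<open>g\<close>, and a bound uniform in \<open>g\<close> survives averaging.\<close>

lemma prob_Pi_pmf_le_cond:
  assumes fin: "finite I" and R: "R \<subseteq> I" and c: "0 \<le> c"
    and le: "\<And>g. measure_pmf.prob (Pi_pmf R d P) {f. (\<lambda>e. if e \<in> R then f e else g e) \<in> E} \<le> c"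
  shows "measure_pmf.prob (Pi_pmf I d P) E \<le> c"
proof -
  let ?h = "\<lambda>(f,g) x. if x \<in> R then f x else g x"
  have I: "I = R \<union> (I - R)" using R by auto
  have "Pi_pmf (R \<union> (I - R)) d P = map_pmf ?h (pair_pmf (Pi_pmf R d P) (Pi_pmf (I - R) d P))"
    using fin R by (intro Pi_pmf_union) (auto intro: finite_subset)
  then have "measure_pmf.prob (Pi_pmf I d P) E = measure_pmf.prob (pair_pmf (Pi_pmf R d P) (Pi_pmf (I - R) d P)) (?h -` E)"
    by (subst I) (simp only: measure_map_pmf)
  also have "\<dots> \<le> c"
    using le c by (intro prob_pair_pmf_le_snd) (auto simp: vimage_def)
  finally show ?thesis .
qed

abbreviation bernoulli_Pi :: "'a set \<Rightarrow> ('a \<Rightarrow> real) \<Rightarrow> ('a \<Rightarrow> bool) pmf" where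
  "bernoulli_Pi R q \<equiv> Pi_pmf R False (\<lambda>e. bernoulli_pmf (q e))"

lemma bernoulli_mgf:
  assumes q: "0 \<le> q" "q \<le> (1::real)"
  shows "measure_pmf.expectation (bernoulli_pmf q) (\<lambda>v. exp (c * (of_bool v - q))) = exp (- c * q) * (1 + q * (exp c - 1))"
proof -
  have "exp (c * (1 - q)) = exp (- c * q) * exp c" by (simp add: algebra_simps flip: exp_add)
  then show ?thesis using q by simp (simp add: algebra_simps)
qed

lemma bernoulli_mgf_hoeffding:
  assumes q: "0 \<le> q" "q \<le> (1::real)"
  shows "measure_pmf.expectation (bernoulli_pmf q) (\<lambda>v. exp (c * (of_bool v - q))) \<le> exp (c\<^sup>2 / 8)"
proof -
  have pos: "exp (- c * q) * (1 + q * (exp c - 1)) \<le> exp (c\<^sup>2 / 8)" if "0 \<le> c" "0 \<le> q" for c q :: real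
  proof -
    have p: "0 < 1 + q * (exp c - 1)" using that by (intro add_pos_nonneg) auto
    have "- c * q + ln (1 + q * (exp c - 1)) \<le> c\<^sup>2 / 8" using Hoeffdings_lemma_aux[OF that] by simp
    then have "exp (- c * q + ln (1 + q * (exp c - 1))) \<le> exp (c\<^sup>2 / 8)" by (subst exp_le_cancel_iff)
    then show ?thesis using p by (simp only: exp_add exp_ln)
  qed
  show ?thesis
  proof (cases "0 \<le> c")
    case True then show ?thesis using pos q unfolding bernoulli_mgf[OF q] by auto
  next
    case False
    \<comment> \<open>Exchanging success and failure maps \<open>c\<close> to \<open>- c\<close> and
      \<open>q\<close> to \<open>1 - q\<close> and leaves the moment generating function
      unchanged.\<close>
    have "exp (- c * q) * (1 + q * (exp c - 1)) = exp (- (-c) * (1 - q)) * (1 + (1 - q) * (exp (- c) - 1))"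
    proof -
      have 1: "exp (- (-c) * (1 - q)) = exp (- c * q) * exp c" by (simp add: algebra_simps flip: exp_add)
      have 2: "exp c * (1 + (1 - q) * (exp (- c) - 1)) = 1 + q * (exp c - 1)"
        by (simp add: exp_minus field_simps)
      show ?thesis unfolding 1 mult.assoc 2 ..
    qed
    also have "\<dots> \<le> exp ((-c)\<^sup>2 / 8)" using False q by (intro pos) auto
    finally show ?thesis unfolding bernoulli_mgf[OF q] by simp
  qed
qed

lemma exp_le_quadratic: assumes "\<bar>c\<bar> \<le> (1::real)" shows "exp c \<le> 1 + c + c\<^sup>2"
proof (cases "0 \<le> c")
  case True then show ?thesis using assms exp_bound by auto
next
  case False
  then have c: "c < 0" by simp
  have "1 + (-c) + c\<^sup>2 / 2 \<le> exp (-c)"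
    using exp_lower_Taylor_quadratic[of "-c"] c by simp
  then have "1 / exp (-c) \<le> 1 / (1 - c + c\<^sup>2 / 2)"
    using c by (intro divide_left_mono) (auto intro!: mult_pos_pos add_pos_nonneg)
  then have 1: "exp c \<le> 1 / (1 - c + c\<^sup>2 / 2)" by (simp add: exp_minus inverse_eq_divide)
  have "1 \<le> (1 + c + c\<^sup>2) * (1 - c + c\<^sup>2 / 2)"
  proof -
    have "(1 + c + c\<^sup>2) * (1 - c + c\<^sup>2 / 2) - 1 = c\<^sup>2 / 2 * (1 - c + c\<^sup>2)"
      by (simp add: power2_eq_square field_simps)
    also have "\<dots> \<ge> 0" using c by (intro mult_nonneg_nonneg) (auto intro!: add_nonneg_nonneg)
    finally show ?thesis by simp
  qed
  then have "1 / (1 - c + c\<^sup>2 / 2) \<le> 1 + c + c\<^sup>2"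
    using c by (subst pos_divide_le_eq) (auto intro!: add_pos_nonneg)
  then show ?thesis using 1 by linarith
qed

lemma bernoulli_mgf_bernstein:
  assumes q: "0 \<le> q" "q \<le> (1::real)" and c: "\<bar>c\<bar> \<le> 1"
  shows "measure_pmf.expectation (bernoulli_pmf q) (\<lambda>v. exp (c * (of_bool v - q))) \<le> exp (q * c\<^sup>2)"
proof -
  have "q * (exp c - 1) \<le> q * (c + c\<^sup>2)" using exp_le_quadratic[OF c] q by (intro mult_left_mono) auto
  also have "1 + q * (c + c\<^sup>2) \<le> exp (q * (c + c\<^sup>2))" by (rule exp_ge_add_one_self)
  finally have "1 + q * (exp c - 1) \<le> exp (q * (c + c\<^sup>2))" by simp
  then have "exp (- c * q) * (1 + q * (exp c - 1)) \<le> exp (- c * q) * exp (q * (c + c\<^sup>2))"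
    by (intro mult_left_mono) auto
  also have "\<dots> = exp (q * c\<^sup>2)" by (simp add: algebra_simps flip: exp_add)
  finally show ?thesis unfolding bernoulli_mgf[OF q] .
qed

lemma chernoff_Pi_pmf:
  fixes c q :: "'a \<Rightarrow> real"
  assumes fin: "finite R"
    and mgf: "\<And>e. e \<in> R \<Longrightarrow> measure_pmf.expectation (bernoulli_pmf (q e)) (\<lambda>v. exp (c e * (of_bool v - q e))) \<le> exp (w e)"
  shows "measure_pmf.prob (bernoulli_Pi R q) {f. t < (\<Sum>e\<in>R. c e * (of_bool (f e) - q e))}
     \<le> exp ((\<Sum>e\<in>R. w e) - t)"
proof -
  let ?P = "bernoulli_Pi R q"
  define Z where "Z f = (\<Prod>e\<in>R. exp (c e * (of_bool (f e) - q e)))" for f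
  have Zexp: "Z f = exp (\<Sum>e\<in>R. c e * (of_bool (f e) - q e))" for f by (simp add: Z_def exp_sum fin)
  have fs: "finite (set_pmf ?P)"
  proof (rule finite_subset)
    show "set_pmf ?P \<subseteq> PiE_dflt R False (\<lambda>_. UNIV)"
      using set_Pi_pmf_subset[OF fin, of False "\<lambda>e. bernoulli_pmf (q e)"] by (auto simp: PiE_dflt_def subset_iff)
    show "finite (PiE_dflt R False (\<lambda>_. UNIV :: bool set))" using fin by auto
  qed
  have int: "integrable (measure_pmf ?P) F" for F :: "_ \<Rightarrow> real" by (rule integrable_measure_pmf_finite[OF fs])
  have "measure_pmf.prob ?P {f. t < (\<Sum>e\<in>R. c e * (of_bool (f e) - q e))} \<le> measure_pmf.prob ?P {f\<in>space ?P. exp t \<le> Z f}"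
    by (intro measure_pmf.finite_measure_mono) (auto simp: Zexp)
  also have "\<dots> \<le> measure_pmf.expectation ?P Z / exp t"
    by (rule integral_Markov_inequality_measure[where A = "{}"]) (auto simp: int Zexp)
  also have "measure_pmf.expectation ?P Z = (\<Prod>e\<in>R. measure_pmf.expectation (bernoulli_pmf (q e)) (\<lambda>v. exp (c e * (of_bool v - q e))))"
    unfolding Z_def
    by (rule expectation_prod_Pi_pmf[OF fin, where f = "\<lambda>e v. exp (c e * (of_bool v - q e))"])
       (auto intro: integrable_measure_pmf_finite)
  also have "\<dots> \<le> (\<Prod>e\<in>R. exp (w e))"
    by (intro prod_mono conjI mgf) (auto intro!: Bochner_Integration.integral_nonneg)
  finally have "measure_pmf.prob ?P {f. t < (\<Sum>e\<in>R. c e * (of_bool (f e) - q e))} \<le> (\<Prod>e\<in>R. exp (w e)) / exp t"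
    by (simp add: divide_right_mono)
  then show ?thesis by (simp add: exp_diff exp_sum fin)
qed

lemma two_sided_tail:
  fixes Z T :: "'a \<Rightarrow> real"
  assumes "measure_pmf.prob P {f. T f < Z f} \<le> c" "measure_pmf.prob P {f. T f < - Z f} \<le> c"
  shows "measure_pmf.prob P {f. T f < \<bar>Z f\<bar>} \<le> 2 * c"
proof -
  have "{f. T f < \<bar>Z f\<bar>} = {f. T f < Z f} \<union> {f. T f < - Z f}" by auto
  then show ?thesis using measure_Un_le[of "{f. T f < Z f}" "measure_pmf P" "{f. T f < - Z f}"] assms by simp
qed

lemma hoeffding_Pi_pmf_one_sided:
  fixes c q :: "'a \<Rightarrow> real"
  assumes fin: "finite R" and q: "\<And>e. e \<in> R \<Longrightarrow> 0 \<le> q e \<and> q e \<le> 1" and u: "0 \<le> u"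
  shows "measure_pmf.prob (bernoulli_Pi R q)
     {f. u * sqrt (\<Sum>e\<in>R. (c e)\<^sup>2) < (\<Sum>e\<in>R. c e * (of_bool (f e) - q e))} \<le> exp (- 2 * u\<^sup>2)"
proof -
  define v where "v = (\<Sum>e\<in>R. (c e)\<^sup>2)"
  have v0: "0 \<le> v" by (simp add: v_def sum_nonneg)
  show ?thesis
  proof (cases "v = 0")
    case True
    then have "c e = 0" if "e \<in> R" for e using that fin by (simp add: v_def sum_nonneg_eq_0_iff)
    then have "{f. u * sqrt (\<Sum>e\<in>R. (c e)\<^sup>2) < (\<Sum>e\<in>R. c e * (of_bool (f e) - q e))} = {}" by simp
    then show ?thesis by simp
  next
    case False
    then have v: "0 < v" using v0 by simp
    \<comment> \<open>Minimiser of the exponent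
      \<open>s\<^sup>2 * v / 8 - s * u * sqrt v\<close>.\<close>
    define s where "s = 4 * u / sqrt v"
    show ?thesis
    proof (cases "u = 0")
      case True
      then show ?thesis by simp
    next
      case False
      then have s: "0 < s" using u v by (simp add: s_def)
      have "{f. u * sqrt (\<Sum>e\<in>R. (c e)\<^sup>2) < (\<Sum>e\<in>R. c e * (of_bool (f e) - q e))}
         = {f. s * (u * sqrt v) < (\<Sum>e\<in>R. s * c e * (of_bool (f e) - q e))}"
        using s by (simp add: v_def mult.assoc flip: sum_distrib_left)
      moreover have "measure_pmf.prob (bernoulli_Pi R q)
          {f. s * (u * sqrt v) < (\<Sum>e\<in>R. s * c e * (of_bool (f e) - q e))} \<le> exp ((\<Sum>e\<in>R. (s * c e)\<^sup>2 / 8) - s * (u * sqrt v))"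
        using q by (intro chernoff_Pi_pmf[OF fin] bernoulli_mgf_hoeffding) auto
      moreover have "(\<Sum>e\<in>R. (s * c e)\<^sup>2 / 8) - s * (u * sqrt v) = - 2 * u\<^sup>2"
      proof -
        have "(\<Sum>e\<in>R. (s * c e)\<^sup>2 / 8) = s\<^sup>2 * v / 8"
          by (simp add: power_mult_distrib v_def sum_distrib_left sum_divide_distrib)
        also have "s\<^sup>2 * v = 16 * u\<^sup>2" using v by (simp add: s_def power_divide power_mult_distrib)
        finally show ?thesis using v by (simp add: s_def power2_eq_square)
      qed
      ultimately show ?thesis by simp
    qed
  qed
qed

lemma hoeffding_Pi_pmf:
  fixes c q :: "'a \<Rightarrow> real"
  assumes fin: "finite R" and q: "\<And>e. e \<in> R \<Longrightarrow> 0 \<le> q e \<and> q e \<le> 1" and u: "0 \<le> u"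
  shows "measure_pmf.prob (bernoulli_Pi R q)
     {f. u * sqrt (\<Sum>e\<in>R. (c e)\<^sup>2) < \<bar>\<Sum>e\<in>R. c e * (of_bool (f e) - q e)\<bar>} \<le> 2 * exp (- 2 * u\<^sup>2)"
proof (rule two_sided_tail)
  show "measure_pmf.prob (bernoulli_Pi R q)
     {f. u * sqrt (\<Sum>e\<in>R. (c e)\<^sup>2) < (\<Sum>e\<in>R. c e * (of_bool (f e) - q e))} \<le> exp (- 2 * u\<^sup>2)"
    by (rule hoeffding_Pi_pmf_one_sided[OF fin q u])
  show "measure_pmf.prob (bernoulli_Pi R q)
     {f. u * sqrt (\<Sum>e\<in>R. (c e)\<^sup>2) < - (\<Sum>e\<in>R. c e * (of_bool (f e) - q e))} \<le> exp (- 2 * u\<^sup>2)"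
    using hoeffding_Pi_pmf_one_sided[where c = "\<lambda>e. - c e", OF fin q u] by (simp add: sum_negf)
qed

text \<open>The quadratic bound for the moment generating function needs
  \<open>s * b \<le> 1\<close>. If \<open>u / sqrt v\<close>, optimal for the variance term, is
  admissible, it is used; otherwise the largest admissible value \<open>1 / b\<close> is, and the
  range term \<open>2 * u\<^sup>2 * b\<close> pays for it.\<close>

lemma bernstein_Pi_pmf_one_sided:
  fixes c q :: "'a \<Rightarrow> real"
  assumes fin: "finite R" and q: "\<And>e. e \<in> R \<Longrightarrow> 0 \<le> q e \<and> q e \<le> 1" and u: "0 \<le> u"
    and b0: "0 \<le> b" and b: "\<And>e. e \<in> R \<Longrightarrow> \<bar>c e\<bar> \<le> b"
  shows "measure_pmf.prob (bernoulli_Pi R q)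
     {f. 2 * u * sqrt (\<Sum>e\<in>R. q e * (c e)\<^sup>2) + 2 * u\<^sup>2 * b < (\<Sum>e\<in>R. c e * (of_bool (f e) - q e))} \<le> exp (- u\<^sup>2)"
proof -
  define v where "v = (\<Sum>e\<in>R. q e * (c e)\<^sup>2)"
  have v0: "0 \<le> v" using q by (simp add: v_def sum_nonneg)
  define t where "t = 2 * u * sqrt v + 2 * u\<^sup>2 * b"
  define Z where "Z f = (\<Sum>e\<in>R. c e * (of_bool (f e) - q e))" for f
  have key: "measure_pmf.prob (bernoulli_Pi R q) {f. t < Z f} \<le> exp (- u\<^sup>2)"
    if s: "0 < s" "s * b \<le> 1" and st: "s\<^sup>2 * v - s * t \<le> - u\<^sup>2" for s
  proof -
    have "{f. t < Z f} = {f. s * t < (\<Sum>e\<in>R. s * c e * (of_bool (f e) - q e))}"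
      using s by (simp add: Z_def mult.assoc flip: sum_distrib_left)
    moreover have "measure_pmf.prob (bernoulli_Pi R q)
       {f. s * t < (\<Sum>e\<in>R. s * c e * (of_bool (f e) - q e))} \<le> exp ((\<Sum>e\<in>R. q e * (s * c e)\<^sup>2) - s * t)"
    proof (intro chernoff_Pi_pmf[OF fin] bernoulli_mgf_bernstein)
      fix e assume e: "e \<in> R"
      have "\<bar>s * c e\<bar> \<le> s * b" using b[OF e] s by (simp add: abs_mult)
      then show "\<bar>s * c e\<bar> \<le> 1" using s by linarith
    qed (use q in auto)
    moreover have "(\<Sum>e\<in>R. q e * (s * c e)\<^sup>2) = s\<^sup>2 * v"
      by (simp add: power_mult_distrib v_def sum_distrib_left algebra_simps)
    moreover have "exp (s\<^sup>2 * v - s * t) \<le> exp (- u\<^sup>2)" using st by simp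
    ultimately show ?thesis by (simp only:)
  qed
  have "measure_pmf.prob (bernoulli_Pi R q) {f. t < Z f} \<le> exp (- u\<^sup>2)"
  proof (cases "u = 0 \<or> (\<forall>e\<in>R. c e = 0)")
    case True
    then show ?thesis
    proof
      assume "\<forall>e\<in>R. c e = 0"
      then have "Z f = 0" for f by (simp add: Z_def)
      moreover have "0 \<le> t" using u v0 b0 by (simp add: t_def)
      ultimately have "{f. t < Z f} = {}" by auto
      then show ?thesis by simp
    qed simp
  next
    case False
    then obtain e where e: "e \<in> R" "c e \<noteq> 0" by auto
    have b0: "0 < b" using b[OF e(1)] e(2) by linarith
    have u0: "0 < u" using False u by simp
    show ?thesis
    proof (cases "u * b \<le> sqrt v")
      case True
      then have sv: "0 < sqrt v" using mult_pos_pos[OF u0 b0] by linarith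
      show ?thesis
      proof (rule key[of "u / sqrt v"])
        show "0 < u / sqrt v" using u0 sv by simp
        show "u / sqrt v * b \<le> 1" using True sv by (simp add: field_simps)
        have "(u / sqrt v)\<^sup>2 * v = u\<^sup>2" using sv by (simp add: power_divide)
        moreover have "u / sqrt v * t = 2 * u\<^sup>2 + u / sqrt v * (2 * u\<^sup>2 * b)"
          using sv by (simp add: t_def field_simps power2_eq_square)
        moreover have "0 \<le> u / sqrt v * (2 * u\<^sup>2 * b)" using u0 b0 sv by simp
        ultimately show "(u / sqrt v)\<^sup>2 * v - u / sqrt v * t \<le> - u\<^sup>2" by linarith
      qed
    next
      case False
      show ?thesis
      proof (rule key[of "1 / b"])
        have "v = sqrt v * sqrt v" using v0 by simp
        also have "\<dots> \<le> (u * b) * (u * b)" using False v0 u0 b0 by (intro mult_mono) auto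
        finally have "(1 / b)\<^sup>2 * v \<le> u\<^sup>2" using b0 by (simp add: power2_eq_square field_simps)
        moreover have "1 / b * t = 1 / b * (2 * u * sqrt v) + 2 * u\<^sup>2" using b0 by (simp add: t_def field_simps)
        moreover have "0 \<le> 1 / b * (2 * u * sqrt v)" using b0 u0 v0 by simp
        ultimately show "(1 / b)\<^sup>2 * v - 1 / b * t \<le> - u\<^sup>2" by linarith
      qed (use b0 in auto)
    qed
  qed
  then show ?thesis by (simp add: t_def v_def Z_def)
qed

lemma bernstein_Pi_pmf:
  fixes c q :: "'a \<Rightarrow> real"
  assumes fin: "finite R" and q: "\<And>e. e \<in> R \<Longrightarrow> 0 \<le> q e \<and> q e \<le> 1" and u: "0 \<le> u"
    and b0: "0 \<le> b" and b: "\<And>e. e \<in> R \<Longrightarrow> \<bar>c e\<bar> \<le> b"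
  shows "measure_pmf.prob (bernoulli_Pi R q)
     {f. 2 * u * sqrt (\<Sum>e\<in>R. q e * (c e)\<^sup>2) + 2 * u\<^sup>2 * b < \<bar>\<Sum>e\<in>R. c e * (of_bool (f e) - q e)\<bar>} \<le> 2 * exp (- u\<^sup>2)"
proof (rule two_sided_tail)
  show "measure_pmf.prob (bernoulli_Pi R q)
     {f. 2 * u * sqrt (\<Sum>e\<in>R. q e * (c e)\<^sup>2) + 2 * u\<^sup>2 * b < (\<Sum>e\<in>R. c e * (of_bool (f e) - q e))} \<le> exp (- u\<^sup>2)"
    by (rule bernstein_Pi_pmf_one_sided[OF fin q u b0 b])
  show "measure_pmf.prob (bernoulli_Pi R q)
     {f. 2 * u * sqrt (\<Sum>e\<in>R. q e * (c e)\<^sup>2) + 2 * u\<^sup>2 * b < - (\<Sum>e\<in>R. c e * (of_bool (f e) - q e))} \<le> exp (- u\<^sup>2)"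
    using bernstein_Pi_pmf_one_sided[where c = "\<lambda>e. - c e", OF fin q u b0] b by (simp add: sum_negf)
qed

text \<open>Both tail bounds persist when the coefficients depend on coordinates outside \<open>R\<close>: condition on those.\<close>

lemma hoeffding_Pi_pmf_cond:
  fixes q :: "'a \<Rightarrow> real" and c :: "('a \<Rightarrow> bool) \<Rightarrow> 'a \<Rightarrow> real"
  assumes fin: "finite I" and R: "R \<subseteq> I" and q: "\<And>e. e \<in> I \<Longrightarrow> 0 \<le> q e \<and> q e \<le> 1" and u: "0 \<le> u"
    and indep: "\<And>f f' e. (\<And>e'. e' \<notin> R \<Longrightarrow> f e' = f' e') \<Longrightarrow> e \<in> R \<Longrightarrow> c f e = c f' e"
  shows "measure_pmf.prob (bernoulli_Pi I q)
     {f. u * sqrt (\<Sum>e\<in>R. (c f e)\<^sup>2) < \<bar>\<Sum>e\<in>R. c f e * (of_bool (f e) - q e)\<bar>} \<le> 2 * exp (- 2 * u\<^sup>2)"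
proof (rule prob_Pi_pmf_le_cond[OF fin R])
  fix g :: "'a \<Rightarrow> bool"
  define c' where "c' = c (\<lambda>e. if e \<in> R then False else g e)"
  have c: "c (\<lambda>e. if e \<in> R then f e else g e) e = c' e" if "e \<in> R" for f e
    unfolding c'_def by (rule indep[OF _ that]) auto
  show "measure_pmf.prob (bernoulli_Pi R q)
     {f. (\<lambda>e. if e \<in> R then f e else g e) \<in> {f. u * sqrt (\<Sum>e\<in>R. (c f e)\<^sup>2) < \<bar>\<Sum>e\<in>R. c f e * (of_bool (f e) - q e)\<bar>}}
     \<le> 2 * exp (- 2 * u\<^sup>2)"
    using hoeffding_Pi_pmf[of R q u c'] fin R q u by (auto simp: c finite_subset subset_iff cong: sum.cong)
qed simp

lemma bernstein_Pi_pmf_cond: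
  fixes q :: "'a \<Rightarrow> real" and c :: "('a \<Rightarrow> bool) \<Rightarrow> 'a \<Rightarrow> real" and b :: "('a \<Rightarrow> bool) \<Rightarrow> real"
  assumes fin: "finite I" and R: "R \<subseteq> I" and q: "\<And>e. e \<in> I \<Longrightarrow> 0 \<le> q e \<and> q e \<le> 1" and u: "0 \<le> u"
    and indep: "\<And>f f' e. (\<And>e'. e' \<notin> R \<Longrightarrow> f e' = f' e') \<Longrightarrow> e \<in> R \<Longrightarrow> c f e = c f' e"
    and indep_b: "\<And>f f'. (\<And>e'. e' \<notin> R \<Longrightarrow> f e' = f' e') \<Longrightarrow> b f = b f'"
    and b0: "\<And>f. 0 \<le> b f" and b: "\<And>f e. e \<in> R \<Longrightarrow> \<bar>c f e\<bar> \<le> b f"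
  shows "measure_pmf.prob (bernoulli_Pi I q)
     {f. 2 * u * sqrt (\<Sum>e\<in>R. q e * (c f e)\<^sup>2) + 2 * u\<^sup>2 * b f < \<bar>\<Sum>e\<in>R. c f e * (of_bool (f e) - q e)\<bar>} \<le> 2 * exp (- u\<^sup>2)"
proof (rule prob_Pi_pmf_le_cond[OF fin R])
  fix g :: "'a \<Rightarrow> bool"
  define c' where "c' = c (\<lambda>e. if e \<in> R then False else g e)"
  define b' where "b' = b (\<lambda>e. if e \<in> R then False else g e)"
  have c: "c (\<lambda>e. if e \<in> R then f e else g e) e = c' e" if "e \<in> R" for f e
    unfolding c'_def by (rule indep[OF _ that]) auto
  have b'': "b (\<lambda>e. if e \<in> R then f e else g e) = b'" for f
    unfolding b'_def by (rule indep_b) auto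
  have bb: "\<bar>c' e\<bar> \<le> b'" if "e \<in> R" for e unfolding c'_def b'_def by (rule b[OF that])
  show "measure_pmf.prob (bernoulli_Pi R q)
     {f. (\<lambda>e. if e \<in> R then f e else g e) \<in> {f. 2 * u * sqrt (\<Sum>e\<in>R. q e * (c f e)\<^sup>2) + 2 * u\<^sup>2 * b f < \<bar>\<Sum>e\<in>R. c f e * (of_bool (f e) - q e)\<bar>}}
     \<le> 2 * exp (- u\<^sup>2)"
    using bernstein_Pi_pmf[of R q u b' c'] fin R q u bb b0[of "\<lambda>e. if e \<in> R then False else g e", folded b'_def] by (auto simp: c b'' finite_subset subset_iff cong: sum.cong)
qed simp

section \<open>Concentration in the Bradley--Terry--Luce model\<close>

definition Trip :: "nat \<Rightarrow> nat \<Rightarrow> (nat \<times> nat \<times> nat) set" where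
  "Trip n L = {(i, j, l). (i, j) \<in> Pairs n \<and> l < L}"

text \<open>Outcomes are available for every pair and are masked by the graph afterwards. This makes
  the data a function of two independent product samples, so that either one can be frozen while the
  other is random.\<close>

definition obs :: "((nat \<times> nat) \<Rightarrow> bool) \<Rightarrow> ((nat \<times> nat \<times> nat) \<Rightarrow> bool) \<Rightarrow> btl_data" where
  "obs A Y = (A, \<lambda>(i, j, l). A (i, j) \<and> Y (i, j, l))"

lemma fst_obs [simp]: "fst (obs A Y) = A" by (simp add: obs_def)

text \<open>Leaving out item \<open>i\<close>: it is compared with everybody and always loses, so a stationary vector
  puts no mass on it and restricts to a stationary vector of the remaining items.\<close>
definition leave_out :: "nat \<Rightarrow> btl_data \<Rightarrow> btl_data" where
  "leave_out i \<omega> = (\<lambda>(j, k). if j = i \<or> k = i then True else fst \<omega> (j, k),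
             \<lambda>(j, k, l). if j = i \<or> k = i then k = i else snd \<omega> (j, k, l))"

lemma finite_Pairs [simp]: "finite (Pairs n)"
  by (rule finite_subset[of _ "{..<n} \<times> {..<n}"]) (auto simp: Pairs_def)

lemma Trip_eq: "Trip n L = (\<lambda>((i, j), l). (i, j, l)) ` (Pairs n \<times> {..<L})"
  by (force simp: Trip_def)

lemma finite_Trip [simp]: "finite (Trip n L)"
  by (simp add: Trip_eq)

lemma sum_Trip: "(\<Sum>e\<in>Trip n L. F e) = (\<Sum>(i, j)\<in>Pairs n. \<Sum>l<L. F (i, j, l))"
  unfolding Trip_eq by (subst sum.reindex) (auto simp: inj_on_def sum.cartesian_product case_prod_unfold)

lemma sum_symmetrize_Pairs:
  fixes H :: "nat \<Rightarrow> nat \<Rightarrow> real"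
  assumes "\<And>i. H i i = 0"
  shows "(\<Sum>i<n. \<Sum>j<n. H i j) = (\<Sum>(i, j)\<in>Pairs n. H i j + H j i)"
proof -
  have "(\<Sum>i<n. \<Sum>j<n. H i j) = (\<Sum>(i, j)\<in>{..<n} \<times> {..<n}. H i j)" by (simp add: sum.cartesian_product)
  also have "\<dots> = (\<Sum>(i, j)\<in>Pairs n \<union> prod.swap ` Pairs n. H i j)"
  proof (rule sum.mono_neutral_right)
    show "\<forall>x\<in>{..<n} \<times> {..<n} - (Pairs n \<union> prod.swap ` Pairs n). (case x of (i, j) \<Rightarrow> H i j) = 0"
    proof
      fix x assume x: "x \<in> {..<n} \<times> {..<n} - (Pairs n \<union> prod.swap ` Pairs n)"
      obtain i j where ij: "x = (i, j)" by (cases x)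
      have "i < n" "j < n" and no: "(i, j) \<notin> Pairs n" "(i, j) \<notin> prod.swap ` Pairs n" using x ij by auto
      have "(i, j) \<in> prod.swap ` Pairs n" if "j < i"
        using that \<open>i < n\<close> by (intro image_eqI[of _ _ "(j, i)"]) (auto simp: Pairs_def)
      then have "i = j" using no \<open>i < n\<close> \<open>j < n\<close> by (cases i j rule: linorder_cases) (auto simp: Pairs_def)
      then show "(case x of (i, j) \<Rightarrow> H i j) = 0" using assms ij by simp
    qed
  qed (auto simp: Pairs_def)
  also have "\<dots> = (\<Sum>(i, j)\<in>Pairs n. H i j) + (\<Sum>(i, j)\<in>prod.swap ` Pairs n. H i j)"
    by (intro sum.union_disjoint finite_imageI finite_Pairs) (auto simp: Pairs_def)
  also have "(\<Sum>(i, j)\<in>prod.swap ` Pairs n. H i j) = (\<Sum>(i, j)\<in>Pairs n. H j i)"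
    by (subst sum.reindex) (auto simp: inj_on_def case_prod_unfold)
  finally show ?thesis by (simp add: sum.distrib case_prod_unfold)
qed

lemma sum_row_Pairs:
  assumes "i < n"
  shows "(\<Sum>e\<in>{e\<in>Pairs n. fst e = i \<or> snd e = i}. F e) = (\<Sum>j\<in>{..<n}-{i}. F (min i j, max i j))"
proof -
  have "bij_betw (\<lambda>j. (min i j, max i j)) ({..<n}-{i}) {e\<in>Pairs n. fst e = i \<or> snd e = i}"
  proof (rule bij_betwI[where g = "\<lambda>(j, k). if j = i then k else j"])
    show "(\<lambda>j. (min i j, max i j)) \<in> {..<n}-{i} \<rightarrow> {e\<in>Pairs n. fst e = i \<or> snd e = i}"
      using assms by (auto simp: Pairs_def min_def max_def)
    show "(\<lambda>(j, k). if j = i then k else j) \<in> {e\<in>Pairs n. fst e = i \<or> snd e = i} \<rightarrow> {..<n}-{i}"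
      by (auto simp: Pairs_def)
  qed (auto simp: Pairs_def min_def max_def)
  then show ?thesis by (subst sum.reindex_bij_betw[symmetric]) auto
qed

lemma sum_row_Trip:
  assumes "i < n"
  shows "(\<Sum>e\<in>{(j, k, l)\<in>Trip n L. j = i \<or> k = i}. F e) = (\<Sum>j\<in>{..<n}-{i}. \<Sum>l<L. F (min i j, max i j, l))"
proof -
  have "{(j, k, l)\<in>Trip n L. j = i \<or> k = i} = (\<lambda>((j, k), l). (j, k, l)) ` ({e\<in>Pairs n. fst e = i \<or> snd e = i} \<times> {..<L})"
    by (force simp: Trip_def)
  then have "(\<Sum>e\<in>{(j, k, l)\<in>Trip n L. j = i \<or> k = i}. F e)
      = (\<Sum>e\<in>{e\<in>Pairs n. fst e = i \<or> snd e = i}. \<Sum>l<L. F (fst e, snd e, l))"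
    by (simp only:) (subst sum.reindex, auto simp: inj_on_def sum.cartesian_product case_prod_unfold)
  also have "\<dots> = (\<Sum>j\<in>{..<n}-{i}. \<Sum>l<L. F (min i j, max i j, l))"
    by (subst sum_row_Pairs[OF assms]) simp
  finally show ?thesis .
qed

text \<open>An outcome outside the graph equals the default \<open>False\<close> in the model and
  after masking, and marginals of a product distribution are again products.\<close>

lemma btl_pmf_decouple:
  "btl_pmf n p L \<theta> = map_pmf (\<lambda>(A, Y). obs A Y)
     (pair_pmf (Pi_pmf (Pairs n) False (\<lambda>_. bernoulli_pmf p))
               (Pi_pmf (Trip n L) False (\<lambda>(i, j, l). bernoulli_pmf (psi (\<theta> i - \<theta> j)))))"
proof -
  let ?q = "\<lambda>(i, j, l). bernoulli_pmf (psi (\<theta> i - \<theta> j))"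
  let ?T = "\<lambda>A. {(i, j, l). (i, j) \<in> Pairs n \<and> A (i, j) \<and> l < L}"
  have "map_pmf (Pair A) (Pi_pmf (?T A) False ?q) = map_pmf (obs A) (Pi_pmf (Trip n L) False ?q)" for A
  proof -
    have "Pi_pmf (?T A) False ?q = map_pmf (\<lambda>f x. if x \<in> ?T A then f x else False) (Pi_pmf (Trip n L) False ?q)"
      by (rule Pi_pmf_subset[OF finite_Trip]) (auto simp: Trip_def)
    then have "map_pmf (Pair A) (Pi_pmf (?T A) False ?q)
        = map_pmf (\<lambda>f. (A, \<lambda>x. if x \<in> ?T A then f x else False)) (Pi_pmf (Trip n L) False ?q)"
      by (simp add: map_pmf_comp)
    also have "\<dots> = map_pmf (obs A) (Pi_pmf (Trip n L) False ?q)"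
    proof (rule map_pmf_cong[OF refl])
      fix Y assume "Y \<in> set_pmf (Pi_pmf (Trip n L) False ?q)"
      then have "Y x = False" if "x \<notin> Trip n L" for x
        using set_Pi_pmf_subset[OF finite_Trip, of n L False ?q] that by blast
      then show "(A, \<lambda>x. if x \<in> ?T A then Y x else False) = obs A Y"
        by (auto simp: obs_def fun_eq_iff Trip_def)
    qed
    finally show ?thesis .
  qed
  then show ?thesis
    unfolding btl_pmf_def pair_pmf_def map_pmf_def by (simp add: bind_assoc_pmf bind_return_pmf)
qed

lemma prob_btl_le_graph:
  assumes "\<And>A. measure_pmf.prob (Pi_pmf (Trip n L) False (\<lambda>(i, j, l). bernoulli_pmf (psi (\<theta> i - \<theta> j)))) {Y. obs A Y \<in> E} \<le> c" "0 \<le> c"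
  shows "measure_pmf.prob (btl_pmf n p L \<theta>) E \<le> c"
  unfolding btl_pmf_decouple measure_map_pmf using assms by (intro prob_pair_pmf_le_fst) auto

lemma prob_btl_le_outcome:
  assumes "\<And>Y. measure_pmf.prob (Pi_pmf (Pairs n) False (\<lambda>_. bernoulli_pmf p)) {A. obs A Y \<in> E} \<le> c" "0 \<le> c"
  shows "measure_pmf.prob (btl_pmf n p L \<theta>) E \<le> c"
  unfolding btl_pmf_decouple measure_map_pmf using assms by (intro prob_pair_pmf_le_snd) auto

lemma psi_bounds: "0 \<le> psi t" "psi t \<le> 1"
  by (auto simp: psi_def add_pos_pos field_simps)

lemma psi_minus: "psi (- t) = 1 - psi t"
proof -
  have "1 + exp t \<noteq> 0" by (metis add_pos_pos exp_gt_zero less_irrefl zero_less_one)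
  then show ?thesis by (simp add: psi_def exp_minus field_simps)
qed

definition xi :: "nat \<Rightarrow> (nat \<Rightarrow> real) \<Rightarrow> btl_data \<Rightarrow> nat \<Rightarrow> nat \<Rightarrow> real" where
  "xi L \<theta> \<omega> i j = ybar L \<omega> i j - psi (\<theta> i - \<theta> j)"

lemma Aij_obs: "Aij (obs A Y) i j = (if i = j then 0 else of_bool (A (min i j, max i j)))"
  by (auto simp: Aij_def obs_def min_def max_def)

lemma Aij_xi_obs:
  assumes "L \<ge> 1" "i \<noteq> j"
  shows "Aij (obs A Y) i j * xi L \<theta> (obs A Y) i j =
    of_bool (A (min i j, max i j)) * ((if i < j then 1 else - 1) / real L) *
      (\<Sum>l<L. of_bool (Y (min i j, max i j, l)) - psi (\<theta> (min i j) - \<theta> (max i j)))"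
proof (cases "A (min i j, max i j)")
  case True
  have L: "real L > 0" using assms by simp
  have A1: "Aij (obs A Y) i j = 1" using True assms by (simp add: Aij_obs)
  show ?thesis
  proof (cases "i < j")
    case lt: True
    then show ?thesis unfolding A1 using True L by (simp add: xi_def ybar_def obs_def sum_subtractf field_simps min_def max_def)
  next
    case False
    then have lt: "j < i" using assms by simp
    have "psi (\<theta> i - \<theta> j) = 1 - psi (\<theta> j - \<theta> i)" using psi_minus[of "\<theta> j - \<theta> i"] by simp
    moreover have "ybar L (obs A Y) i j = 1 - (\<Sum>l<L. of_bool (Y (j, i, l))) / real L"
      using True lt by (simp add: ybar_def obs_def min_def max_def)
    ultimately show ?thesis unfolding A1 using True L lt
      by (simp add: xi_def sum_subtractf diff_divide_distrib min_def max_def)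
  qed
qed (use assms in \<open>simp add: Aij_obs\<close>)

lemma leave_out_obs_indep_outcome:
  assumes "\<And>e. e \<notin> {(j, k, l)\<in>Trip n L. j = i \<or> k = i} \<Longrightarrow> Y e = Y' e"
  shows "leave_out i (obs A Y) = leave_out i (obs A Y')"
  using assms by (auto simp: leave_out_def obs_def fun_eq_iff)

lemma leave_out_obs_indep_graph:
  assumes "\<And>e. e \<notin> {e\<in>Pairs n. fst e = i \<or> snd e = i} \<Longrightarrow> A e = A' e"
  shows "leave_out i (obs A Y) = leave_out i (obs A' Y)"
  using assms by (auto simp: leave_out_def obs_def fun_eq_iff)

text \<open>Independence of row \<open>i\<close> is built into the form of the coefficients: they
  see the data only through \<open>leave_out i \<omega>\<close>, which ignores all outcomes at
  \<open>i\<close>. With graph and other outcomes fixed, the sum is a linear form in the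
  \<open>L\<close> outcomes of each comparison of \<open>i\<close>, and Hoeffding applies.\<close>

lemma row_noise_tail:
  assumes i: "i < n" and L: "L \<ge> 1" and u: "0 \<le> u"
  shows "measure_pmf.prob (btl_pmf n p L \<theta>)
     {\<omega>. u * sqrt (\<Sum>j\<in>{..<n}-{i}. Aij \<omega> i j * (C (leave_out i \<omega>) j)\<^sup>2 / real L)
        < \<bar>\<Sum>j\<in>{..<n}-{i}. Aij \<omega> i j * C (leave_out i \<omega>) j * xi L \<theta> \<omega> i j\<bar>} \<le> 2 * exp (- 2 * u\<^sup>2)"
proof (rule prob_btl_le_graph)
  fix A
  define q where "q = (\<lambda>(i, j, l :: nat). psi (\<theta> i - \<theta> j))"
  define R where "R = {(j, k, l)\<in>Trip n L. j = i \<or> k = i}"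
  define c where "c Y = (\<lambda>(j, k, l :: nat). of_bool (A (j, k)) * ((if j = i then C (leave_out i (obs A Y)) k else - C (leave_out i (obs A Y)) j) / real L))" for Y
  have q: "(\<lambda>(i, j, l). bernoulli_pmf (psi (\<theta> i - \<theta> j))) = (\<lambda>e. bernoulli_pmf (q e))"
    by (auto simp: q_def fun_eq_iff)
  have 1: "(\<Sum>e\<in>R. c Y e * (of_bool (Y e) - q e)) =
      (\<Sum>j\<in>{..<n}-{i}. Aij (obs A Y) i j * C (leave_out i (obs A Y)) j * xi L \<theta> (obs A Y) i j)" for Y
    unfolding R_def sum_row_Trip[OF i]
  proof (rule sum.cong[OF refl])
    fix j assume j: "j \<in> {..<n} - {i}"
    have "(\<Sum>l<L. c Y (min i j, max i j, l) * (of_bool (Y (min i j, max i j, l)) - q (min i j, max i j, l)))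
       = (of_bool (A (min i j, max i j)) * ((if i < j then 1 else - 1) / real L) *
      (\<Sum>l<L. of_bool (Y (min i j, max i j, l)) - psi (\<theta> (min i j) - \<theta> (max i j)))) * C (leave_out i (obs A Y)) j"
      using j unfolding sum_distrib_left sum_distrib_right
      by (intro sum.cong refl) (auto simp: c_def q_def min_def max_def)
    also have "\<dots> = Aij (obs A Y) i j * xi L \<theta> (obs A Y) i j * C (leave_out i (obs A Y)) j"
      using j L by (subst Aij_xi_obs) auto
    finally show "(\<Sum>l<L. c Y (min i j, max i j, l) * (of_bool (Y (min i j, max i j, l)) - q (min i j, max i j, l)))
       = Aij (obs A Y) i j * C (leave_out i (obs A Y)) j * xi L \<theta> (obs A Y) i j" by simp
  qed
  have 2: "(\<Sum>e\<in>R. (c Y e)\<^sup>2) = (\<Sum>j\<in>{..<n}-{i}. Aij (obs A Y) i j * (C (leave_out i (obs A Y)) j)\<^sup>2 / real L)" for Y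
    unfolding R_def sum_row_Trip[OF i]
    by (intro sum.cong refl) (use L in \<open>auto simp: c_def Aij_obs power_divide power2_eq_square min_def max_def\<close>)
  have "measure_pmf.prob (bernoulli_Pi (Trip n L) q)
     {Y. u * sqrt (\<Sum>e\<in>R. (c Y e)\<^sup>2) < \<bar>\<Sum>e\<in>R. c Y e * (of_bool (Y e) - q e)\<bar>} \<le> 2 * exp (- 2 * u\<^sup>2)"
  proof (rule hoeffding_Pi_pmf_cond[OF finite_Trip _ _ u])
    fix Y Y' :: "nat \<times> nat \<times> nat \<Rightarrow> bool" and e
    assume "\<And>e'. e' \<notin> R \<Longrightarrow> Y e' = Y' e'"
    then have "leave_out i (obs A Y) = leave_out i (obs A Y')" unfolding R_def by (rule leave_out_obs_indep_outcome)
    then show "c Y e = c Y' e" by (simp only: c_def)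
  qed (auto simp: R_def q_def psi_bounds)
  then show "measure_pmf.prob (Pi_pmf (Trip n L) False (\<lambda>(i, j, l). bernoulli_pmf (psi (\<theta> i - \<theta> j)))) {Y. obs A Y \<in>
     {\<omega>. u * sqrt (\<Sum>j\<in>{..<n}-{i}. Aij \<omega> i j * (C (leave_out i \<omega>) j)\<^sup>2 / real L)
        < \<bar>\<Sum>j\<in>{..<n}-{i}. Aij \<omega> i j * C (leave_out i \<omega>) j * xi L \<theta> \<omega> i j\<bar>}} \<le> 2 * exp (- 2 * u\<^sup>2)"
    unfolding 1 2 q by simp
qed simp

lemma Aij_sym: "Aij \<omega> i j = Aij \<omega> j i" by (auto simp: Aij_def)
lemma Aij_diag [simp]: "Aij \<omega> i i = 0" by (simp add: Aij_def)
lemma xi_antisym': "i \<noteq> j \<Longrightarrow> xi L \<theta> \<omega> j i = - xi L \<theta> \<omega> i j"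
  using psi_minus[of "\<theta> i - \<theta> j"] by (auto simp: xi_def ybar_def)

text \<open>The noise is antisymmetric, so a comparison enters the double sum once, with weight
  \<open>g i - g j\<close>. The graph is fixed before the outcomes are drawn, hence \<open>g\<close>
  may depend on it.\<close>

lemma linear_noise_tail:
  fixes g :: "((nat \<times> nat) \<Rightarrow> bool) \<Rightarrow> nat \<Rightarrow> real" and w :: "nat \<Rightarrow> nat \<Rightarrow> real"
  assumes L: "L \<ge> 1" and u: "0 \<le> u" and w: "\<And>i j. w i j = w j i"
  shows "measure_pmf.prob (btl_pmf n p L \<theta>)
     {\<omega>. u * sqrt (\<Sum>(i, j)\<in>Pairs n. Aij \<omega> i j * (w i j * (g (fst \<omega>) i - g (fst \<omega>) j))\<^sup>2 / real L)
        < \<bar>\<Sum>i<n. g (fst \<omega>) i * (\<Sum>j<n. Aij \<omega> i j * w i j * xi L \<theta> \<omega> i j)\<bar>} \<le> 2 * exp (- 2 * u\<^sup>2)"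
proof (rule prob_btl_le_graph)
  fix A
  define q where "q = (\<lambda>(i, j, l :: nat). psi (\<theta> i - \<theta> j))"
  define c where "c = (\<lambda>(i, j, l :: nat). of_bool (A (i, j)) * (w i j * (g A i - g A j)) / real L)"
  have q: "(\<lambda>(i, j, l). bernoulli_pmf (psi (\<theta> i - \<theta> j))) = (\<lambda>e. bernoulli_pmf (q e))"
    by (auto simp: q_def fun_eq_iff)
  have 1: "(\<Sum>e\<in>Trip n L. c e * (of_bool (Y e) - q e)) =
      (\<Sum>i<n. g A i * (\<Sum>j<n. Aij (obs A Y) i j * w i j * xi L \<theta> (obs A Y) i j))" for Y
  proof -
    have "(\<Sum>i<n. g A i * (\<Sum>j<n. Aij (obs A Y) i j * w i j * xi L \<theta> (obs A Y) i j))
      = (\<Sum>i<n. \<Sum>j<n. g A i * (Aij (obs A Y) i j * w i j * xi L \<theta> (obs A Y) i j))"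
      by (simp add: sum_distrib_left)
    also have "\<dots> = (\<Sum>(i, j)\<in>Pairs n. g A i * (Aij (obs A Y) i j * w i j * xi L \<theta> (obs A Y) i j)
        + g A j * (Aij (obs A Y) j i * w j i * xi L \<theta> (obs A Y) j i))"
      by (rule sum_symmetrize_Pairs) simp
    also have "\<dots> = (\<Sum>(i, j)\<in>Pairs n. (w i j * (g A i - g A j)) * (Aij (obs A Y) i j * xi L \<theta> (obs A Y) i j))"
    proof (intro sum.cong refl, safe)
      fix i j assume "(i, j) \<in> Pairs n"
      then have "i \<noteq> j" by (auto simp: Pairs_def)
      then show "g A i * (Aij (obs A Y) i j * w i j * xi L \<theta> (obs A Y) i j)
        + g A j * (Aij (obs A Y) j i * w j i * xi L \<theta> (obs A Y) j i) = (w i j * (g A i - g A j)) * (Aij (obs A Y) i j * xi L \<theta> (obs A Y) i j)"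
        using xi_antisym'[of i j L \<theta> "obs A Y"] Aij_sym[of "obs A Y" j i] w[of j i] by (simp add: algebra_simps)
    qed
    also have "\<dots> = (\<Sum>(i, j)\<in>Pairs n. \<Sum>l<L. c (i, j, l) * (of_bool (Y (i, j, l)) - q (i, j, l)))"
    proof (intro sum.cong refl, safe)
      fix i j assume "(i, j) \<in> Pairs n"
      then have ij: "i < j" by (auto simp: Pairs_def)
      then show "(w i j * (g A i - g A j)) * (Aij (obs A Y) i j * xi L \<theta> (obs A Y) i j)
         = (\<Sum>l<L. c (i, j, l) * (of_bool (Y (i, j, l)) - q (i, j, l)))"
        using L by (subst Aij_xi_obs) (auto simp: c_def q_def min_def max_def sum_distrib_left)
    qed
    also have "\<dots> = (\<Sum>e\<in>Trip n L. c e * (of_bool (Y e) - q e))" by (simp add: sum_Trip)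
    finally show ?thesis ..
  qed
  have 2: "(\<Sum>e\<in>Trip n L. (c e)\<^sup>2) = (\<Sum>(i, j)\<in>Pairs n. Aij (obs A Y) i j * (w i j * (g A i - g A j))\<^sup>2 / real L)" for Y
    unfolding sum_Trip
    by (intro sum.cong refl) (use L in \<open>auto simp: c_def Aij_obs Pairs_def power_divide power2_eq_square min_def max_def\<close>)
  have "measure_pmf.prob (bernoulli_Pi (Trip n L) q)
     {Y. u * sqrt (\<Sum>e\<in>Trip n L. (c e)\<^sup>2) < \<bar>\<Sum>e\<in>Trip n L. c e * (of_bool (Y e) - q e)\<bar>} \<le> 2 * exp (- 2 * u\<^sup>2)"
    by (rule hoeffding_Pi_pmf[OF finite_Trip _ u]) (auto simp: q_def psi_bounds)
  then show "measure_pmf.prob (Pi_pmf (Trip n L) False (\<lambda>(i, j, l). bernoulli_pmf (psi (\<theta> i - \<theta> j)))) {Y. obs A Y \<in>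
     {\<omega>. u * sqrt (\<Sum>(i, j)\<in>Pairs n. Aij \<omega> i j * (w i j * (g (fst \<omega>) i - g (fst \<omega>) j))\<^sup>2 / real L)
        < \<bar>\<Sum>i<n. g (fst \<omega>) i * (\<Sum>j<n. Aij \<omega> i j * w i j * xi L \<theta> \<omega> i j)\<bar>}} \<le> 2 * exp (- 2 * u\<^sup>2)"
    unfolding q by (simp only: mem_Collect_eq fst_obs 1 2[symmetric])
qed simp

text \<open>Now all outcomes are frozen and only the edges at \<open>i\<close> are random;
  \<open>leave_out i \<omega>\<close> ignores these edges as well. Bernstein is used because the
  variance of an edge is of order \<open>p\<close>, which may be tiny.\<close>

lemma row_graph_tail:
  assumes i: "i < n" and p: "0 \<le> p" "p \<le> 1" and u: "0 \<le> u"
    and b0: "\<And>\<omega>. 0 \<le> b \<omega>" and b: "\<And>\<omega> j. j < n \<Longrightarrow> j \<noteq> i \<Longrightarrow> \<bar>C \<omega> j\<bar> \<le> b \<omega>"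
  shows "measure_pmf.prob (btl_pmf n p L \<theta>)
     {\<omega>. 2 * u * sqrt (\<Sum>j\<in>{..<n}-{i}. p * (C (leave_out i \<omega>) j)\<^sup>2) + 2 * u\<^sup>2 * b (leave_out i \<omega>)
        < \<bar>\<Sum>j\<in>{..<n}-{i}. C (leave_out i \<omega>) j * (Aij \<omega> i j - p)\<bar>} \<le> 2 * exp (- u\<^sup>2)"
proof (rule prob_btl_le_outcome)
  fix Y
  define R where "R = {e\<in>Pairs n. fst e = i \<or> snd e = i}"
  define c where "c A = (\<lambda>(j, k). if j = i then C (leave_out i (obs A Y)) k else C (leave_out i (obs A Y)) j)" for A
  have 1: "(\<Sum>e\<in>R. c A e * (of_bool (A e) - p)) = (\<Sum>j\<in>{..<n}-{i}. C (leave_out i (obs A Y)) j * (Aij (obs A Y) i j - p))" for A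
    unfolding R_def sum_row_Pairs[OF i] by (intro sum.cong refl) (auto simp: c_def Aij_obs min_def max_def)
  have 2: "(\<Sum>e\<in>R. p * (c A e)\<^sup>2) = (\<Sum>j\<in>{..<n}-{i}. p * (C (leave_out i (obs A Y)) j)\<^sup>2)" for A
    unfolding R_def sum_row_Pairs[OF i] by (intro sum.cong refl) (auto simp: c_def min_def max_def)
  have rp: "leave_out i (obs A Y) = leave_out i (obs A' Y)" if "\<And>e'. e' \<notin> R \<Longrightarrow> A e' = A' e'" for A A'
    using that unfolding R_def by (rule leave_out_obs_indep_graph)
  have "measure_pmf.prob (Pi_pmf (Pairs n) False (\<lambda>e. bernoulli_pmf p))
     {A. 2 * u * sqrt (\<Sum>e\<in>R. p * (c A e)\<^sup>2) + 2 * u\<^sup>2 * b (leave_out i (obs A Y)) < \<bar>\<Sum>e\<in>R. c A e * (of_bool (A e) - p)\<bar>} \<le> 2 * exp (- u\<^sup>2)"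
  proof (rule bernstein_Pi_pmf_cond[OF finite_Pairs _ _ u])
    fix A A' :: "nat \<times> nat \<Rightarrow> bool" and e
    assume "\<And>e'. e' \<notin> R \<Longrightarrow> A e' = A' e'"
    then have "leave_out i (obs A Y) = leave_out i (obs A' Y)" by (rule rp)
    then show "c A e = c A' e" "b (leave_out i (obs A Y)) = b (leave_out i (obs A' Y))"
      by (simp_all only: c_def)
  next
    fix A e assume "e \<in> R"
    then show "\<bar>c A e\<bar> \<le> b (leave_out i (obs A Y))" using i by (auto simp: c_def R_def Pairs_def intro!: b)
  qed (use p b0 in \<open>auto simp: R_def\<close>)
  then show "measure_pmf.prob (Pi_pmf (Pairs n) False (\<lambda>_. bernoulli_pmf p)) {A. obs A Y \<in>
     {\<omega>. 2 * u * sqrt (\<Sum>j\<in>{..<n}-{i}. p * (C (leave_out i \<omega>) j)\<^sup>2) + 2 * u\<^sup>2 * b (leave_out i \<omega>)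
        < \<bar>\<Sum>j\<in>{..<n}-{i}. C (leave_out i \<omega>) j * (Aij \<omega> i j - p)\<bar>}} \<le> 2 * exp (- u\<^sup>2)"
    unfolding 1 2 by simp
qed simp

lemma cut_tail:
  assumes S: "S \<subseteq> {..<n}" and p: "0 \<le> p" "p \<le> 1"
  shows "measure_pmf.prob (btl_pmf n p L \<theta>)
     {\<omega>. (\<Sum>i\<in>S. \<Sum>j\<in>{..<n}-S. Aij \<omega> i j) < p * real (card S) * real (n - card S) / 2}
     \<le> 2 * exp (- (p * real (card S) * real (n - card S)) / 64)"
proof (rule prob_btl_le_outcome)
  fix Y
  define \<mu> where "\<mu> = p * real (card S) * real (n - card S)"
  have mu0: "0 \<le> \<mu>" using p by (simp add: \<mu>_def)
  \<comment> \<open>With this choice the Bernstein deviation is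
    \<open>\<mu> / 4 + \<mu> / 32\<close>, below the allowed loss \<open>\<mu> / 2\<close>, and the
    exponent \<open>u\<^sup>2\<close> is \<open>\<mu> / 64\<close>.\<close>
  define u where "u = sqrt \<mu> / 8"
  define c where "c = (\<lambda>(i, j). of_bool ((i \<in> S \<and> j \<notin> S) \<or> (j \<in> S \<and> i \<notin> S)) :: real)"
  have c2: "(c e)\<^sup>2 = c e" for e by (cases e) (simp add: c_def of_bool_def)
  have finS: "finite S" using S by (auto intro: finite_subset)
  have restrict: "(\<Sum>i\<in>S. \<Sum>j\<in>{..<n}-S. H i j) = (\<Sum>i<n. \<Sum>j<n. of_bool (i \<in> S \<and> j \<notin> S) * H i j)" for H :: "nat \<Rightarrow> nat \<Rightarrow> real"
  proof -
    have "(\<Sum>i\<in>S. \<Sum>j\<in>{..<n}-S. H i j) = (\<Sum>i\<in>S. \<Sum>j<n. of_bool (i \<in> S \<and> j \<notin> S) * H i j)"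
      by (intro sum.cong refl sum.mono_neutral_cong_left) auto
    also have "\<dots> = (\<Sum>i<n. \<Sum>j<n. of_bool (i \<in> S \<and> j \<notin> S) * H i j)"
      using S by (intro sum.mono_neutral_cong_left) auto
    finally show ?thesis .
  qed
  have cut: "(\<Sum>i\<in>S. \<Sum>j\<in>{..<n}-S. H i j) = (\<Sum>e\<in>Pairs n. c e * H (fst e) (snd e))"
    if H: "\<And>i j. H i j = H j i" for H :: "nat \<Rightarrow> nat \<Rightarrow> real"
    unfolding restrict by (subst sum_symmetrize_Pairs) (auto simp: c_def intro!: sum.cong intro: H)
  have 1: "(\<Sum>i\<in>S. \<Sum>j\<in>{..<n}-S. Aij (obs A Y) i j) = (\<Sum>e\<in>Pairs n. c e * of_bool (A e))" for A
    by (subst cut[OF Aij_sym]) (auto intro!: sum.cong simp: Aij_obs Pairs_def min_def max_def)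
  have 2: "(\<Sum>e\<in>Pairs n. c e * p) = \<mu>"
  proof -
    have "(\<Sum>e\<in>Pairs n. c e * p) = (\<Sum>i\<in>S. \<Sum>j\<in>{..<n}-S. p)" by (subst cut) auto
    also have "\<dots> = \<mu>" using S finS by (simp add: \<mu>_def card_Diff_subset)
    finally show ?thesis .
  qed
  have 3: "(\<Sum>e\<in>Pairs n. p * (c e)\<^sup>2) = \<mu>"
    unfolding 2[symmetric] by (simp add: c2 mult.commute)
  have "measure_pmf.prob (Pi_pmf (Pairs n) False (\<lambda>e. bernoulli_pmf p))
     {A. 2 * u * sqrt (\<Sum>e\<in>Pairs n. p * (c e)\<^sup>2) + 2 * u\<^sup>2 * 1 < \<bar>\<Sum>e\<in>Pairs n. c e * (of_bool (A e) - p)\<bar>} \<le> 2 * exp (- u\<^sup>2)"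
    by (rule bernstein_Pi_pmf) (use p mu0 in \<open>auto simp: c_def u_def\<close>)
  moreover have "2 * u * sqrt (\<Sum>e\<in>Pairs n. p * (c e)\<^sup>2) + 2 * u\<^sup>2 * 1 = 9/32 * \<mu>"
    unfolding 3 using mu0 by (simp add: u_def power_divide field_simps)
  moreover have "u\<^sup>2 = \<mu> / 64" using mu0 by (simp add: u_def power_divide)
  ultimately have T: "measure_pmf.prob (Pi_pmf (Pairs n) False (\<lambda>e. bernoulli_pmf p))
     {A. 9/32 * \<mu> < \<bar>\<Sum>e\<in>Pairs n. c e * (of_bool (A e) - p)\<bar>} \<le> 2 * exp (- \<mu> / 64)"
    by (simp only: minus_divide_left)
  have "{A. obs A Y \<in> {\<omega>. (\<Sum>i\<in>S. \<Sum>j\<in>{..<n}-S. Aij \<omega> i j) < \<mu> / 2}}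
      \<subseteq> {A. 9/32 * \<mu> < \<bar>\<Sum>e\<in>Pairs n. c e * (of_bool (A e) - p)\<bar>}"
  proof safe
    fix A assume "(\<Sum>i\<in>S. \<Sum>j\<in>{..<n}-S. Aij (obs A Y) i j) < \<mu> / 2"
    then have "(\<Sum>e\<in>Pairs n. c e * of_bool (A e)) < \<mu> / 2" unfolding 1 .
    moreover have "(\<Sum>e\<in>Pairs n. c e * (of_bool (A e) - p)) = (\<Sum>e\<in>Pairs n. c e * of_bool (A e)) - \<mu>"
      by (simp add: 2[symmetric] sum_subtractf algebra_simps)
    ultimately show "9/32 * \<mu> < \<bar>\<Sum>e\<in>Pairs n. c e * (of_bool (A e) - p)\<bar>" using mu0 by linarith
  qed
  then have "measure_pmf.prob (Pi_pmf (Pairs n) False (\<lambda>_. bernoulli_pmf p)) {A. obs A Y \<in> {\<omega>. (\<Sum>i\<in>S. \<Sum>j\<in>{..<n}-S. Aij \<omega> i j) < \<mu> / 2}}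
      \<le> 2 * exp (- \<mu> / 64)"
    by (intro order_trans[OF measure_pmf.finite_measure_mono T]) auto
  then show "measure_pmf.prob (Pi_pmf (Pairs n) False (\<lambda>_. bernoulli_pmf p)) {A. obs A Y \<in> {\<omega>. (\<Sum>i\<in>S. \<Sum>j\<in>{..<n}-S. Aij \<omega> i j) < p * real (card S) * real (n - card S) / 2}}
      \<le> 2 * exp (- (p * real (card S) * real (n - card S)) / 64)"
    unfolding \<mu>_def .
qed simp

section \<open>Spectral estimator and leave-one-out vectors\<close>

lemma (in comparison_data) M_normalized:
  assumes "(\<Sum>i\<in>V. A j i * (\<pi> j * \<eta> i j - \<pi> i * \<eta> j i)) = 0"
  shows "M V (\<lambda>i. \<pi> i / a i / c - 1) j = B V j"
proof -
  have "M V (\<lambda>i. \<pi> i / a i / c) j = (\<Sum>i\<in>V. A j i * (\<pi> j * \<eta> i j - \<pi> i * \<eta> j i)) / c"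
    unfolding M_def sum_divide_distrib
    by (intro sum.cong refl) (use a_pos in \<open>simp add: less_imp_neq[THEN not_sym] field_simps diff_divide_distrib\<close>)
  also have "\<dots> = 0" using assms by simp
  finally have 0: "M V (\<lambda>i. \<pi> i / a i / c) j = 0" .
  have "M V (\<lambda>_. 0) j = 0" by (simp add: M_def)
  then show ?thesis using M_shift[of V "\<lambda>i. \<pi> i / a i / c" "\<lambda>_. 0" 1 j] 0 by simp
qed

lemma ybar_nonneg: "L \<ge> 1 \<Longrightarrow> 0 \<le> ybar L \<omega> i j"
proof -
  assume L: "L \<ge> 1"
  have "(\<Sum>l<L. of_bool (P l)) \<le> (\<Sum>l<L. 1 :: real)" for P by (intro sum_mono) simp
  then have "(\<Sum>l<L. of_bool (P l)) / real L \<le> 1" for P using L by (simp add: field_simps)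
  then show ?thesis by (auto simp: ybar_def intro!: divide_nonneg_nonneg sum_nonneg)
qed

lemma ybar_add: "i \<noteq> j \<Longrightarrow> ybar L \<omega> i j + ybar L \<omega> j i = 1"
  by (auto simp: ybar_def)

lemma Aij_leave_out: "j \<noteq> i \<Longrightarrow> k \<noteq> i \<Longrightarrow> Aij (leave_out i \<omega>) j k = Aij \<omega> j k"
  by (simp add: Aij_def leave_out_def)
lemma Aij_leave_out_row: "k \<noteq> i \<Longrightarrow> Aij (leave_out i \<omega>) i k = 1" "k \<noteq> i \<Longrightarrow> Aij (leave_out i \<omega>) k i = 1"
  by (simp_all add: Aij_def leave_out_def)
lemma ybar_leave_out: "j \<noteq> i \<Longrightarrow> k \<noteq> i \<Longrightarrow> ybar L (leave_out i \<omega>) j k = ybar L \<omega> j k"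
  by (simp add: ybar_def leave_out_def)
lemma ybar_leave_out_row: "L \<ge> 1 \<Longrightarrow> k \<noteq> i \<Longrightarrow> ybar L (leave_out i \<omega>) i k = 0" "L \<ge> 1 \<Longrightarrow> k \<noteq> i \<Longrightarrow> ybar L (leave_out i \<omega>) k i = 1"
  by (auto simp: ybar_def leave_out_def)

lemma stationary_balance:
  assumes st: "stationary_prob n (Pmat n p L \<omega>) \<pi>" and p: "0 < p" and j: "j < n"
  shows "(\<Sum>i<n. Aij \<omega> j i * (\<pi> j * ybar L \<omega> i j - \<pi> i * ybar L \<omega> j i)) = 0"
proof -
  define d where "d = 2 * real n * p"
  have d: "d \<noteq> 0" using p j by (simp add: d_def)
  define S where "S = (\<Sum>k\<in>{..<n} - {j}. Aij \<omega> j k * ybar L \<omega> k j)"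
  have "\<pi> j = (\<Sum>i<n. \<pi> i * Pmat n p L \<omega> i j)" using st j by (simp add: stationary_prob_def)
  also have "\<dots> = \<pi> j * Pmat n p L \<omega> j j + (\<Sum>i\<in>{..<n}-{j}. \<pi> i * Pmat n p L \<omega> i j)"
    using j by (simp add: sum.remove)
  also have "Pmat n p L \<omega> j j = 1 - S / d" by (simp add: Pmat_def S_def d_def atLeast0LessThan)
  also have "(\<Sum>i\<in>{..<n}-{j}. \<pi> i * Pmat n p L \<omega> i j) = (\<Sum>i\<in>{..<n}-{j}. Aij \<omega> j i * (\<pi> i * ybar L \<omega> j i)) / d"
    unfolding sum_divide_distrib by (intro sum.cong refl) (auto simp: Pmat_def d_def Aij_sym[of \<omega> j])
  finally have "\<pi> j * S = (\<Sum>i\<in>{..<n}-{j}. Aij \<omega> j i * (\<pi> i * ybar L \<omega> j i))"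
    using d by (simp add: field_simps)
  then have "(\<Sum>i\<in>{..<n}-{j}. Aij \<omega> j i * (\<pi> j * ybar L \<omega> i j - \<pi> i * ybar L \<omega> j i)) = 0"
    unfolding S_def sum_distrib_left by (simp add: algebra_simps sum_subtractf)
  then show ?thesis using j by (simp add: sum.remove[of "{..<n}" j])
qed

text \<open>The hypothesis \<open>stat\<close> covers every data set, in particular the artificial
  ones of the form \<open>leave_out i \<omega>\<close>; evaluating \<open>ph\<close> there supplies
  the leave-one-out vectors without a separate existence argument. At least three items are required
  so that \<open>ln n\<close> is at least 1.\<close>

locale btl_model =
  fixes n :: nat and p :: real and L :: nat and \<theta> :: "nat \<Rightarrow> real" and R :: real
    and ph :: "btl_data \<Rightarrow> nat \<Rightarrow> real"
  assumes n3: "3 \<le> n" and p0: "0 < p" and p1: "p \<le> 1" and L1: "1 \<le> L" and R1: "1 \<le> R"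
    and theta_sum: "(\<Sum>i<n. \<theta> i) = 0"
    and theta_ratio: "i < n \<Longrightarrow> j < n \<Longrightarrow> exp (\<theta> i - \<theta> j) \<le> R"
    and stat: "stationary_prob n (Pmat n p L \<omega>) (ph \<omega>)"
begin

text \<open>Scaled to be of order one. The value 1 beyond the items keeps the bounds valid for all
  indices, as \<open>comparison_data\<close> demands.\<close>

definition a :: "nat \<Rightarrow> real" where "a i = (if i < n then real n * pi_star n \<theta> i else 1)"

lemma Z0: "0 < (\<Sum>k<n. exp (\<theta> k))" using n3 by (intro sum_pos) (auto simp: lessThan_empty_iff)

lemma a_eq: "i < n \<Longrightarrow> a i = real n / (\<Sum>k<n. exp (\<theta> k)) * exp (\<theta> i)"
  by (simp add: a_def pi_star_def)

lemma a_bounds: "1 / R \<le> a i" "a i \<le> R"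
proof -
  have "1 / R \<le> a i \<and> a i \<le> R"
  proof (cases "i < n")
    case True
    have le: "exp (\<theta> k) \<le> R * exp (\<theta> l)" if "k < n" "l < n" for k l
      using theta_ratio[OF that] by (simp add: exp_diff field_simps)
    have "real n * exp (\<theta> i) = (\<Sum>k<n. exp (\<theta> i))" by simp
    also have "\<dots> \<le> (\<Sum>k<n. R * exp (\<theta> k))" using le True by (intro sum_mono) auto
    finally have 1: "real n * exp (\<theta> i) \<le> R * (\<Sum>k<n. exp (\<theta> k))" by (simp add: sum_distrib_left)
    have "(\<Sum>k<n. exp (\<theta> k)) \<le> (\<Sum>k<n. R * exp (\<theta> i))" using le True by (intro sum_mono) auto
    then have 2: "(\<Sum>k<n. exp (\<theta> k)) \<le> R * (real n * exp (\<theta> i))" by (simp add: algebra_simps)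
    show ?thesis using 1 2 Z0 R1 True by (simp add: a_eq field_simps)
  qed (use R1 in \<open>auto simp: a_def field_simps\<close>)
  then show "1 / R \<le> a i" "a i \<le> R" by auto
qed

lemma cd: "R \<le> K \<Longrightarrow> comparison_data (Aij \<omega>) (ybar L \<omega>) a K"
proof
  fix i j assume RK: "R \<le> K"
  show "Aij \<omega> i j = Aij \<omega> j i" by (rule Aij_sym)
  show "Aij \<omega> i j = 0 \<or> Aij \<omega> i j = 1" by (auto simp: Aij_def)
  show "0 \<le> ybar L \<omega> i j" by (rule ybar_nonneg[OF L1])
  show "1 \<le> K" using R1 RK by simp
  have "1 / K \<le> 1 / R" using R1 RK by (simp add: field_simps)
  then show "1 / K \<le> a i" using a_bounds(1)[of i] by linarith
  show "a i \<le> K" using a_bounds(2)[of i] RK by linarith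
qed (auto simp: ybar_add)

sublocale cd: comparison_data "Aij \<omega>" "ybar L \<omega>" a R for \<omega>
  by (rule cd) simp

abbreviation hh where "hh \<equiv> comparison_data.h a"
abbreviation BB where "BB \<omega> \<equiv> comparison_data.B (Aij \<omega>) (ybar L \<omega>) a"
abbreviation MM where "MM \<omega> \<equiv> comparison_data.M (Aij \<omega>) (ybar L \<omega>) a"

lemma psi_a: "i < n \<Longrightarrow> j < n \<Longrightarrow> psi (\<theta> i - \<theta> j) = a i / (a i + a j)"
proof -
  assume ij: "i < n" "j < n"
  define c where "c = real n / (\<Sum>k<n. exp (\<theta> k))"
  have c: "c > 0" using Z0 n3 by (simp add: c_def)
  have "a i / (a i + a j) = c * exp (\<theta> i) / (c * (exp (\<theta> i) + exp (\<theta> j)))"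
    using ij by (simp add: a_eq c_def algebra_simps)
  also have "\<dots> = exp (\<theta> i) / (exp (\<theta> i) + exp (\<theta> j))" using c by simp
  also have "\<dots> = psi (\<theta> i - \<theta> j)"
  proof -
    have "0 < exp (\<theta> i) + exp (\<theta> j)" by (simp add: add_pos_pos)
    moreover have "0 < 1 + exp (\<theta> i) / exp (\<theta> j)" by (simp add: add_pos_pos)
    ultimately show ?thesis by (simp add: psi_def exp_diff field_simps)
  qed
  finally show ?thesis ..
qed

lemma xi_eq: "i < n \<Longrightarrow> j < n \<Longrightarrow> comparison_data.\<xi> (ybar L \<omega>) a i j = xi L \<theta> \<omega> i j"
  by (simp add: cd.\<xi>_def xi_def psi_a)

lemma BB_eq: "i < n \<Longrightarrow> BB \<omega> {..<n} i = (\<Sum>j<n. Aij \<omega> i j * (a i + a j) * xi L \<theta> \<omega> i j)"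
  unfolding cd.B_def by (intro sum.cong refl) (simp add: xi_eq)

definition Dt :: "btl_data \<Rightarrow> nat \<Rightarrow> real" where "Dt \<omega> i = (\<Sum>j<n. Aij \<omega> i j * hh i j)"

lemma b_div_d: assumes i: "i < n" shows "b_tilde n L \<theta> \<omega> i / d_tilde n \<theta> \<omega> i = BB \<omega> {..<n} i / Dt \<omega> i"
proof -
  have n0: "real n > 0" using n3 by simp
  have st: "(\<Sum>j\<in>{0..<n}-{i}. F j) = (\<Sum>j<n. F j)" if "F i = 0" for F :: "nat \<Rightarrow> real"
    using that i by (simp add: atLeast0LessThan sum.remove[of "{..<n}" i])
  have "real n * b_tilde n L \<theta> \<omega> i = BB \<omega> {..<n} i"
    unfolding b_tilde_def BB_eq[OF i] sum_distrib_left
    by (subst st) (use i in \<open>auto intro!: sum.cong simp: a_def xi_def algebra_simps\<close>)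
  moreover have "real n * d_tilde n \<theta> \<omega> i = Dt \<omega> i"
  proof -
    have "real n * d_tilde n \<theta> \<omega> i = (\<Sum>j\<in>{0..<n}-{i}. a i * (Aij \<omega> i j * psi (\<theta> j - \<theta> i)))"
      using i by (simp add: d_tilde_def sum_distrib_left a_def mult.assoc)
    also have "\<dots> = (\<Sum>j<n. a i * (Aij \<omega> i j * psi (\<theta> j - \<theta> i)))" by (subst st) auto
    also have "\<dots> = Dt \<omega> i"
      unfolding Dt_def by (intro sum.cong refl) (simp add: cd.h_def psi_a i algebra_simps)
    finally show ?thesis .
  qed
  ultimately show ?thesis using n0 by (metis mult_divide_mult_cancel_left less_irrefl)
qed

definition xv :: "btl_data \<Rightarrow> nat \<Rightarrow> real" where
  "xv \<omega> i = ph \<omega> i / a i / ((\<Sum>j<n. ph \<omega> j / a j) / real n) - 1"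

text \<open>To be evaluated at \<open>leave_out i \<omega>\<close>, where it is the analogue of \<open>xv\<close> for the items other than \<open>i\<close>.\<close>
definition loo :: "nat \<Rightarrow> btl_data \<Rightarrow> nat \<Rightarrow> real" where
  "loo i \<omega> j = ph \<omega> j / a j / ((\<Sum>k\<in>{..<n}-{i}. ph \<omega> k / a k) / (real n - 1)) - 1"

lemma ph_nonneg: "i < n \<Longrightarrow> 0 \<le> ph \<omega> i" using stat by (simp add: stationary_prob_def)
lemma ph_sum: "(\<Sum>i<n. ph \<omega> i) = 1" using stat by (simp add: stationary_prob_def)

lemma weight_sum_pos: assumes "S \<subseteq> {..<n}" "(\<Sum>i\<in>S. ph \<omega> i) = 1" shows "0 < (\<Sum>i\<in>S. ph \<omega> i / a i)"
proof -
  have R0: "R > 0" using R1 by simp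
  have "(\<Sum>i\<in>S. ph \<omega> i / R) \<le> (\<Sum>i\<in>S. ph \<omega> i / a i)"
  proof (intro sum_mono divide_left_mono)
    fix i assume "i \<in> S"
    then show "0 \<le> ph \<omega> i" using assms(1) by (intro ph_nonneg) auto
    show "a i \<le> R" by (rule a_bounds)
    show "0 < R * a i" using R0 cd.a_pos[of i] by simp
  qed
  then have "1 / R \<le> (\<Sum>i\<in>S. ph \<omega> i / a i)" using assms(2) by (simp add: sum_divide_distrib[symmetric])
  moreover have "0 < 1 / R" using R0 by simp
  ultimately show ?thesis by linarith
qed

lemma xv_mean: "(\<Sum>i<n. xv \<omega> i) = 0"
proof -
  have W: "0 < (\<Sum>i<n. ph \<omega> i / a i)" using weight_sum_pos[of "{..<n}"] ph_sum by simp
  have "(\<Sum>i<n. xv \<omega> i) = (\<Sum>i<n. ph \<omega> i / a i) / ((\<Sum>j<n. ph \<omega> j / a j) / real n) - real n"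
    by (simp only: xv_def sum_subtractf flip: sum_divide_distrib) simp
  then show ?thesis using W by simp
qed

lemma M_xv: "i < n \<Longrightarrow> MM \<omega> {..<n} (xv \<omega>) i = BB \<omega> {..<n} i"
  unfolding xv_def by (rule cd.M_normalized) (rule stationary_balance[OF stat p0])

text \<open>The balance equation of \<open>i\<close> has outflow \<open>(n - 1) * ph i\<close> and
  no inflow. The forced losses are essential: if \<open>i\<close> were merely disconnected, a
  stationary vector could keep mass on it.\<close>

lemma ph_leave_out_zero: assumes i: "i < n" shows "ph (leave_out i \<omega>) i = 0"
proof -
  have "0 = (\<Sum>k<n. Aij (leave_out i \<omega>) i k * (ph (leave_out i \<omega>) i * ybar L (leave_out i \<omega>) k i - ph (leave_out i \<omega>) k * ybar L (leave_out i \<omega>) i k))"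
    by (rule stationary_balance[OF stat p0 i, symmetric])
  also have "\<dots> = (\<Sum>k\<in>{..<n}-{i}. ph (leave_out i \<omega>) i)"
    using i L1 by (simp add: sum.remove[of "{..<n}" i] Aij_leave_out_row ybar_leave_out_row)
  also have "\<dots> = (real n - 1) * ph (leave_out i \<omega>) i" using i n3 by (simp add: of_nat_diff)
  finally show ?thesis using n3 by auto
qed

lemma loo_mean: assumes i: "i < n" shows "(\<Sum>j\<in>{..<n}-{i}. loo i (leave_out i \<omega>) j) = 0"
proof -
  have "(\<Sum>j\<in>{..<n}-{i}. ph (leave_out i \<omega>) j) = 1"
    using ph_sum[of "leave_out i \<omega>"] ph_leave_out_zero[OF i] i by (simp add: sum.remove[of "{..<n}" i])
  then have W: "0 < (\<Sum>j\<in>{..<n}-{i}. ph (leave_out i \<omega>) j / a j)" by (intro weight_sum_pos) auto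
  have "(\<Sum>j\<in>{..<n}-{i}. loo i (leave_out i \<omega>) j) = (\<Sum>j\<in>{..<n}-{i}. ph (leave_out i \<omega>) j / a j) / ((\<Sum>k\<in>{..<n}-{i}. ph (leave_out i \<omega>) k / a k) / (real n - 1)) - (real n - 1)"
    using i n3 by (simp only: loo_def sum_subtractf flip: sum_divide_distrib) (simp add: of_nat_diff)
  then show ?thesis using W n3 by simp
qed

lemma M_loo: assumes i: "i < n" and j: "j < n" "j \<noteq> i"
  shows "MM \<omega> ({..<n}-{i}) (loo i (leave_out i \<omega>)) j = BB \<omega> ({..<n}-{i}) j"
  unfolding loo_def
proof (rule cd.M_normalized)
  let ?f = "ph (leave_out i \<omega>)"
  have "0 = (\<Sum>k<n. Aij (leave_out i \<omega>) j k * (?f j * ybar L (leave_out i \<omega>) k j - ?f k * ybar L (leave_out i \<omega>) j k))"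
    by (rule stationary_balance[OF stat p0 j(1), symmetric])
  also have "\<dots> = (\<Sum>k\<in>{..<n}-{i}. Aij (leave_out i \<omega>) j k * (?f j * ybar L (leave_out i \<omega>) k j - ?f k * ybar L (leave_out i \<omega>) j k))"
    using i j L1 ph_leave_out_zero[OF i] by (simp add: sum.remove[of "{..<n}" i] ybar_leave_out_row)
  also have "\<dots> = (\<Sum>k\<in>{..<n}-{i}. Aij \<omega> j k * (?f j * ybar L \<omega> k j - ?f k * ybar L \<omega> j k))"
    using j by (intro sum.cong refl) (simp add: Aij_leave_out ybar_leave_out)
  finally show "(\<Sum>k\<in>{..<n}-{i}. Aij \<omega> j k * (?f j * ybar L \<omega> k j - ?f k * ybar L \<omega> j k)) = 0" ..
qed

text \<open>The scale \<open>W\<close> and the normalising sum of \<open>pi_star\<close> are common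
  to all items and disappear under centring of the logarithms, while the centred \<theta> is
  unchanged.\<close>

lemma spectral_eq:
  assumes pos: "\<And>k. k < n \<Longrightarrow> 0 < 1 + xv \<omega> k" and i: "i < n"
  shows "spectral_theta n (ph \<omega>) i - \<theta> i = ln (1 + xv \<omega> i) - (\<Sum>k<n. ln (1 + xv \<omega> k)) / real n"
proof -
  define W where "W = (\<Sum>j<n. ph \<omega> j / a j) / real n"
  have W: "0 < W" using weight_sum_pos[of "{..<n}"] ph_sum n3 by (simp add: W_def)
  define c where "c = ln W + ln (real n / (\<Sum>k<n. exp (\<theta> k)))"
  have eq: "ln (ph \<omega> k) = c + \<theta> k + ln (1 + xv \<omega> k)" if k: "k < n" for k
  proof -
    have cz: "0 < real n / (\<Sum>k<n. exp (\<theta> k))" using Z0 n3 by simp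
    have "ph \<omega> k = W * (a k * (1 + xv \<omega> k))"
      using W cd.a_pos[of k] by (simp add: xv_def W_def[symmetric] field_simps)
    also have "\<dots> = W * (real n / (\<Sum>k<n. exp (\<theta> k)) * exp (\<theta> k) * (1 + xv \<omega> k))" by (simp add: a_eq[OF k])
    finally have "ln (ph \<omega> k) = ln (W * (real n / (\<Sum>k<n. exp (\<theta> k)) * exp (\<theta> k) * (1 + xv \<omega> k)))" by simp
    also have "\<dots> = ln W + (ln (real n / (\<Sum>k<n. exp (\<theta> k))) + \<theta> k + ln (1 + xv \<omega> k))"
      using W cz pos[OF k] by (simp only: ln_mult_pos mult_pos_pos exp_gt_zero ln_exp)
    finally show ?thesis by (simp add: c_def)
  qed
  have "(\<Sum>k<n. ln (ph \<omega> k)) = (\<Sum>k<n. c + \<theta> k + ln (1 + xv \<omega> k))" by (intro sum.cong refl) (simp add: eq)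
  also have "\<dots> = real n * c + (\<Sum>k<n. ln (1 + xv \<omega> k))" using theta_sum by (simp add: sum.distrib)
  finally show ?thesis using n3 by (simp add: spectral_theta_def eq[OF i] add_divide_distrib)
qed

section \<open>Scales of the problem and exceptional events\<close>

definition m :: real where "m = real n * p"
definition lam :: real where "lam = sqrt (ln (real n))"
definition \<nu> :: real where "\<nu> = 1 / sqrt m"
definition r :: real where "r = 1 / sqrt (m * real L)"
definition \<sigma> :: real where "\<sigma> = sqrt (lam ^ 3) * \<nu>"
text \<open>Dominates the constants of all estimates on the good event; the most demanding is
  \<open>320 * R ^ 4\<close> from \<open>weighted_B_le\<close>, and the spectral gap needs at least
  128.\<close>

definition K :: real where "K = 400 * R ^ 4"

definition row_noise_bad :: "real \<Rightarrow> nat \<Rightarrow> (btl_data \<Rightarrow> nat \<Rightarrow> real) \<Rightarrow> btl_data set" where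
  "row_noise_bad u i C = {\<omega>. u * sqrt (\<Sum>j\<in>{..<n}-{i}. Aij \<omega> i j * (C (leave_out i \<omega>) j)\<^sup>2 / real L)
        < \<bar>\<Sum>j\<in>{..<n}-{i}. Aij \<omega> i j * C (leave_out i \<omega>) j * xi L \<theta> \<omega> i j\<bar>}"

definition row_graph_bad :: "real \<Rightarrow> nat \<Rightarrow> (btl_data \<Rightarrow> nat \<Rightarrow> real) \<Rightarrow> (btl_data \<Rightarrow> real) \<Rightarrow> btl_data set" where
  "row_graph_bad u i C b = {\<omega>. 2 * u * sqrt (\<Sum>j\<in>{..<n}-{i}. p * (C (leave_out i \<omega>) j)\<^sup>2) + 2 * u\<^sup>2 * b (leave_out i \<omega>)
        < \<bar>\<Sum>j\<in>{..<n}-{i}. C (leave_out i \<omega>) j * (Aij \<omega> i j - p)\<bar>}"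

definition linear_noise_bad :: "real \<Rightarrow> (((nat \<times> nat) \<Rightarrow> bool) \<Rightarrow> nat \<Rightarrow> real) \<Rightarrow> btl_data set" where
  "linear_noise_bad u g = {\<omega>. u * sqrt (\<Sum>(i, j)\<in>Pairs n. Aij \<omega> i j * ((a i + a j) * (g (fst \<omega>) i - g (fst \<omega>) j))\<^sup>2 / real L)
        < \<bar>\<Sum>i<n. g (fst \<omega>) i * (\<Sum>j<n. Aij \<omega> i j * (a i + a j) * xi L \<theta> \<omega> i j)\<bar>}"

definition cut_bad :: "nat set \<Rightarrow> btl_data set" where
  "cut_bad S = {\<omega>. (\<Sum>i\<in>S. \<Sum>j\<in>{..<n}-S. Aij \<omega> i j) < p * real (card S) * real (n - card S) / 2}"

definition Hs :: "nat \<Rightarrow> real" where "Hs i = (\<Sum>j\<in>{..<n}-{i}. hh i j)"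
definition XX :: "nat \<Rightarrow> btl_data \<Rightarrow> real" where "XX i \<omega> = Max ((\<lambda>j. \<bar>loo i \<omega> j\<bar>) ` ({..<n}-{i}))"

text \<open>Weights may depend on the graph but not on the outcomes. As \<open>Dt\<close> only reads
  the graph, a dummy outcome is supplied.\<close>

definition g_loc :: "nat \<Rightarrow> ((nat \<times> nat) \<Rightarrow> bool) \<Rightarrow> nat \<Rightarrow> real" where
  "g_loc i A j = (if j = i then 0 else hh i j / Hs i / Dt (A, \<lambda>_. False) j)"
definition g_avg :: "((nat \<times> nat) \<Rightarrow> bool) \<Rightarrow> nat \<Rightarrow> real" where
  "g_avg A j = 1 / (real n * Dt (A, \<lambda>_. False) j)"
text \<open>A union bound over all sign patterns controls \<open>\<Sum>i. \<bar>B i\<bar>\<close> without a logarithmic loss.\<close>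
definition g_sign :: "nat set \<Rightarrow> ((nat \<times> nat) \<Rightarrow> bool) \<Rightarrow> nat \<Rightarrow> real" where
  "g_sign T A j = (if j \<in> T then 1 else - 1)"

text \<open>The levels \<open>u1\<close> and \<open>u2\<close> give tails of order
  \<open>n^(-12)\<close>: there are \<open>n\<close> rows and about \<open>n\<close> events per row,
  which leaves \<open>n^(-10)\<close>. The level \<open>u3\<close> gives
  \<open>exp (- 14 * n)\<close>, which outweighs the \<open>2 ^ n\<close> sign patterns.\<close>

definition u1 :: real where "u1 = sqrt 6 * lam"
definition u2 :: real where "u2 = sqrt 12 * lam"
definition u3 :: real where "u3 = sqrt (7 * real n)"

definition bad_row :: "nat \<Rightarrow> btl_data set" where
  "bad_row i = row_graph_bad u2 i (\<lambda>_ _. 1) (\<lambda>_. 1) \<union> row_graph_bad u2 i (\<lambda>_. hh i) (\<lambda>_. R)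
     \<union> row_graph_bad u2 i (\<lambda>\<omega> j. hh i j * loo i \<omega> j) (\<lambda>\<omega>. R * XX i \<omega>)
     \<union> row_graph_bad u2 i (\<lambda>\<omega> j. (loo i \<omega> j)\<^sup>2) (\<lambda>\<omega>. (XX i \<omega>)\<^sup>2)
     \<union> row_noise_bad u1 i (\<lambda>_ j. a i + a j) \<union> row_noise_bad u1 i (\<lambda>_ _. 1)
     \<union> row_noise_bad u1 i (\<lambda>\<omega> j. a j * loo i \<omega> j) \<union> linear_noise_bad u1 (g_loc i)
     \<union> (\<Union>k<n. row_noise_bad u1 i (\<lambda>_ j. of_bool (j = k)))"

definition bad :: "btl_data set" where
  "bad = (\<Union>i<n. bad_row i) \<union> linear_noise_bad u1 g_avg \<union> (\<Union>T\<in>Pow {..<n}. linear_noise_bad u3 (g_sign T))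
     \<union> (\<Union>S\<in>{S. S \<subseteq> {..<n} \<and> S \<noteq> {} \<and> 2 * card S \<le> n}. cut_bad S)"

lemma R0: "0 < R" using R1 by simp
lemma n0: "0 < real n" using n3 by simp
lemma m0: "0 < m" using n3 p0 by (simp add: m_def)
lemma nu0: "0 < \<nu>" using m0 by (simp add: \<nu>_def)
lemma L0: "0 < real L" using L1 by simp
lemma r0: "0 < r" using m0 L0 by (simp add: r_def)
lemma m_le_n: "m \<le> real n" using p1 n0 by (simp add: m_def mult_left_le)

lemma lam_sq: "lam\<^sup>2 = ln (real n)" using n3 by (simp add: lam_def)

lemma lam1: "1 \<le> lam"
proof -
  have "exp 1 \<le> real n" using exp_le n3 by linarith
  then have "1 \<le> ln (real n)" using n0 by (simp add: ln_ge_iff)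
  then show ?thesis by (simp add: lam_def)
qed

lemma m_nu: "m * \<nu>\<^sup>2 = 1" using m0 by (simp add: \<nu>_def power_divide)
lemma sqrt_m: "sqrt m = m * \<nu>" using m0 by (simp add: \<nu>_def real_div_sqrt)
lemma lam_sqrt_m: "lam * sqrt m = m * (lam * \<nu>)" by (simp add: sqrt_m)
lemma lam_sq_m: "lam\<^sup>2 = m * (lam * \<nu>)\<^sup>2" using m_nu by (simp add: power_mult_distrib mult.left_commute)
lemma sig_sq: "\<sigma>\<^sup>2 = lam ^ 3 * \<nu>\<^sup>2" using lam1 by (simp add: \<sigma>_def power_mult_distrib)
lemma sig0: "0 \<le> \<sigma>" using nu0 lam1 by (simp add: \<sigma>_def)

lemma tau_le_sig: "lam * \<nu> \<le> \<sigma>"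
proof (rule power2_le_imp_le[OF _ sig0])
  have "lam\<^sup>2 \<le> lam ^ 3" using lam1 by (intro power_increasing) auto
  then show "(lam * \<nu>)\<^sup>2 \<le> \<sigma>\<^sup>2" unfolding sig_sq power_mult_distrib by (intro mult_right_mono) auto
qed

lemma sqrt_m_L: "sqrt (m / real L) = m * r"
proof -
  have "m * r = m / sqrt m / sqrt (real L)" by (simp add: r_def real_sqrt_mult)
  also have "m / sqrt m = sqrt m" using m0 by (simp add: real_div_sqrt)
  finally show ?thesis by (simp add: real_sqrt_divide)
qed

lemma r_le_nu: "r \<le> \<nu>"
proof -
  have "m * 1 \<le> m * real L" using L1 m0 by (intro mult_left_mono) auto
  then show ?thesis unfolding r_def \<nu>_def using m0 L0 by (intro divide_left_mono mult_pos_pos real_sqrt_le_mono) auto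
qed

lemma R4: "1 \<le> R ^ 4" "R \<le> R ^ 4" using R1 power_increasing[of 1 4 R] by auto
lemma R_le_K: "R \<le> K" using R4 by (simp add: K_def)
lemma K0: "0 < K" using R0 R_le_K by linarith

lemma sqrt_bounds: "sqrt 6 \<le> (5/2 :: real)" "sqrt 12 \<le> (7/2 :: real)" "sqrt 7 \<le> (11/4 :: real)"
  by (rule real_le_lsqrt; simp add: power2_eq_square)+

lemma u0: "0 \<le> u1" "0 \<le> u2" "0 \<le> u3" using lam1 by (auto simp: u1_def u2_def u3_def)

lemma Dt_fst: "Dt (fst \<omega>, \<lambda>_. False) = Dt \<omega>"
proof -
  have "Aij (fst \<omega>, \<lambda>_. False) i j = Aij \<omega> i j" for i j by (simp add: Aij_def)
  then show ?thesis by (simp add: Dt_def fun_eq_iff)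
qed

lemma row_graph_good:
  assumes "\<omega> \<notin> row_graph_bad u2 i C b" and S: "(\<Sum>j\<in>{..<n}-{i}. (C (leave_out i \<omega>) j)\<^sup>2) \<le> S\<^sup>2" "0 \<le> S"
  shows "\<bar>\<Sum>j\<in>{..<n}-{i}. C (leave_out i \<omega>) j * (Aij \<omega> i j - p)\<bar> \<le> 7 * lam * (sqrt p * S) + 24 * lam\<^sup>2 * b (leave_out i \<omega>)"
proof -
  have "sqrt (\<Sum>j\<in>{..<n}-{i}. p * (C (leave_out i \<omega>) j)\<^sup>2) = sqrt p * sqrt (\<Sum>j\<in>{..<n}-{i}. (C (leave_out i \<omega>) j)\<^sup>2)"
    by (simp add: real_sqrt_mult flip: sum_distrib_left)
  also have "\<dots> \<le> sqrt p * S"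
  proof (rule mult_left_mono)
    show "sqrt (\<Sum>j\<in>{..<n}-{i}. (C (leave_out i \<omega>) j)\<^sup>2) \<le> S" using S by (simp add: real_le_lsqrt)
  qed (use p0 in simp)
  finally have "2 * u2 * sqrt (\<Sum>j\<in>{..<n}-{i}. p * (C (leave_out i \<omega>) j)\<^sup>2) \<le> 2 * u2 * (sqrt p * S)"
    using u0 by (intro mult_left_mono) auto
  also have "\<dots> \<le> 7 * lam * (sqrt p * S)"
  proof (rule mult_right_mono)
    have "sqrt 12 * lam \<le> 7/2 * lam" using sqrt_bounds lam1 by (intro mult_right_mono) auto
    then show "2 * u2 \<le> 7 * lam" by (simp add: u2_def)
  qed (use p0 S in simp)
  finally have "2 * u2 * sqrt (\<Sum>j\<in>{..<n}-{i}. p * (C (leave_out i \<omega>) j)\<^sup>2) \<le> 7 * lam * (sqrt p * S)" .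
  moreover have "2 * u2\<^sup>2 = 24 * lam\<^sup>2" by (simp add: u2_def power_mult_distrib)
  ultimately show ?thesis using assms(1) unfolding row_graph_bad_def by simp
qed

lemma row_noise_good:
  assumes "\<omega> \<notin> row_noise_bad u1 i C" and W: "(\<Sum>j\<in>{..<n}-{i}. Aij \<omega> i j * (C (leave_out i \<omega>) j)\<^sup>2) \<le> W\<^sup>2" "0 \<le> W"
  shows "\<bar>\<Sum>j\<in>{..<n}-{i}. Aij \<omega> i j * C (leave_out i \<omega>) j * xi L \<theta> \<omega> i j\<bar> \<le> 5/2 * lam * (W / sqrt (real L))"
proof -
  have "sqrt (\<Sum>j\<in>{..<n}-{i}. Aij \<omega> i j * (C (leave_out i \<omega>) j)\<^sup>2 / real L) \<le> sqrt (W\<^sup>2 / real L)"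
    unfolding sum_divide_distrib[symmetric] using W L0 by (intro real_sqrt_le_mono divide_right_mono) auto
  also have "\<dots> = W / sqrt (real L)" using W by (simp add: real_sqrt_divide)
  finally have "u1 * sqrt (\<Sum>j\<in>{..<n}-{i}. Aij \<omega> i j * (C (leave_out i \<omega>) j)\<^sup>2 / real L) \<le> u1 * (W / sqrt (real L))"
    using u0 by (intro mult_left_mono) auto
  also have "\<dots> \<le> 5/2 * lam * (W / sqrt (real L))"
    unfolding u1_def using sqrt_bounds lam1 W L0 by (intro mult_right_mono) auto
  finally show ?thesis using assms(1) unfolding row_noise_bad_def by simp
qed

lemma linear_noise_good:
  assumes nb: "\<omega> \<notin> linear_noise_bad u g" and u: "0 \<le> u" and g: "\<And>j. j < n \<Longrightarrow> \<bar>g (fst \<omega>) j\<bar> \<le> \<gamma>"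
    and deg: "\<And>i. i < n \<Longrightarrow> (\<Sum>j<n. Aij \<omega> i j) \<le> 2 * m"
  shows "\<bar>\<Sum>i<n. g (fst \<omega>) i * BB \<omega> {..<n} i\<bar> \<le> u * (4 * R * \<gamma> * (sqrt (real n) * (m * r)))"
proof -
  define h where "h = g (fst \<omega>)"
  have gam0: "0 \<le> \<gamma>" using g[of 0] n3 by force
  have "(\<Sum>(i, j)\<in>Pairs n. Aij \<omega> i j * ((a i + a j) * (h i - h j))\<^sup>2 / real L)
     \<le> (\<Sum>(i, j)\<in>Pairs n. Aij \<omega> i j * ((2 * R) * (2 * \<gamma>))\<^sup>2 / real L)"
  proof (rule sum_mono, clarify)
    fix i j assume "(i, j) \<in> Pairs n"
    then have ij: "i < n" "j < n" by (auto simp: Pairs_def)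
    have "\<bar>a i + a j\<bar> \<le> 2 * R" using a_bounds(2)[of i] a_bounds(2)[of j] cd.a_pos[of i] cd.a_pos[of j] by linarith
    moreover have "\<bar>h i - h j\<bar> \<le> 2 * \<gamma>" using g[OF ij(1)] g[OF ij(2)] by (simp add: h_def)
    ultimately have "\<bar>(a i + a j) * (h i - h j)\<bar> \<le> (2 * R) * (2 * \<gamma>)"
      unfolding abs_mult using R0 by (intro mult_mono) auto
    then have "((a i + a j) * (h i - h j))\<^sup>2 \<le> ((2 * R) * (2 * \<gamma>))\<^sup>2" using power_mono[of "\<bar>(a i + a j) * (h i - h j)\<bar>" "(2 * R) * (2 * \<gamma>)" 2] by (simp only: power2_abs)
    then show "Aij \<omega> i j * ((a i + a j) * (h i - h j))\<^sup>2 / real L \<le> Aij \<omega> i j * ((2 * R) * (2 * \<gamma>))\<^sup>2 / real L"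
      using cd.A_nonneg L0 by (intro divide_right_mono mult_left_mono) auto
  qed
  also have "\<dots> = (\<Sum>(i, j)\<in>Pairs n. Aij \<omega> i j) * ((2 * R) * (2 * \<gamma>))\<^sup>2 / real L"
    by (simp add: sum_distrib_right sum_divide_distrib case_prod_unfold)
  also have "\<dots> \<le> (real n * m) * ((2 * R) * (2 * \<gamma>))\<^sup>2 / real L"
  proof -
    have "(\<Sum>i<n. \<Sum>j<n. Aij \<omega> i j) = (\<Sum>(i, j)\<in>Pairs n. Aij \<omega> i j + Aij \<omega> j i)"
      by (rule sum_symmetrize_Pairs) simp
    also have "\<dots> = 2 * (\<Sum>(i, j)\<in>Pairs n. Aij \<omega> i j)"
      by (simp add: sum_distrib_left case_prod_unfold Aij_sym[of \<omega> "snd _"])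
    finally have "2 * (\<Sum>(i, j)\<in>Pairs n. Aij \<omega> i j) = (\<Sum>i<n. \<Sum>j<n. Aij \<omega> i j)" by simp
    also have "\<dots> \<le> (\<Sum>i<n. 2 * m)" using deg by (intro sum_mono) auto
    finally have "(\<Sum>(i, j)\<in>Pairs n. Aij \<omega> i j) \<le> real n * m" by simp
    then show ?thesis using L0 by (intro divide_right_mono mult_right_mono) auto
  qed
  finally have le: "(\<Sum>(i, j)\<in>Pairs n. Aij \<omega> i j * ((a i + a j) * (h i - h j))\<^sup>2 / real L) \<le> (real n * m) * ((2 * R) * (2 * \<gamma>))\<^sup>2 / real L" .
  have "sqrt (\<Sum>(i, j)\<in>Pairs n. Aij \<omega> i j * ((a i + a j) * (h i - h j))\<^sup>2 / real L) \<le> sqrt ((real n * m) * ((2 * R) * (2 * \<gamma>))\<^sup>2 / real L)"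
    using le by (rule real_sqrt_le_mono)
  also have "\<dots> = sqrt (real n * (m / real L) * ((2 * R) * (2 * \<gamma>))\<^sup>2)" by simp
  also have "\<dots> = 4 * R * \<gamma> * (sqrt (real n) * (m * r))"
    using R0 gam0 by (simp only: real_sqrt_mult sqrt_m_L real_sqrt_abs) (simp add: abs_mult)
  finally have "u * sqrt (\<Sum>(i, j)\<in>Pairs n. Aij \<omega> i j * ((a i + a j) * (h i - h j))\<^sup>2 / real L) \<le> u * (4 * R * \<gamma> * (sqrt (real n) * (m * r)))"
    using u by (intro mult_left_mono) auto
  moreover have "\<bar>\<Sum>i<n. h i * (\<Sum>j<n. Aij \<omega> i j * (a i + a j) * xi L \<theta> \<omega> i j)\<bar> \<le>
     u * sqrt (\<Sum>(i, j)\<in>Pairs n. Aij \<omega> i j * ((a i + a j) * (h i - h j))\<^sup>2 / real L)"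
    using nb unfolding linear_noise_bad_def h_def by simp
  moreover have "(\<Sum>i<n. h i * BB \<omega> {..<n} i) = (\<Sum>i<n. h i * (\<Sum>j<n. Aij \<omega> i j * (a i + a j) * xi L \<theta> \<omega> i j))"
    by (intro sum.cong refl) (simp add: BB_eq)
  ultimately show ?thesis unfolding h_def by linarith
qed

end

section \<open>Consequences of the good event\<close>

locale btl_good = btl_model +
  fixes \<omega>
  assumes good: "\<omega> \<notin> bad" and small: "1000 * K ^ 6 * \<sigma> \<le> 1"
begin

abbreviation \<tau> where "\<tau> \<equiv> lam * \<nu>"

lemma tau0: "0 < \<tau>" using lam1 nu0 by simp

lemma K_ge1: "1 \<le> K" using R4 by (simp add: K_def)

lemma tau_K: assumes "k \<le> 6" shows "1000 * (K ^ k * \<tau>) \<le> 1"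
proof -
  have "K ^ k * \<tau> \<le> K ^ 6 * \<sigma>"
    using K_ge1 assms tau_le_sig tau0 by (intro mult_mono power_increasing) auto
  then show ?thesis using small by linarith
qed

lemma tau_small: "1000 * \<tau> \<le> 1" using tau_K[of 0] by simp

lemma tau_sq_le: "24 * \<tau>\<^sup>2 \<le> \<tau>"
proof -
  have "24 * \<tau> * \<tau> \<le> 1 * \<tau>" using tau_small tau0 by (intro mult_right_mono) auto
  then show ?thesis by (simp add: power2_eq_square)
qed

lemma good_row: "i < n \<Longrightarrow> \<omega> \<notin> bad_row i" using good by (auto simp: bad_def)

lemma card_minus: "i < n \<Longrightarrow> real (card ({..<n}-{i})) = real n - 1" using n3 by (simp add: of_nat_diff)

lemma row_full: "i < n \<Longrightarrow> F i = 0 \<Longrightarrow> (\<Sum>j\<in>{..<n}-{i}. F j) = (\<Sum>j<n. F j)" for F :: "nat \<Rightarrow> real"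
  by (simp add: sum.remove[of "{..<n}" i])

lemma sqrt_pn: "sqrt p * sqrt (real n) = sqrt m" by (simp add: m_def real_sqrt_mult mult.commute)

lemma dev_le: "7 * lam * (sqrt p * (c * sqrt (real n))) + 24 * lam\<^sup>2 * c \<le> 8 * c * (\<tau> * m)" if "0 \<le> c" for c
proof -
  have "7 * lam * (sqrt p * (c * sqrt (real n))) = 7 * c * (lam * (sqrt p * sqrt (real n)))" by simp
  also have "\<dots> = 7 * c * (m * \<tau>)" unfolding sqrt_pn lam_sqrt_m ..
  finally have "7 * lam * (sqrt p * (c * sqrt (real n))) + 24 * lam\<^sup>2 * c = 7 * c * (m * \<tau>) + c * m * (24 * \<tau>\<^sup>2)"
    by (simp add: lam_sq_m)
  also have "\<dots> \<le> 7 * c * (m * \<tau>) + c * m * \<tau>" using tau_sq_le that m0 by (intro add_left_mono mult_left_mono) auto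
  finally show ?thesis by (simp add: algebra_simps)
qed

lemma degree_le: assumes i: "i < n" shows "(\<Sum>j<n. Aij \<omega> i j) \<le> 2 * m"
proof -
  have nb: "\<omega> \<notin> row_graph_bad u2 i (\<lambda>_ _. 1) (\<lambda>_. 1)" using good_row[OF i] by (auto simp: bad_row_def)
  have "\<bar>\<Sum>j\<in>{..<n}-{i}. 1 * (Aij \<omega> i j - p)\<bar> \<le> 7 * lam * (sqrt p * (1 * sqrt (real n))) + 24 * lam\<^sup>2 * 1"
    using row_graph_good[OF nb, of "1 * sqrt (real n)"] i n3 by (simp add: of_nat_diff)
  also have "\<dots> \<le> 8 * 1 * (\<tau> * m)" by (rule dev_le) simp
  also have "\<dots> \<le> m" using tau_small m0 mult_right_mono[of "8 * \<tau>" 1 m] tau0 by simp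
  finally have "(\<Sum>j\<in>{..<n}-{i}. Aij \<omega> i j) \<le> (real n - 1) * p + m"
    using card_minus[OF i] by (simp add: sum_subtractf)
  also have "(\<Sum>j\<in>{..<n}-{i}. Aij \<omega> i j) = (\<Sum>j<n. Aij \<omega> i j)" by (rule row_full[OF i]) simp
  finally show ?thesis using p0 by (simp add: m_def algebra_simps)
qed

lemma h_abs: "\<bar>hh i j\<bar> \<le> R" using cd.h_pos[of i j] cd.h_upper[of i j] by simp

lemma D_dev: assumes i: "i < n" shows "\<bar>Dt \<omega> i - p * Hs i\<bar> \<le> 8 * R * (\<tau> * m)"
proof -
  have nb: "\<omega> \<notin> row_graph_bad u2 i (\<lambda>_. hh i) (\<lambda>_. R)" using good_row[OF i] by (auto simp: bad_row_def)
  have "(\<Sum>j\<in>{..<n}-{i}. (hh i j)\<^sup>2) \<le> (\<Sum>j\<in>{..<n}-{i}. R\<^sup>2)"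
    using h_abs R0 by (intro sum_mono) (simp add: abs_le_square_iff[symmetric])
  also have "\<dots> \<le> (R * sqrt (real n))\<^sup>2"
    using card_minus[OF i] mult_right_mono[of "real n - 1" "real n" "R\<^sup>2"] by (simp add: power_mult_distrib mult.commute)
  finally have S: "(\<Sum>j\<in>{..<n}-{i}. (hh i j)\<^sup>2) \<le> (R * sqrt (real n))\<^sup>2" .
  have "Dt \<omega> i - p * Hs i = (\<Sum>j\<in>{..<n}-{i}. hh i j * (Aij \<omega> i j - p))"
    unfolding Dt_def Hs_def using row_full[OF i, of "\<lambda>j. Aij \<omega> i j * hh i j"]
    by (simp add: sum_subtractf sum_distrib_left algebra_simps)
  then have "\<bar>Dt \<omega> i - p * Hs i\<bar> \<le> 7 * lam * (sqrt p * (R * sqrt (real n))) + 24 * lam\<^sup>2 * R"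
    using row_graph_good[OF nb S] R0 by simp
  also have "\<dots> \<le> 8 * R * (\<tau> * m)" using R0 by (intro dev_le) simp
  finally show ?thesis .
qed

lemma Hs_lower: assumes i: "i < n" shows "real n / (4 * R) \<le> Hs i"
proof -
  have "(\<Sum>j\<in>{..<n}-{i}. 1 / (2 * R)) \<le> Hs i" unfolding Hs_def by (intro sum_mono cd.h_lower)
  moreover have "(\<Sum>j\<in>{..<n}-{i}. 1 / (2 * R)) = (real n - 1) / (2 * R)" using card_minus[OF i] by simp
  moreover have "real n / (4 * R) \<le> (real n - 1) / (2 * R)" using n3 R0 by (simp add: field_simps)
  ultimately show ?thesis by linarith
qed

lemma D_lower: assumes i: "i < n" shows "m / (8 * R) \<le> Dt \<omega> i"
proof -
  have "p * (real n / (4 * R)) \<le> p * Hs i" using Hs_lower[OF i] p0 by (intro mult_left_mono) auto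
  then have 1: "m / (4 * R) \<le> p * Hs i" by (simp add: m_def algebra_simps)
  have "8 * R * \<tau> \<le> 1 / (8 * R)"
  proof -
    have "64 * R\<^sup>2 \<le> 1000 * K"
    proof -
      have "R\<^sup>2 \<le> R ^ 4" using R1 by (intro power_increasing) auto
      then show ?thesis unfolding K_def using R4(1) by linarith
    qed
    then have "64 * R\<^sup>2 * \<tau> \<le> 1000 * K * \<tau>" using tau0 by (intro mult_right_mono) auto
    moreover have "1000 * K * \<tau> \<le> 1" using tau_K[of 1] by (simp add: mult.assoc)
    ultimately have "64 * R\<^sup>2 * \<tau> \<le> 1" by linarith
    then show ?thesis using R0 by (simp add: field_simps power2_eq_square)
  qed
  then have "8 * R * \<tau> * m \<le> 1 / (8 * R) * m" using m0 by (intro mult_right_mono) auto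
  then have "8 * R * (\<tau> * m) \<le> m / (8 * R)" by (simp add: mult.assoc)
  moreover have "m / (4 * R) = m / (8 * R) + m / (8 * R)" using R0 by (simp add: field_simps)
  ultimately show ?thesis using D_dev[OF i] 1 by linarith
qed

lemma D_pos: "i < n \<Longrightarrow> 0 < Dt \<omega> i"
  using D_lower[of i] m0 R0 by (auto intro: less_le_trans[rotated])

lemma Hs_pos: "i < n \<Longrightarrow> 0 < Hs i"
  using Hs_lower[of i] n0 R0 by (auto intro: less_le_trans[rotated])

lemma cut_good:
  assumes S: "S \<subseteq> {..<n}" "2 * card S \<le> n"
  shows "m / 4 * real (card S) \<le> (\<Sum>i\<in>S. \<Sum>j\<in>{..<n}-S. Aij \<omega> i j)"
proof (cases "S = {}")
  case False
  then have "\<omega> \<notin> cut_bad S" using good S by (auto simp: bad_def)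
  then have 1: "p * real (card S) * real (n - card S) / 2 \<le> (\<Sum>i\<in>S. \<Sum>j\<in>{..<n}-S. Aij \<omega> i j)" by (simp add: cut_bad_def)
  have "real n / 2 \<le> real (n - card S)" using S(2) by linarith
  then have "p * real (card S) * (real n / 2) \<le> p * real (card S) * real (n - card S)" using p0 by (intro mult_left_mono) auto
  then show ?thesis using 1 by (simp add: m_def algebra_simps)
qed simp

lemma m_ge: "1000 \<le> m"
proof -
  have "\<nu> \<le> \<tau>" using lam1 nu0 by simp
  then have "\<nu> \<le> 1/1000" using tau_small by linarith
  then have "\<nu>\<^sup>2 \<le> (1/1000)\<^sup>2" using nu0 by (intro power_mono) auto
  then have "m * \<nu>\<^sup>2 \<le> m * (1/1000)\<^sup>2" using m0 by (intro mult_left_mono) auto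
  then have "1 \<le> m * (1/1000)\<^sup>2" unfolding m_nu .
  then show ?thesis by (simp add: power2_eq_square)
qed

text \<open>Cheeger with cut constant \<open>m / 8\<close> and degrees up to \<open>2 * m\<close>
  gives the gap \<open>m / 128\<close>. The cut constant is half of what \<open>cut_good\<close>
  provides, so that the deletion of one item is covered too.\<close>

lemma gap_from_cut:
  assumes V: "V \<subseteq> {..<n}" and iso: "\<And>S. S \<subseteq> V \<Longrightarrow> 2 * card S \<le> card V \<Longrightarrow> m / 8 * real (card S) \<le> (\<Sum>i\<in>S. \<Sum>j\<in>V-S. Aij \<omega> i j)"
    and z: "(\<Sum>i\<in>V. z i) = 0"
  shows "m / K * (\<Sum>i\<in>V. (z i)\<^sup>2) \<le> (\<Sum>i\<in>V. \<Sum>j\<in>V. Aij \<omega> i j * (z i - z j)\<^sup>2)"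
proof -
  have "(m / 8)\<^sup>2 * (\<Sum>i\<in>V. (z i)\<^sup>2) \<le> (2 * m) * (\<Sum>i\<in>V. \<Sum>j\<in>V. Aij \<omega> i j * (z i - z j)\<^sup>2)"
  proof (rule cheeger_spectral_gap[OF _ Aij_sym cd.A_nonneg iso _ _ _ z])
    fix i assume i: "i \<in> V"
    have "(\<Sum>j\<in>V. Aij \<omega> i j) \<le> (\<Sum>j<n. Aij \<omega> i j)" using V cd.A_nonneg by (intro sum_mono2) auto
    then show "(\<Sum>j\<in>V. Aij \<omega> i j) \<le> 2 * m" using degree_le[of i] i V by auto
  qed (use V m0 in \<open>auto intro: finite_subset\<close>)
  then have "m * (m / 128 * (\<Sum>i\<in>V. (z i)\<^sup>2)) \<le> m * (\<Sum>i\<in>V. \<Sum>j\<in>V. Aij \<omega> i j * (z i - z j)\<^sup>2)"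
    by (simp add: power2_eq_square)
  then have "m / 128 * (\<Sum>i\<in>V. (z i)\<^sup>2) \<le> (\<Sum>i\<in>V. \<Sum>j\<in>V. Aij \<omega> i j * (z i - z j)\<^sup>2)"
    using m0 by (simp only: mult_le_cancel_left_pos)
  moreover have "m / K * (\<Sum>i\<in>V. (z i)\<^sup>2) \<le> m / 128 * (\<Sum>i\<in>V. (z i)\<^sup>2)"
    using R4 m0 K0 by (intro mult_right_mono divide_left_mono) (auto simp: K_def sum_nonneg)
  ultimately show ?thesis by linarith
qed

lemma gap_full: "(\<Sum>i<n. z i) = 0 \<Longrightarrow> m / K * (\<Sum>i<n. (z i)\<^sup>2) \<le> (\<Sum>i<n. \<Sum>j<n. Aij \<omega> i j * (z i - z j)\<^sup>2)"
proof (rule gap_from_cut)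
  fix S assume "S \<subseteq> {..<n}" "2 * card S \<le> card {..<n}"
  then have "m / 4 * real (card S) \<le> (\<Sum>i\<in>S. \<Sum>j\<in>{..<n}-S. Aij \<omega> i j)" by (intro cut_good) auto
  moreover have "m / 8 * real (card S) \<le> m / 4 * real (card S)" using m0 by (intro mult_right_mono) auto
  ultimately show "m / 8 * real (card S) \<le> (\<Sum>i\<in>S. \<Sum>j\<in>{..<n}-S. Aij \<omega> i j)" by linarith
qed auto

text \<open>Deleting \<open>k\<close> costs every vertex of \<open>S\<close> at most one edge, that
  is at most \<open>card S\<close> in total, and this is below \<open>m / 8 * card S\<close> because
  \<open>m\<close> is large.\<close>

lemma gap_minus:
  assumes k: "k < n"
  shows "(\<Sum>i\<in>{..<n}-{k}. z i) = 0 \<Longrightarrow> m / K * (\<Sum>i\<in>{..<n}-{k}. (z i)\<^sup>2) \<le> (\<Sum>i\<in>{..<n}-{k}. \<Sum>j\<in>{..<n}-{k}. Aij \<omega> i j * (z i - z j)\<^sup>2)"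
proof (rule gap_from_cut)
  fix S assume S: "S \<subseteq> {..<n}-{k}" "2 * card S \<le> card ({..<n}-{k})"
  have "card ({..<n}-{k}) \<le> n" using card_Diff1_le[of "{..<n}" k] by simp
  then have 1: "m / 4 * real (card S) \<le> (\<Sum>i\<in>S. \<Sum>j\<in>{..<n}-S. Aij \<omega> i j)" using S by (intro cut_good) auto
  have "(\<Sum>i\<in>S. \<Sum>j\<in>{..<n}-S. Aij \<omega> i j) = (\<Sum>i\<in>S. Aij \<omega> i k + (\<Sum>j\<in>{..<n}-{k}-S. Aij \<omega> i j))"
  proof (intro sum.cong refl)
    fix i
    have "{..<n} - S - {k} = {..<n} - {k} - S" by auto
    then show "(\<Sum>j\<in>{..<n}-S. Aij \<omega> i j) = Aij \<omega> i k + (\<Sum>j\<in>{..<n}-{k}-S. Aij \<omega> i j)"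
      using S k by (subst sum.remove[of _ k]) auto
  qed
  also have "\<dots> = (\<Sum>i\<in>S. Aij \<omega> i k) + (\<Sum>i\<in>S. \<Sum>j\<in>{..<n}-{k}-S. Aij \<omega> i j)" by (rule sum.distrib)
  also have "(\<Sum>i\<in>S. Aij \<omega> i k) \<le> (\<Sum>i\<in>S. 1)" by (intro sum_mono cd.A_le1)
  finally have 2: "(\<Sum>i\<in>S. \<Sum>j\<in>{..<n}-S. Aij \<omega> i j) \<le> real (card S) + (\<Sum>i\<in>S. \<Sum>j\<in>{..<n}-{k}-S. Aij \<omega> i j)" by simp
  have "m / 8 * real (card S) + 1 * real (card S) \<le> m / 8 * real (card S) + m / 8 * real (card S)"
    using m_ge by (intro add_left_mono mult_right_mono) auto
  then show "m / 8 * real (card S) \<le> (\<Sum>i\<in>S. \<Sum>j\<in>{..<n}-{k}-S. Aij \<omega> i j)" using 1 2 by (simp add: algebra_simps)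
qed auto

lemma row_noise_le:
  assumes i: "i < n" and nb: "\<omega> \<notin> row_noise_bad u1 i (\<lambda>_. c)" and c: "\<And>j. \<bar>c j\<bar> \<le> d"
  shows "\<bar>\<Sum>j<n. Aij \<omega> i j * c j * xi L \<theta> \<omega> i j\<bar> \<le> 4 * d * (m * (lam * r))"
proof -
  have d0: "0 \<le> d" using c[of 0] by linarith
  have "(\<Sum>j\<in>{..<n}-{i}. Aij \<omega> i j * (c j)\<^sup>2) \<le> (\<Sum>j\<in>{..<n}-{i}. Aij \<omega> i j * d\<^sup>2)"
    using c d0 cd.A_nonneg by (intro sum_mono mult_left_mono) (auto simp: abs_le_square_iff[symmetric])
  also have "\<dots> = (\<Sum>j<n. Aij \<omega> i j) * d\<^sup>2" using row_full[OF i, of "\<lambda>j. Aij \<omega> i j"] by (simp add: sum_distrib_right[symmetric])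
  also have "\<dots> \<le> 2 * m * d\<^sup>2" using degree_le[OF i] by (intro mult_right_mono) auto
  also have "\<dots> = (sqrt 2 * (d * sqrt m))\<^sup>2" using m0 by (simp add: power_mult_distrib)
  finally have "\<bar>\<Sum>j\<in>{..<n}-{i}. Aij \<omega> i j * c j * xi L \<theta> \<omega> i j\<bar> \<le> 5/2 * lam * (sqrt 2 * (d * sqrt m) / sqrt (real L))"
    using d0 m0 by (intro row_noise_good[OF nb]) auto
  also have "\<dots> = 5/2 * sqrt 2 * (d * (lam * (sqrt (m / real L))))" by (simp add: real_sqrt_divide)
  also have "\<dots> \<le> 4 * (d * (lam * (sqrt (m / real L))))"
  proof (rule mult_right_mono)
    have "sqrt 2 \<le> (8/5 :: real)" by (rule real_le_lsqrt) (auto simp: power2_eq_square)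
    then show "5/2 * sqrt 2 \<le> (4 :: real)" by simp
  qed (use d0 lam1 m0 in auto)
  also have "\<dots> = 4 * d * (m * (lam * r))" unfolding sqrt_m_L by simp
  finally show ?thesis using row_full[OF i, of "\<lambda>j. Aij \<omega> i j * c j * xi L \<theta> \<omega> i j"] by simp
qed

lemma K_bounds: "8 * R \<le> K" "24 * R \<le> K" "4 \<le> K" "320 * R ^ 4 \<le> K" "11 * R \<le> K"
  using R4 by (auto simp: K_def)

lemma B_le: assumes i: "i < n" shows "\<bar>BB \<omega> {..<n} i\<bar> \<le> K * m * (lam * r)"
proof -
  have nb: "\<omega> \<notin> row_noise_bad u1 i (\<lambda>_ j. a i + a j)" using good_row[OF i] by (auto simp: bad_row_def)
  have "\<bar>BB \<omega> {..<n} i\<bar> \<le> 4 * (2 * R) * (m * (lam * r))"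
    unfolding BB_eq[OF i]
  proof (rule row_noise_le[OF i nb])
    fix j
    show "\<bar>a i + a j\<bar> \<le> 2 * R" using a_bounds(2)[of i] a_bounds(2)[of j] cd.a_pos[of i] cd.a_pos[of j] by linarith
  qed
  also have "\<dots> \<le> K * (m * (lam * r))" using K_bounds m0 lam1 r0 by (intro mult_right_mono) auto
  finally show ?thesis by simp
qed

lemma G_le: assumes i: "i < n" shows "\<bar>\<Sum>j<n. Aij \<omega> i j * xi L \<theta> \<omega> i j\<bar> \<le> K * m * (lam * r)"
proof -
  have nb: "\<omega> \<notin> row_noise_bad u1 i (\<lambda>_ _. 1)" using good_row[OF i] by (auto simp: bad_row_def)
  have "\<bar>\<Sum>j<n. Aij \<omega> i j * 1 * xi L \<theta> \<omega> i j\<bar> \<le> 4 * 1 * (m * (lam * r))"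
    by (intro row_noise_le[OF i nb]) simp
  also have "\<dots> \<le> K * (m * (lam * r))" using K_bounds m0 lam1 r0 by (intro mult_right_mono) auto
  finally show ?thesis by simp
qed

text \<open>An indicator as coefficient vector reduces the row sum to a single comparison, whose
  noise is of order \<open>lam / sqrt L\<close>.\<close>

lemma xi_le: assumes i: "i < n" and k: "k < n" shows "Aij \<omega> i k * \<bar>xi L \<theta> \<omega> i k\<bar> \<le> K * (lam * r) / \<nu>"
proof (cases "k = i")
  case True
  then show ?thesis using K0 lam1 r0 nu0 by simp
next
  case False
  have nb: "\<omega> \<notin> row_noise_bad u1 i (\<lambda>_ j. of_bool (j = k))" using good_row[OF i] k by (auto simp: bad_row_def)
  have s: "(\<Sum>j\<in>{..<n}-{i}. F j * of_bool (j = k)) = F k" for F :: "nat \<Rightarrow> real"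
    using k False by (subst sum.remove[of _ k]) auto
  have sq: "(of_bool b)\<^sup>2 = (of_bool b :: real)" for b by (cases b) auto
  have "(\<Sum>j\<in>{..<n}-{i}. Aij \<omega> i j * (of_bool (j = k))\<^sup>2) = Aij \<omega> i k" unfolding sq by (rule s)
  then have W: "(\<Sum>j\<in>{..<n}-{i}. Aij \<omega> i j * (of_bool (j = k))\<^sup>2) \<le> 1\<^sup>2" using cd.A_le1 by simp
  have "(\<Sum>j\<in>{..<n}-{i}. Aij \<omega> i j * of_bool (j = k) * xi L \<theta> \<omega> i j) = Aij \<omega> i k * xi L \<theta> \<omega> i k"
    using s[of "\<lambda>j. Aij \<omega> i j * xi L \<theta> \<omega> i j"] by (simp add: mult.assoc mult.commute[of "of_bool _"])
  then have "\<bar>Aij \<omega> i k * xi L \<theta> \<omega> i k\<bar> \<le> 5/2 * lam * (1 / sqrt (real L))"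
    using row_noise_good[OF nb W] by simp
  also have "\<dots> = 5/2 * (lam * r / \<nu>)"
    using m0 by (simp add: r_def \<nu>_def real_sqrt_mult)
  also have "\<dots> \<le> K * (lam * r / \<nu>)" using K_bounds lam1 r0 nu0 by (intro mult_right_mono) auto
  finally show ?thesis using cd.A_nonneg[of \<omega> i k] by (simp add: abs_mult)
qed

lemma B_sum_le: "(\<Sum>i<n. \<bar>BB \<omega> {..<n} i\<bar>) \<le> K * real n * m * r"
proof -
  \<comment> \<open>This set depends on the data, which is harmless: \<open>bad\<close> contains the
    events of all subsets.\<close>
  define T where "T = {i. i < n \<and> 0 \<le> BB \<omega> {..<n} i}"
  have nb: "\<omega> \<notin> linear_noise_bad u3 (g_sign T)" using good by (auto simp: bad_def T_def)
  have "(\<Sum>i<n. \<bar>BB \<omega> {..<n} i\<bar>) = (\<Sum>i<n. g_sign T (fst \<omega>) i * BB \<omega> {..<n} i)"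
    by (intro sum.cong refl) (auto simp: g_sign_def T_def)
  also have "\<dots> \<le> u3 * (4 * R * 1 * (sqrt (real n) * (m * r)))"
    by (rule abs_le_D1, rule linear_noise_good[OF nb u0(3) _ degree_le]) (simp_all add: g_sign_def)
  also have "\<dots> = 4 * sqrt 7 * R * (real n * (m * r))"
    by (simp add: u3_def real_sqrt_mult)
  also have "\<dots> \<le> 11 * R * (real n * (m * r))"
    using sqrt_bounds R0 m0 r0 by (intro mult_right_mono) auto
  also have "\<dots> \<le> K * (real n * (m * r))"
    using K_bounds m0 r0 by (intro mult_right_mono) auto
  finally show ?thesis by simp
qed

text \<open>Weights of order \<open>1 / (n m)\<close> spread the noise over all items; cancellation
  gains a factor \<open>1 / sqrt n\<close>, at most \<nu> because \<open>m \<le> n\<close>. The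
  constant \<open>32 * R ^ 3\<close> is \<open>R * (4 * R) * (8 * R)\<close>, from the bounds on
  \<open>hh\<close>, \<open>Hs\<close> and \<open>Dt\<close> in \<open>g_loc\<close>.\<close>

lemma weighted_B_le:
  assumes nb: "\<omega> \<notin> linear_noise_bad u1 g" and g: "\<And>j. j < n \<Longrightarrow> \<bar>g (fst \<omega>) j\<bar> \<le> 32 * R ^ 3 / (real n * m)"
  shows "\<bar>\<Sum>j<n. g (fst \<omega>) j * BB \<omega> {..<n} j\<bar> \<le> K * \<tau> * r"
proof -
  have "\<bar>\<Sum>j<n. g (fst \<omega>) j * BB \<omega> {..<n} j\<bar> \<le> u1 * (4 * R * (32 * R ^ 3 / (real n * m)) * (sqrt (real n) * (m * r)))"
    by (rule linear_noise_good[OF nb u0(1) g degree_le])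
  also have "\<dots> = sqrt 6 * (128 * R ^ 4 * (lam * r * (1 / sqrt (real n))))"
  proof -
    have "sqrt (real n) / real n = 1 / sqrt (real n)" using n0 by (simp add: field_simps)
    moreover have "4 * R * (32 * R ^ 3 / (real n * m)) * (sqrt (real n) * (m * r)) = 128 * R ^ 4 * (r * (sqrt (real n) / real n))"
      using m0 n0 by (simp add: field_simps eval_nat_numeral)
    ultimately show ?thesis by (simp add: u1_def)
  qed
  also have "\<dots> \<le> 5/2 * (128 * R ^ 4 * (lam * r * \<nu>))"
  proof (intro mult_mono mult_left_mono)
    show "sqrt 6 \<le> (5/2 :: real)" by (rule sqrt_bounds)
    show "1 / sqrt (real n) \<le> \<nu>" unfolding \<nu>_def using m_le_n m0 by (intro divide_left_mono mult_pos_pos) auto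
  qed (use R0 lam1 r0 in auto)
  also have "\<dots> = 320 * R ^ 4 * (\<tau> * r)" by simp
  also have "\<dots> \<le> K * (\<tau> * r)" using K_bounds tau0 r0 by (intro mult_right_mono) auto
  finally show ?thesis by simp
qed

lemma avg_local_le: assumes i: "i < n"
  shows "\<bar>\<Sum>j\<in>{..<n}-{i}. hh i j / Hs i * (BB \<omega> {..<n} j / Dt \<omega> j)\<bar> \<le> K * \<tau> * r"
proof -
  have nb: "\<omega> \<notin> linear_noise_bad u1 (g_loc i)" using good_row[OF i] by (auto simp: bad_row_def)
  have "(\<Sum>j\<in>{..<n}-{i}. hh i j / Hs i * (BB \<omega> {..<n} j / Dt \<omega> j)) = (\<Sum>j\<in>{..<n}-{i}. g_loc i (fst \<omega>) j * BB \<omega> {..<n} j)"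
    by (intro sum.cong refl) (simp add: g_loc_def Dt_fst)
  also have "\<dots> = (\<Sum>j<n. g_loc i (fst \<omega>) j * BB \<omega> {..<n} j)" by (rule row_full[OF i]) (simp add: g_loc_def)
  finally have eq: "(\<Sum>j\<in>{..<n}-{i}. hh i j / Hs i * (BB \<omega> {..<n} j / Dt \<omega> j)) = (\<Sum>j<n. g_loc i (fst \<omega>) j * BB \<omega> {..<n} j)" .
  show ?thesis unfolding eq
  proof (rule weighted_B_le[OF nb])
    fix j assume j: "j < n"
    show "\<bar>g_loc i (fst \<omega>) j\<bar> \<le> 32 * R ^ 3 / (real n * m)"
    proof (cases "j = i")
      case False
      have "\<bar>g_loc i (fst \<omega>) j\<bar> = hh i j / Hs i / Dt \<omega> j"
        using False Hs_pos[OF i] D_pos[OF j] cd.h_pos[of i j] by (simp add: g_loc_def Dt_fst)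
      also have "\<dots> \<le> R / (real n / (4 * R)) / (m / (8 * R))"
        using cd.h_upper[of i j] cd.h_pos[of i j] Hs_lower[OF i] D_lower[OF j] Hs_pos[OF i] n0 R0 m0
        by (intro frac_le) auto
      also have "\<dots> = 32 * R ^ 3 / (real n * m)" by (simp add: power3_eq_cube)
      finally show ?thesis .
    qed (use R0 n0 m0 in \<open>simp add: g_loc_def\<close>)
  qed
qed

lemma avg_global_le: "\<bar>\<Sum>j<n. BB \<omega> {..<n} j / Dt \<omega> j\<bar> / real n \<le> K * \<tau> * r"
proof -
  have nb: "\<omega> \<notin> linear_noise_bad u1 g_avg" using good by (auto simp: bad_def)
  have "(\<Sum>j<n. g_avg (fst \<omega>) j * BB \<omega> {..<n} j) = (\<Sum>j<n. BB \<omega> {..<n} j / Dt \<omega> j) / real n"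
    unfolding sum_divide_distrib by (intro sum.cong refl) (simp add: g_avg_def Dt_fst)
  moreover have "\<bar>\<Sum>j<n. g_avg (fst \<omega>) j * BB \<omega> {..<n} j\<bar> \<le> K * \<tau> * r"
  proof (rule weighted_B_le[OF nb])
    fix j assume j: "j < n"
    have "\<bar>g_avg (fst \<omega>) j\<bar> = 1 / (real n * Dt \<omega> j)" using D_pos[OF j] n0 by (simp add: g_avg_def Dt_fst)
    also have "\<dots> \<le> 1 / (real n * (m / (8 * R)))"
      using D_lower[OF j] m0 R0 n0 by (intro divide_left_mono mult_left_mono mult_pos_pos D_pos[OF j]) auto
    also have "\<dots> = 8 * R / (real n * m)" by simp
    also have "\<dots> \<le> 32 * R ^ 3 / (real n * m)"
    proof (rule divide_right_mono)
      have "R \<le> R ^ 3" using R1 power_increasing[of 1 3 R] by simp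
      then show "8 * R \<le> 32 * R ^ 3" using R0 by linarith
    qed (use n0 m0 in simp)
    finally show "\<bar>g_avg (fst \<omega>) j\<bar> \<le> 32 * R ^ 3 / (real n * m)" .
  qed
  ultimately show ?thesis using n0 by simp
qed

abbreviation x' where "x' i \<equiv> loo i (leave_out i \<omega>)"
definition Q' where "Q' i = L2_set (x' i) ({..<n}-{i}) / sqrt (real n)"
abbreviation X' where "X' i \<equiv> XX i (leave_out i \<omega>)"

lemma x'_le_X': "j < n \<Longrightarrow> j \<noteq> i \<Longrightarrow> \<bar>x' i j\<bar> \<le> X' i"
  unfolding XX_def by (rule Max_ge) auto

lemma X'_nonneg: assumes "i < n" shows "0 \<le> X' i"
proof -
  have "\<exists>j<n. j \<noteq> i" using n3 by (cases "i = 0") (auto intro: exI[of _ 1] exI[of _ 0])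
  then show ?thesis using x'_le_X'[of _ i] by (meson abs_ge_zero order_trans)
qed

lemma L2_Q': "sqrt p * L2_set (x' i) ({..<n}-{i}) = sqrt m * Q' i"
  using n0 by (simp add: Q'_def m_def real_sqrt_mult)

lemma sum_x'_sq: "(\<Sum>j\<in>{..<n}-{i}. (x' i j)\<^sup>2) = (L2_set (x' i) ({..<n}-{i}))\<^sup>2"
  by (simp add: L2_set_sq)

lemma T2_le: assumes i: "i < n"
  shows "\<bar>\<Sum>j\<in>{..<n}-{i}. (Aij \<omega> i j - p) * hh i j * x' i j\<bar> \<le> K * m * (\<tau> * Q' i + \<tau>\<^sup>2 * X' i)"
proof -
  have nb: "\<omega> \<notin> row_graph_bad u2 i (\<lambda>\<omega> j. hh i j * loo i \<omega> j) (\<lambda>\<omega>. R * XX i \<omega>)"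
    using good_row[OF i] by (auto simp: bad_row_def)
  have "(\<Sum>j\<in>{..<n}-{i}. (hh i j * x' i j)\<^sup>2) \<le> (\<Sum>j\<in>{..<n}-{i}. R\<^sup>2 * (x' i j)\<^sup>2)"
    unfolding power_mult_distrib using h_abs R0 by (intro sum_mono mult_right_mono) (auto simp: abs_le_square_iff[symmetric])
  also have "\<dots> = (R * L2_set (x' i) ({..<n}-{i}))\<^sup>2" by (simp add: sum_distrib_left[symmetric] sum_x'_sq power_mult_distrib)
  finally have "\<bar>\<Sum>j\<in>{..<n}-{i}. hh i j * x' i j * (Aij \<omega> i j - p)\<bar> \<le>
      7 * lam * (sqrt p * (R * L2_set (x' i) ({..<n}-{i}))) + 24 * lam\<^sup>2 * (R * X' i)"
    using R0 by (intro row_graph_good[OF nb]) (auto simp: L2_set_nonneg)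
  also have "\<dots> = 7 * R * (lam * (sqrt p * L2_set (x' i) ({..<n}-{i}))) + 24 * lam\<^sup>2 * (R * X' i)" by simp
  also have "\<dots> = 7 * R * (lam * sqrt m * Q' i) + 24 * lam\<^sup>2 * (R * X' i)" unfolding L2_Q' by simp
  also have "\<dots> = 7 * (R * m * (\<tau> * Q' i)) + 24 * (R * m * (\<tau>\<^sup>2 * X' i))" unfolding lam_sqrt_m lam_sq_m by simp
  also have "\<dots> \<le> 24 * (R * m * (\<tau> * Q' i)) + 24 * (R * m * (\<tau>\<^sup>2 * X' i))"
    using R0 m0 tau0 by (intro add_right_mono mult_right_mono) (auto simp: Q'_def L2_set_nonneg)
  also have "\<dots> = 24 * R * (m * (\<tau> * Q' i + \<tau>\<^sup>2 * X' i))" by (simp add: algebra_simps)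
  also have "\<dots> \<le> K * (m * (\<tau> * Q' i + \<tau>\<^sup>2 * X' i))"
    using K_bounds m0 tau0 X'_nonneg[OF i] by (intro mult_right_mono) (auto simp: Q'_def L2_set_nonneg intro!: mult_nonneg_nonneg add_nonneg_nonneg)
  finally show ?thesis by (simp add: mult.assoc mult.left_commute mult.commute)
qed

text \<open>Conditional variance of the noise sum in \<open>T1_le\<close>: the squares of
  \<open>x' i\<close> over the actual neighbours of \<open>i\<close>. A second Bernstein bound, for
  the squares, compares it with \<open>p\<close> times the sum over all items, and the deviation
  terms 7 and 24 fit into the cross and square terms 10 and 25 of a perfect square.\<close>

lemma row_sq_le: assumes i: "i < n"
  shows "(\<Sum>j\<in>{..<n}-{i}. Aij \<omega> i j * (x' i j)\<^sup>2) \<le> (sqrt m * Q' i + 5 * (lam * X' i))\<^sup>2"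
proof -
  define \<Lambda> where "\<Lambda> = L2_set (x' i) ({..<n}-{i})"
  have nb: "\<omega> \<notin> row_graph_bad u2 i (\<lambda>\<omega> j. (loo i \<omega> j)\<^sup>2) (\<lambda>\<omega>. (XX i \<omega>)\<^sup>2)"
    using good_row[OF i] by (auto simp: bad_row_def)
  have X0: "0 \<le> X' i" by (rule X'_nonneg[OF i])
  have "(\<Sum>j\<in>{..<n}-{i}. ((x' i j)\<^sup>2)\<^sup>2) \<le> (\<Sum>j\<in>{..<n}-{i}. (X' i)\<^sup>2 * (x' i j)\<^sup>2)"
  proof (rule sum_mono)
    fix j assume "j \<in> {..<n}-{i}"
    then have "\<bar>x' i j\<bar> \<le> X' i" by (intro x'_le_X') auto
    then have "(x' i j)\<^sup>2 \<le> (X' i)\<^sup>2" using X0 by (simp add: abs_le_square_iff[symmetric])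
    then show "((x' i j)\<^sup>2)\<^sup>2 \<le> (X' i)\<^sup>2 * (x' i j)\<^sup>2" unfolding power2_eq_square[of "(x' i j)\<^sup>2"] by (intro mult_right_mono) auto
  qed
  also have "\<dots> = (X' i * \<Lambda>)\<^sup>2" by (simp add: sum_distrib_left[symmetric] sum_x'_sq power_mult_distrib \<Lambda>_def)
  finally have "\<bar>\<Sum>j\<in>{..<n}-{i}. (x' i j)\<^sup>2 * (Aij \<omega> i j - p)\<bar> \<le> 7 * lam * (sqrt p * (X' i * \<Lambda>)) + 24 * lam\<^sup>2 * (X' i)\<^sup>2"
    using X0 by (intro row_graph_good[OF nb]) (auto simp: L2_set_nonneg \<Lambda>_def)
  moreover have "(\<Sum>j\<in>{..<n}-{i}. (x' i j)\<^sup>2 * (Aij \<omega> i j - p)) = (\<Sum>j\<in>{..<n}-{i}. Aij \<omega> i j * (x' i j)\<^sup>2) - p * \<Lambda>\<^sup>2"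
    by (simp add: \<Lambda>_def sum_x'_sq[symmetric] sum_subtractf sum_distrib_left algebra_simps)
  ultimately have "(\<Sum>j\<in>{..<n}-{i}. Aij \<omega> i j * (x' i j)\<^sup>2) \<le> p * \<Lambda>\<^sup>2 + 7 * lam * (sqrt p * (X' i * \<Lambda>)) + 24 * lam\<^sup>2 * (X' i)\<^sup>2" by linarith
  also have "p * \<Lambda>\<^sup>2 = (sqrt p * \<Lambda>)\<^sup>2" using p0 by (simp add: power_mult_distrib)
  also have "(sqrt p * \<Lambda>)\<^sup>2 + 7 * lam * (sqrt p * (X' i * \<Lambda>)) + 24 * lam\<^sup>2 * (X' i)\<^sup>2 \<le> (sqrt p * \<Lambda> + 5 * (lam * X' i))\<^sup>2"
  proof -
    have "0 \<le> (sqrt p * \<Lambda>) * (lam * X' i)" using p0 lam1 X0 by (simp add: \<Lambda>_def L2_set_nonneg)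
    moreover have "0 \<le> (lam * X' i)\<^sup>2" by simp
    moreover have "(sqrt p * \<Lambda> + 5 * (lam * X' i))\<^sup>2 = (sqrt p * \<Lambda>)\<^sup>2 + 10 * ((sqrt p * \<Lambda>) * (lam * X' i)) + 25 * (lam * X' i)\<^sup>2"
      by (simp add: power2_eq_square algebra_simps)
    moreover have "7 * lam * (sqrt p * (X' i * \<Lambda>)) = 7 * ((sqrt p * \<Lambda>) * (lam * X' i))" by simp
    moreover have "24 * lam\<^sup>2 * (X' i)\<^sup>2 = 24 * (lam * X' i)\<^sup>2" by (simp add: power_mult_distrib)
    ultimately show ?thesis by linarith
  qed
  also have "sqrt p * \<Lambda> = sqrt m * Q' i" unfolding \<Lambda>_def by (rule L2_Q')
  finally show ?thesis .
qed

lemma T1_le: assumes i: "i < n"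
  shows "\<bar>\<Sum>j\<in>{..<n}-{i}. Aij \<omega> i j * xi L \<theta> \<omega> i j * a j * x' i j\<bar> \<le> K * m * (\<tau> * Q' i + \<tau>\<^sup>2 * X' i)"
proof -
  define W where "W = sqrt m * Q' i + 5 * (lam * X' i)"
  have W0: "0 \<le> W" using m0 lam1 X'_nonneg[OF i] by (simp add: W_def Q'_def L2_set_nonneg)
  have nb: "\<omega> \<notin> row_noise_bad u1 i (\<lambda>\<omega> j. a j * loo i \<omega> j)" using good_row[OF i] by (auto simp: bad_row_def)
  have "(\<Sum>j\<in>{..<n}-{i}. Aij \<omega> i j * (a j * x' i j)\<^sup>2) \<le> (\<Sum>j\<in>{..<n}-{i}. R\<^sup>2 * (Aij \<omega> i j * (x' i j)\<^sup>2))"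
  proof (rule sum_mono)
    fix j
    have "(a j)\<^sup>2 \<le> R\<^sup>2" using a_bounds(2)[of j] cd.a_pos[of j] by (intro power_mono) auto
    then have "(a j)\<^sup>2 * (Aij \<omega> i j * (x' i j)\<^sup>2) \<le> R\<^sup>2 * (Aij \<omega> i j * (x' i j)\<^sup>2)" using cd.A_nonneg by (intro mult_right_mono) auto
    then show "Aij \<omega> i j * (a j * x' i j)\<^sup>2 \<le> R\<^sup>2 * (Aij \<omega> i j * (x' i j)\<^sup>2)" by (simp add: power_mult_distrib algebra_simps)
  qed
  also have "\<dots> \<le> R\<^sup>2 * W\<^sup>2" unfolding sum_distrib_left[symmetric] W_def using row_sq_le[OF i] by (intro mult_left_mono) auto
  also have "\<dots> = (R * W)\<^sup>2" by (simp add: power_mult_distrib)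
  finally have "\<bar>\<Sum>j\<in>{..<n}-{i}. Aij \<omega> i j * (a j * x' i j) * xi L \<theta> \<omega> i j\<bar> \<le> 5/2 * lam * (R * W / sqrt (real L))"
    using R0 W0 by (intro row_noise_good[OF nb]) auto
  \<comment> \<open>The gain \<open>1 / sqrt L\<close> is given up here; the scale \<open>r\<close>
    of the final error comes from \<open>x' i\<close>.\<close>
  also have "\<dots> \<le> 5/2 * lam * (R * W / 1)"
    using L1 R0 W0 lam1 by (intro mult_left_mono divide_left_mono) auto
  also have "\<dots> = 5/2 * R * (lam * sqrt m * Q' i) + 25/2 * R * (lam\<^sup>2 * X' i)"
    by (simp add: W_def algebra_simps power2_eq_square)
  also have "\<dots> = 5/2 * (R * m * (\<tau> * Q' i)) + 25/2 * (R * m * (\<tau>\<^sup>2 * X' i))" unfolding lam_sqrt_m lam_sq_m by simp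
  also have "\<dots> \<le> 24 * (R * m * (\<tau> * Q' i)) + 24 * (R * m * (\<tau>\<^sup>2 * X' i))"
    using R0 m0 tau0 X'_nonneg[OF i] by (intro add_mono mult_right_mono) (auto simp: Q'_def L2_set_nonneg)
  also have "\<dots> = 24 * R * (m * (\<tau> * Q' i + \<tau>\<^sup>2 * X' i))" by (simp add: algebra_simps)
  also have "\<dots> \<le> K * (m * (\<tau> * Q' i + \<tau>\<^sup>2 * X' i))"
    using K_bounds m0 tau0 X'_nonneg[OF i] by (intro mult_right_mono) (auto simp: Q'_def L2_set_nonneg intro!: mult_nonneg_nonneg add_nonneg_nonneg)
  finally show ?thesis by (simp add: mult.assoc mult.left_commute mult.commute)
qed

lemma good_sample: "good_sample (Aij \<omega>) (ybar L \<omega>) a K n p m r lam \<nu> \<sigma> (xv \<omega>) (\<lambda>i. loo i (leave_out i \<omega>))"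
proof (rule good_sample.intro[OF cd[OF R_le_K]], unfold_locales)
  show "2 \<le> n" using n3 by simp
  show "m = real n * p" by (rule m_def)
  show "0 \<le> p" using p0 by simp
  fix i
  assume i: "i < n"
  show "m / K \<le> (\<Sum>j<n. Aij \<omega> i j * hh i j)"
  proof -
    have "m / K \<le> m / (8 * R)" using m0 K0 R0 K_bounds by (intro divide_left_mono mult_pos_pos) auto
    then show ?thesis using D_lower[OF i] by (simp add: Dt_def)
  qed
  show "\<bar>(\<Sum>j<n. Aij \<omega> i j * hh i j) - p * (\<Sum>j\<in>{..<n}-{i}. hh i j)\<bar> \<le> K * (lam * \<nu>) * m"
  proof -
    have "8 * R * ((lam * \<nu>) * m) \<le> K * ((lam * \<nu>) * m)" using K_bounds tau0 m0 by (intro mult_right_mono) auto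
    then show ?thesis using D_dev[OF i] by (simp add: Dt_def Hs_def)
  qed
  show "\<bar>\<Sum>j<n. Aij \<omega> i j * comparison_data.\<xi> (ybar L \<omega>) a i j\<bar> \<le> K * m * (lam * r)"
    using G_le[OF i] by (simp add: xi_eq i)
  show "\<bar>\<Sum>j\<in>{..<n}-{i}. hh i j / (\<Sum>j\<in>{..<n}-{i}. hh i j) * (BB \<omega> {..<n} j / (\<Sum>k<n. Aij \<omega> j k * hh j k))\<bar> \<le> K * (lam * \<nu>) * r"
    using avg_local_le[OF i] by (simp add: Dt_def Hs_def)
  show "\<bar>\<Sum>j\<in>{..<n}-{i}. Aij \<omega> i j * comparison_data.\<xi> (ybar L \<omega>) a i j * a j * x' i j\<bar>
     \<le> K * m * ((lam * \<nu>) * (L2_set (x' i) ({..<n}-{i}) / sqrt (real n)) + (lam * \<nu>)\<^sup>2 * Max ((\<lambda>j. \<bar>x' i j\<bar>) ` ({..<n}-{i})))"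
    using T1_le[OF i] by (simp add: xi_eq i Q'_def XX_def)
  show "\<bar>\<Sum>j\<in>{..<n}-{i}. (Aij \<omega> i j - p) * hh i j * x' i j\<bar>
     \<le> K * m * ((lam * \<nu>) * (L2_set (x' i) ({..<n}-{i}) / sqrt (real n)) + (lam * \<nu>)\<^sup>2 * Max ((\<lambda>j. \<bar>x' i j\<bar>) ` ({..<n}-{i})))"
    using T2_le[OF i] by (simp add: Q'_def XX_def)
  fix j assume j: "j < n"
  show "Aij \<omega> i j * \<bar>comparison_data.\<xi> (ybar L \<omega>) a i j\<bar> \<le> K * (lam * r) / \<nu>" using xi_le[OF i j] by (simp add: xi_eq i j)
  assume "j \<noteq> i"
  then show "MM \<omega> ({..<n}-{i}) (x' i) j = BB \<omega> ({..<n}-{i}) j" by (rule M_loo[OF i j])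
qed (use lam1 r0 r_le_nu m_nu m_le_n sig_sq sig0 small degree_le gap_full gap_minus B_le B_sum_le M_xv xv_mean loo_mean avg_global_le in \<open>simp_all add: Dt_def\<close>)

lemma expansion:
  assumes i: "i < n"
  shows "\<bar>spectral_theta n (ph \<omega>) i - \<theta> i - b_tilde n L \<theta> \<omega> i / d_tilde n \<theta> \<omega> i\<bar>
     \<le> 812 * K ^ 6 * \<sigma> * \<bar>b_tilde n L \<theta> \<omega> i / d_tilde n \<theta> \<omega> i\<bar> + 300000 * K ^ 13 * \<sigma> * r"
proof -
  have "0 < 1 + xv \<omega> k" if "k < n" for k using good_sample.x_half[OF good_sample that] by linarith
  then have "spectral_theta n (ph \<omega>) i - \<theta> i = ln (1 + xv \<omega> i) - (\<Sum>k<n. ln (1 + xv \<omega> k)) / real n"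
    using i by (rule spectral_eq)
  then show ?thesis using good_sample.log_expansion[OF good_sample i] unfolding b_div_d[OF i] Dt_def by simp
qed

end

section \<open>Probability of the good event\<close>

lemma prob_UN_le:
  assumes "finite I" "\<And>i. i \<in> I \<Longrightarrow> measure_pmf.prob P (F i) \<le> c"
  shows "measure_pmf.prob P (\<Union>i\<in>I. F i) \<le> real (card I) * c"
proof -
  have "measure_pmf.prob P (\<Union>i\<in>I. F i) \<le> (\<Sum>i\<in>I. measure_pmf.prob P (F i))"
    using assms(1) by (intro measure_pmf.finite_measure_subadditive_finite) auto
  also have "\<dots> \<le> (\<Sum>i\<in>I. c)" using assms(2) by (rule sum_mono)
  finally show ?thesis by simp
qed

lemma prob_Un_le:
  assumes "measure_pmf.prob P X \<le> c" "measure_pmf.prob P Y \<le> d"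
  shows "measure_pmf.prob P (X \<union> Y) \<le> c + d"
  using measure_Un_le[of X "measure_pmf P" Y] assms by simp

text \<open>By the binomial theorem the sum is \<open>(1 + q) ^ N - 1\<close>. So when each vertex
  contributes a factor \<open>q\<close> with \<open>N * q \<le> 1\<close>, a union bound over all
  vertex sets costs no more in order than one over singletons.\<close>

lemma sum_power_card_nonempty_le:
  fixes q :: real
  assumes fin: "finite V" and q: "0 \<le> q" "real (card V) * q \<le> 1"
  shows "(\<Sum>S\<in>Pow V - {{}}. q ^ card S) \<le> 2 * (real (card V) * q)"
proof -
  have "(\<Sum>S\<in>Pow V. q ^ card S) = (\<Prod>i\<in>V. q + 1)"
    using prod_add[OF fin, of "\<lambda>_. q" "\<lambda>_. 1"] by simp
  then have "(\<Sum>S\<in>Pow V - {{}}. q ^ card S) = (1 + q) ^ card V - 1"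
    using fin by (simp add: sum_diff1 add.commute)
  also have "(1 + q) ^ card V \<le> exp q ^ card V" using q by (intro power_mono exp_ge_add_one_self) auto
  also have "\<dots> = exp (real (card V) * q)" by (simp add: exp_of_nat_mult)
  also have "\<dots> \<le> 1 + real (card V) * q + (real (card V) * q)\<^sup>2" using q by (intro exp_le_quadratic) auto
  also have "(real (card V) * q)\<^sup>2 \<le> real (card V) * q" using q by (simp add: power2_eq_square mult_left_le)
  finally show ?thesis by (simp add: mult.commute)
qed

lemma two_power_exp_le: "(1::real) \<le> real n \<Longrightarrow> 2 ^ n * exp (- 14 * real n) \<le> 1 / real n ^ 10"
proof -
  assume n: "1 \<le> real n"
  have "(2::real) ^ n \<le> exp 1 ^ n" using exp_ge_add_one_self[of 1] by (intro power_mono) auto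
  then have "2 ^ n * exp (- 14 * real n) \<le> exp (real n) * exp (- 14 * real n)"
    by (intro mult_right_mono) (auto simp: exp_of_nat_mult[symmetric])
  also have "\<dots> = exp (- 13 * real n)" by (simp flip: exp_add)
  also have "\<dots> \<le> exp (- 10 * real n)" by simp
  also have "\<dots> = 1 / exp (real n) ^ 10" by (simp add: exp_minus inverse_eq_divide flip: exp_of_nat_mult)
  also have "\<dots> \<le> 1 / real n ^ 10"
  proof (intro divide_left_mono power_mono mult_pos_pos)
    show "real n \<le> exp (real n)" using exp_ge_add_one_self[of "real n"] by linarith
  qed (use n in auto)
  finally show ?thesis .
qed

context btl_model begin

abbreviation "PP \<equiv> measure_pmf.prob (btl_pmf n p L \<theta>)"

lemma exp_ln_n: "exp (- (real k * ln (real n))) = 1 / real n ^ k"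
  using n0 by (simp add: exp_minus exp_of_nat_mult inverse_eq_divide)

lemma exp_u: "exp (- 2 * u1\<^sup>2) = 1 / real n ^ 12" "exp (- u2\<^sup>2) = 1 / real n ^ 12"
proof -
  have "- 2 * u1\<^sup>2 = - (real 12 * ln (real n))" "- u2\<^sup>2 = - (real 12 * ln (real n))"
    by (simp_all add: u1_def u2_def power_mult_distrib lam_sq)
  then show "exp (- 2 * u1\<^sup>2) = 1 / real n ^ 12" "exp (- u2\<^sup>2) = 1 / real n ^ 12"
    using exp_ln_n[of 12] by simp_all
qed

lemma prob_row_noise: "i < n \<Longrightarrow> PP (row_noise_bad u1 i C) \<le> 2 / real n ^ 12"
  unfolding row_noise_bad_def using row_noise_tail[OF _ L1 u0(1), of i n p \<theta> C] exp_u by simp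

lemma prob_row_graph:
  assumes "i < n" "\<And>\<omega>. 0 \<le> b \<omega>" "\<And>\<omega> j. j < n \<Longrightarrow> j \<noteq> i \<Longrightarrow> \<bar>C \<omega> j\<bar> \<le> b \<omega>"
  shows "PP (row_graph_bad u2 i C b) \<le> 2 / real n ^ 12"
  unfolding row_graph_bad_def using row_graph_tail[of i n p u2 b C L \<theta>] exp_u assms p0 p1 u0 by simp

lemma prob_linear_noise: "0 \<le> u \<Longrightarrow> PP (linear_noise_bad u g) \<le> 2 * exp (- 2 * u\<^sup>2)"
  unfolding linear_noise_bad_def by (rule linear_noise_tail[OF L1]) (auto simp: add.commute)

lemma XX_ge: "j < n \<Longrightarrow> j \<noteq> i \<Longrightarrow> \<bar>loo i \<omega> j\<bar> \<le> XX i \<omega>"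
  unfolding XX_def by (rule Max_ge) auto

lemma XX_nonneg: "0 \<le> XX i \<omega>"
proof -
  have "\<exists>j<n. j \<noteq> i" using n3 by (cases "i = 0") (auto intro: exI[of _ 1] exI[of _ 0])
  then show ?thesis using XX_ge[of _ i \<omega>] by (meson abs_ge_zero order_trans)
qed

lemma prob_bad_row: assumes i: "i < n" shows "PP (bad_row i) \<le> 18 / real n ^ 11"
proof -
  have h: "\<bar>hh i j\<bar> \<le> R" for j using cd.h_pos[of i j] cd.h_upper[of i j] by simp
  have U: "PP (\<Union>k<n. row_noise_bad u1 i (\<lambda>_ j. of_bool (j = k))) \<le> real (card {..<n}) * (2 / real n ^ 12)"
    by (rule prob_UN_le) (auto intro: prob_row_noise[OF i])
  have "PP (bad_row i) \<le> 2 / real n ^ 12 + 2 / real n ^ 12 + 2 / real n ^ 12 + 2 / real n ^ 12 + 2 / real n ^ 12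
     + 2 / real n ^ 12 + 2 / real n ^ 12 + 2 / real n ^ 12 + real (card {..<n}) * (2 / real n ^ 12)"
    unfolding bad_row_def
  proof (intro prob_Un_le U prob_row_noise[OF i] prob_row_graph[OF i])
    show "PP (linear_noise_bad u1 (g_loc i)) \<le> 2 / real n ^ 12"
      using prob_linear_noise[OF u0(1), of "g_loc i"] exp_u by simp
  next
    fix \<omega> j assume j: "j < n" "j \<noteq> i"
    show "\<bar>hh i j * loo i \<omega> j\<bar> \<le> R * XX i \<omega>"
      unfolding abs_mult using h XX_ge[OF j] R0 by (intro mult_mono) auto
    show "\<bar>(loo i \<omega> j)\<^sup>2\<bar> \<le> (XX i \<omega>)\<^sup>2" using XX_ge[OF j] XX_nonneg by (simp add: abs_le_square_iff[symmetric])
  qed (use R0 XX_nonneg h in auto)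
  also have "\<dots> = (16 + 2 * real n) / real n ^ 12" by (simp add: add_divide_distrib)
  also have "\<dots> \<le> (18 * real n) / real n ^ 12" using n3 by (intro divide_right_mono) auto
  also have "\<dots> = 18 / real n ^ 11" using n0 by (simp add: field_simps eval_nat_numeral)
  finally show ?thesis .
qed

text \<open>Smallness of \<sigma> forces \<open>m\<close> to exceed a large multiple of
  \<open>ln n\<close>, so the cut of \<open>S\<close> fails with probability at most
  \<open>2 * n^(-12 * card S)\<close>. The decay in \<open>card S\<close> beats the number of sets
  of that size.\<close>

lemma prob_bad_cut:
  assumes small: "1000 * K ^ 6 * \<sigma> \<le> 1"
  shows "PP (\<Union>S\<in>{S. S \<subseteq> {..<n} \<and> S \<noteq> {} \<and> 2 * card S \<le> n}. cut_bad S) \<le> 4 / real n ^ 11"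
proof -
  define q where "q = 1 / real n ^ 12"
  have q0: "0 \<le> q" by (simp add: q_def)
  have ln_m: "12 * ln (real n) \<le> m / 128"
  proof -
    have "1 \<le> K ^ 6" using R4 by (intro one_le_power) (simp add: K_def)
    then have "1 * \<sigma> \<le> K ^ 6 * \<sigma>" using sig0 by (intro mult_right_mono) auto
    then have "lam * \<nu> \<le> 1/1000" using small tau_le_sig by linarith
    then have "(lam * \<nu>)\<^sup>2 \<le> (1/1000)\<^sup>2" using lam1 nu0 by (intro power_mono) auto
    then have "m * (lam * \<nu>)\<^sup>2 \<le> m * (1/1000)\<^sup>2" using m0 by (intro mult_left_mono) auto
    then have "ln (real n) \<le> m * (1/1000)\<^sup>2" unfolding lam_sq_m[symmetric] lam_sq .
    then show ?thesis using m0 by (simp add: power2_eq_square)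
  qed
  have cut: "PP (cut_bad S) \<le> 2 * q ^ card S" if S: "S \<subseteq> {..<n}" "2 * card S \<le> n" for S
  proof -
    have "PP (cut_bad S) \<le> 2 * exp (- (p * real (card S) * real (n - card S)) / 64)"
      unfolding cut_bad_def using S p0 p1 by (intro cut_tail) auto
    also have "\<dots> \<le> 2 * exp (- (real (card S) * (12 * ln (real n))))"
    proof -
      have "real n / 2 \<le> real (n - card S)" using S(2) by linarith
      then have "p * real (card S) * (real n / 2) \<le> p * real (card S) * real (n - card S)" using p0 by (intro mult_left_mono) auto
      then have "real (card S) * (m / 128) \<le> p * real (card S) * real (n - card S) / 64" by (simp add: m_def algebra_simps)
      moreover have "real (card S) * (12 * ln (real n)) \<le> real (card S) * (m / 128)" using ln_m by (intro mult_left_mono) auto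
      ultimately show ?thesis by simp
    qed
    also have "\<dots> = 2 * exp (- (12 * ln (real n))) ^ card S" by (simp add: exp_of_nat_mult[symmetric])
    also have "exp (- (12 * ln (real n))) = q" using exp_ln_n[of 12] by (simp add: q_def)
    finally show ?thesis .
  qed
  have "PP (\<Union>S\<in>{S. S \<subseteq> {..<n} \<and> S \<noteq> {} \<and> 2 * card S \<le> n}. cut_bad S)
     \<le> (\<Sum>S\<in>{S. S \<subseteq> {..<n} \<and> S \<noteq> {} \<and> 2 * card S \<le> n}. PP (cut_bad S))"
    by (intro measure_pmf.finite_measure_subadditive_finite) auto
  also have "\<dots> \<le> (\<Sum>S\<in>{S. S \<subseteq> {..<n} \<and> S \<noteq> {} \<and> 2 * card S \<le> n}. 2 * q ^ card S)"
    by (intro sum_mono cut) auto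
  also have "\<dots> \<le> (\<Sum>S\<in>Pow {..<n} - {{}}. 2 * q ^ card S)"
    using q0 by (intro sum_mono2) auto
  also have "\<dots> = 2 * (\<Sum>S\<in>Pow {..<n} - {{}}. q ^ card S)" by (simp add: sum_distrib_left)
  also have "\<dots> \<le> 2 * (2 * (real (card {..<n}) * q))"
  proof (intro mult_left_mono sum_power_card_nonempty_le)
    have "real n ^ 1 \<le> real n ^ 12" using n3 by (intro power_increasing) auto
    then show "real (card {..<n}) * q \<le> 1" using n0 by (simp add: q_def)
  qed (use q0 in auto)
  also have "\<dots> = 4 / real n ^ 11" using n0 by (simp add: q_def field_simps eval_nat_numeral)
  finally show ?thesis .
qed

lemma prob_bad:
  assumes small: "1000 * K ^ 6 * \<sigma> \<le> 1"
  shows "PP bad \<le> 26 / real n ^ 10"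
proof -
  have 1: "PP (\<Union>i<n. bad_row i) \<le> real (card {..<n}) * (18 / real n ^ 11)"
    by (rule prob_UN_le) (auto intro: prob_bad_row)
  have 2: "PP (linear_noise_bad u1 g_avg) \<le> 2 / real n ^ 12"
    using prob_linear_noise[OF u0(1), of g_avg] exp_u by simp
  have 3: "PP (\<Union>T\<in>Pow {..<n}. linear_noise_bad u3 (g_sign T)) \<le> real (card (Pow {..<n})) * (2 * exp (- 2 * u3\<^sup>2))"
    by (intro prob_UN_le prob_linear_noise u0) auto
  have pw: "1 / real n ^ k \<le> 1 / real n ^ 10" if "10 \<le> k" for k
    using that n3 by (intro divide_left_mono power_increasing mult_pos_pos) auto
  have "real (card {..<n}) * (18 / real n ^ 11) = 18 * (1 / real n ^ 10)" using n0 by (simp add: field_simps eval_nat_numeral)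
  moreover have "2 / real n ^ 12 \<le> 2 * (1 / real n ^ 10)" "4 / real n ^ 11 \<le> 4 * (1 / real n ^ 10)" using pw[of 12] pw[of 11] by simp_all
  moreover have "real (card (Pow {..<n})) * (2 * exp (- 2 * u3\<^sup>2)) \<le> 2 * (1 / real n ^ 10)"
  proof -
    have "real (card (Pow {..<n})) * (2 * exp (- 2 * u3\<^sup>2)) = 2 * (2 ^ n * exp (- 14 * real n))"
      using n0 by (simp add: card_Pow u3_def)
    then show ?thesis using two_power_exp_le[of n] n3 by simp
  qed
  moreover have "PP bad \<le> real (card {..<n}) * (18 / real n ^ 11) + 2 / real n ^ 12
     + real (card (Pow {..<n})) * (2 * exp (- 2 * u3\<^sup>2)) + 4 / real n ^ 11"
    unfolding bad_def by (intro prob_Un_le 1 2 3 prob_bad_cut small)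
  \<comment> \<open>The total 26 = 18 + 2 + 2 + 4 comes from rows, global average, sign patterns and
    cuts.\<close>
  ultimately have "PP bad \<le> 26 * (1 / real n ^ 10)" by linarith
  then show ?thesis by simp
qed

lemma expansion_prob:
  assumes small: "1000 * K ^ 6 * \<sigma> \<le> 1"
  shows "1 - 26 / real n ^ 10 \<le> PP {\<omega>. \<forall>i<n.
     \<bar>spectral_theta n (ph \<omega>) i - \<theta> i - b_tilde n L \<theta> \<omega> i / d_tilde n \<theta> \<omega> i\<bar>
     \<le> 812 * K ^ 6 * \<sigma> * \<bar>b_tilde n L \<theta> \<omega> i / d_tilde n \<theta> \<omega> i\<bar> + 300000 * K ^ 13 * \<sigma> * r}"
proof -
  have "- bad \<subseteq> {\<omega>. \<forall>i<n.
     \<bar>spectral_theta n (ph \<omega>) i - \<theta> i - b_tilde n L \<theta> \<omega> i / d_tilde n \<theta> \<omega> i\<bar>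
     \<le> 812 * K ^ 6 * \<sigma> * \<bar>b_tilde n L \<theta> \<omega> i / d_tilde n \<theta> \<omega> i\<bar> + 300000 * K ^ 13 * \<sigma> * r}"
  proof (intro subsetI CollectI allI impI)
    fix \<omega> i assume w: "\<omega> \<in> - bad" and i: "i < n"
    interpret btl_good n p L \<theta> R ph \<omega> by unfold_locales (use w small in auto)
    show "\<bar>spectral_theta n (ph \<omega>) i - \<theta> i - b_tilde n L \<theta> \<omega> i / d_tilde n \<theta> \<omega> i\<bar>
     \<le> 812 * K ^ 6 * \<sigma> * \<bar>b_tilde n L \<theta> \<omega> i / d_tilde n \<theta> \<omega> i\<bar> + 300000 * K ^ 13 * \<sigma> * r"
      by (rule expansion[OF i])
  qed
  then have "PP (- bad) \<le> PP {\<omega>. \<forall>i<n.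
     \<bar>spectral_theta n (ph \<omega>) i - \<theta> i - b_tilde n L \<theta> \<omega> i / d_tilde n \<theta> \<omega> i\<bar>
     \<le> 812 * K ^ 6 * \<sigma> * \<bar>b_tilde n L \<theta> \<omega> i / d_tilde n \<theta> \<omega> i\<bar> + 300000 * K ^ 13 * \<sigma> * r}"
    by (intro measure_pmf.finite_measure_mono) auto
  moreover have "PP (- bad) = 1 - PP bad"
    using measure_pmf.prob_compl[of bad "btl_pmf n p L \<theta>"] by (simp add: Compl_eq_Diff_UNIV)
  ultimately show ?thesis using prob_bad[OF small] by linarith
qed

end

text \<open>Converts a mixed bound into a decomposition. If the relative part suffices, the whole
  error goes into \<open>e1\<close>; otherwise \<open>e1\<close> takes its extreme value with the
  sign that reduces the error, and \<open>e2\<close> is the rest. The identity holds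
  unconditionally, so the error vectors are defined on every sample and only their size depends on
  the good event.\<close>

lemma split_error:
  fixes t \<beta> c d :: real
  assumes "0 \<le> c" "0 \<le> d"
  shows "\<exists>e1 e2. t = e1 * \<beta> + e2 \<and> (\<bar>t\<bar> \<le> c * \<bar>\<beta>\<bar> + d \<longrightarrow> \<bar>e1\<bar> \<le> c \<and> \<bar>e2\<bar> \<le> d)"
proof (cases "\<bar>t\<bar> \<le> c * \<bar>\<beta>\<bar>")
  case True
  show ?thesis
  proof (cases "\<beta> = 0")
    case False
    have "\<bar>t / \<beta>\<bar> \<le> c" using True False by (simp add: abs_divide pos_divide_le_eq)
    then show ?thesis using False assms by (intro exI[of _ "t / \<beta>"] exI[of _ 0]) auto
  qed (use True assms in \<open>auto intro!: exI[of _ 0]\<close>)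
next
  case False
  define e1 where "e1 = c * sgn \<beta> * sgn t"
  have prod: "e1 * \<beta> = c * \<bar>\<beta>\<bar> * sgn t" by (simp add: e1_def abs_sgn mult.commute mult.left_commute)
  have "\<bar>e1\<bar> \<le> c" using assms by (simp add: e1_def abs_mult abs_sgn_eq)
  moreover have "\<bar>t - e1 * \<beta>\<bar> \<le> d" if "\<bar>t\<bar> \<le> c * \<bar>\<beta>\<bar> + d"
    using False that assms unfolding prod by (auto simp: sgn_if abs_if split: if_splits)
  ultimately show ?thesis by (intro exI[of _ e1] exI[of _ "t - e1 * \<beta>"]) auto
qed

theorem theorem2p5:
  fixes p :: "nat \<Rightarrow> real" and L :: "nat \<Rightarrow> nat" and \<kappa> :: "nat \<Rightarrow> real"
    and \<theta> :: "nat \<Rightarrow> nat \<Rightarrow> real"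
    and \<pi>hat :: "nat \<Rightarrow> btl_data \<Rightarrow> nat \<Rightarrow> real"
  assumes p_range: "\<And>n. n \<ge> 2 \<Longrightarrow> 0 < p n \<and> p n \<le> 1"
    and L_pos: "\<And>n. n \<ge> 2 \<Longrightarrow> L n \<ge> 1"
    and kappa_pos: "\<And>n. n \<ge> 2 \<Longrightarrow> \<kappa> n > 0"
    and theta_in: "\<And>n. n \<ge> 2 \<Longrightarrow> \<theta> n \<in> Theta n (\<kappa> n)"
    and kappa_bdd: "\<exists>K. \<forall>n\<ge>2. \<kappa> n \<le> K"
    and sparsity: "(\<lambda>n. ln (real n) powr (3/2) / (real n * p n)) \<longlonglongrightarrow> 0"
    and pihat_stat: "\<And>n \<omega>. n \<ge> 2 \<Longrightarrow>
                       stationary_prob n (Pmat n (p n) (L n) \<omega>) (\<pi>hat n \<omega>)"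
  shows "\<exists>C \<delta>1 \<delta>2. \<delta>1 \<longlonglongrightarrow> 0 \<and> \<delta>2 \<longlonglongrightarrow> 0 \<and>
           (\<forall>n\<ge>2. \<exists>\<epsilon>1 \<epsilon>2 :: btl_data \<Rightarrow> nat \<Rightarrow> real.
              (\<forall>\<omega>. \<forall>i<n.
                 spectral_theta n (\<pi>hat n \<omega>) i - \<theta> n i
                   = (1 + \<epsilon>1 \<omega> i) * (b_tilde n (L n) (\<theta> n) \<omega> i / d_tilde n (\<theta> n) \<omega> i)
                     + \<epsilon>2 \<omega> i) \<and>
              measure_pmf.prob (btl_pmf n (p n) (L n) (\<theta> n))
                {\<omega>. \<forall>i<n. \<bar>\<epsilon>1 \<omega> i\<bar> \<le> \<delta>1 n \<and>
                          \<bar>\<epsilon>2 \<omega> i\<bar> \<le> \<delta>2 n / sqrt (real n * p n * real (L n))}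
                \<ge> 1 - C / real n ^ 10)"
  proof -
  obtain \<kappa>0 where \<kappa>0: "\<And>n. n \<ge> 2 \<Longrightarrow> \<kappa> n \<le> \<kappa>0" using kappa_bdd by blast
  \<comment> \<open>The absolute value ensures \<open>1 \<le> R\<close> whatever the sign of the
    bound.\<close>
  define R where "R = exp \<bar>\<kappa>0\<bar>"
  define KR where "KR = 400 * R ^ 4"
  have K0: "0 \<le> KR" by (simp add: KR_def R_def)
  \<comment> \<open>This is the \<sigma> of the model, as \<open>lam ^ 3\<close> is the power 3/2 of
    \<open>ln n\<close>; the sparsity hypothesis says exactly that it tends to zero.\<close>
  define s where "s n = sqrt (ln (real n) powr (3/2) / (real n * p n))" for n
  have s_lim: "s \<longlonglongrightarrow> 0" using tendsto_real_sqrt[OF sparsity] by (simp add: s_def[abs_def])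
  have s0: "0 \<le> s n" if "n \<ge> 2" for n using p_range[OF that] by (simp add: s_def)
  have model: "btl_model n (p n) (L n) (\<theta> n) R (\<pi>hat n)" if n: "n \<ge> 3" for n
  proof
    have n2: "n \<ge> 2" using n by simp
    show "3 \<le> n" "0 < p n" "p n \<le> 1" "1 \<le> L n" using n p_range[OF n2] L_pos[OF n2] by auto
    show "1 \<le> R" by (simp add: R_def)
    show "(\<Sum>i<n. \<theta> n i) = 0" using theta_in[OF n2] by (simp add: Theta_def)
    show "stationary_prob n (Pmat n (p n) (L n) \<omega>) (\<pi>hat n \<omega>)" for \<omega> by (rule pihat_stat[OF n2])
    fix i j assume "i < n" "j < n"
    then have "\<theta> n i - \<theta> n j \<le> \<kappa> n" using theta_in[OF n2] by (simp add: Theta_def)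
    then show "exp (\<theta> n i - \<theta> n j) \<le> R" using \<kappa>0[OF n2] by (simp add: R_def)
  qed
  have sigma: "btl_model.\<sigma> n (p n) = s n" if n: "n \<ge> 3" for n
  proof -
    interpret btl_model n "p n" "L n" "\<theta> n" R "\<pi>hat n" by (rule model[OF n])
    have ln0: "0 < ln (real n)" using n by simp
    have "lam ^ 3 = (ln (real n) powr (1/2)) ^ 3" using ln0 by (simp add: lam_def powr_half_sqrt)
    also have "\<dots> = ln (real n) powr (3/2)" using ln0 by (simp add: powr_power)
    finally have "lam ^ 3 = ln (real n) powr (3/2)" .
    then show ?thesis by (simp add: \<sigma>_def s_def \<nu>_def m_def real_sqrt_divide)
  qed
  have "(\<lambda>n. 1000 * KR ^ 6 * s n) \<longlonglongrightarrow> 1000 * KR ^ 6 * 0" by (intro tendsto_intros s_lim)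
  then have "eventually (\<lambda>n. 1000 * KR ^ 6 * s n < 1) sequentially" by (intro order_tendstoD) auto
  then obtain N0 where N0: "\<And>n. n \<ge> N0 \<Longrightarrow> 1000 * KR ^ 6 * s n < 1" by (auto simp: eventually_sequentially)
  define N where "N = max 3 N0"
  \<comment> \<open>The summand \<open>real N ^ 10\<close> makes the claim trivial for the finitely
    many \<open>n\<close> below \<open>N\<close>, where \<sigma> may be too large.\<close>
  define C where "C = 26 + real N ^ 10"
  define \<delta>1 where "\<delta>1 n = 812 * KR ^ 6 * s n" for n
  define \<delta>2 where "\<delta>2 n = 300000 * KR ^ 13 * s n" for n
  have \<delta>1_lim: "\<delta>1 \<longlonglongrightarrow> 0" unfolding \<delta>1_def[abs_def] by (rule tendsto_eq_intros s_lim refl | simp)+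
  have \<delta>2_lim: "\<delta>2 \<longlonglongrightarrow> 0" unfolding \<delta>2_def[abs_def] by (rule tendsto_eq_intros s_lim refl | simp)+
  have main: "\<exists>\<epsilon>1 \<epsilon>2 :: btl_data \<Rightarrow> nat \<Rightarrow> real.
              (\<forall>\<omega>. \<forall>i<n.
                 spectral_theta n (\<pi>hat n \<omega>) i - \<theta> n i
                   = (1 + \<epsilon>1 \<omega> i) * (b_tilde n (L n) (\<theta> n) \<omega> i / d_tilde n (\<theta> n) \<omega> i)
                     + \<epsilon>2 \<omega> i) \<and>
              measure_pmf.prob (btl_pmf n (p n) (L n) (\<theta> n))
                {\<omega>. \<forall>i<n. \<bar>\<epsilon>1 \<omega> i\<bar> \<le> \<delta>1 n \<and>
                          \<bar>\<epsilon>2 \<omega> i\<bar> \<le> \<delta>2 n / sqrt (real n * p n * real (L n))}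
                \<ge> 1 - C / real n ^ 10" if n: "n \<ge> 2" for n
  proof -
    let ?\<beta> = "\<lambda>\<omega> i. b_tilde n (L n) (\<theta> n) \<omega> i / d_tilde n (\<theta> n) \<omega> i"
    let ?t = "\<lambda>\<omega> i. spectral_theta n (\<pi>hat n \<omega>) i - \<theta> n i - ?\<beta> \<omega> i"
    define d where "d = \<delta>2 n / sqrt (real n * p n * real (L n))"
    have d0: "0 \<le> d" "0 \<le> \<delta>1 n"
      using K0 s0[OF n] p_range[OF n] by (auto simp: d_def \<delta>1_def \<delta>2_def)
    have "\<forall>\<omega> i. \<exists>e1 e2. ?t \<omega> i = e1 * ?\<beta> \<omega> i + e2 \<and>
        (\<bar>?t \<omega> i\<bar> \<le> \<delta>1 n * \<bar>?\<beta> \<omega> i\<bar> + d \<longrightarrow> \<bar>e1\<bar> \<le> \<delta>1 n \<and> \<bar>e2\<bar> \<le> d)"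
      using split_error[OF d0(2,1)] by blast
    then obtain \<epsilon>1 \<epsilon>2 where e: "\<And>\<omega> i. ?t \<omega> i = \<epsilon>1 \<omega> i * ?\<beta> \<omega> i + \<epsilon>2 \<omega> i"
      "\<And>\<omega> i. \<bar>?t \<omega> i\<bar> \<le> \<delta>1 n * \<bar>?\<beta> \<omega> i\<bar> + d \<Longrightarrow> \<bar>\<epsilon>1 \<omega> i\<bar> \<le> \<delta>1 n \<and> \<bar>\<epsilon>2 \<omega> i\<bar> \<le> d"
      by metis
    have eq: "spectral_theta n (\<pi>hat n \<omega>) i - \<theta> n i = (1 + \<epsilon>1 \<omega> i) * ?\<beta> \<omega> i + \<epsilon>2 \<omega> i" for \<omega> i
      using e(1)[of \<omega> i] unfolding distrib_right by linarith
    have n10: "0 < real n ^ 10" using n by simp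
    have "1 - C / real n ^ 10 \<le> measure_pmf.prob (btl_pmf n (p n) (L n) (\<theta> n))
        {\<omega>. \<forall>i<n. \<bar>\<epsilon>1 \<omega> i\<bar> \<le> \<delta>1 n \<and> \<bar>\<epsilon>2 \<omega> i\<bar> \<le> d}"
    proof (cases "n < N")
      case True
      then have "real n ^ 10 \<le> real N ^ 10" by (intro power_mono) auto
      then have "real n ^ 10 \<le> C" unfolding C_def by linarith
      then have "1 - C / real n ^ 10 \<le> 0" using n10 by simp
      then show ?thesis using measure_nonneg order_trans by blast
    next
      case False
      then have n3: "n \<ge> 3" and "n \<ge> N0" by (auto simp: N_def)
      interpret btl_model n "p n" "L n" "\<theta> n" R "\<pi>hat n" by (rule model[OF n3])
      have K: "btl_model.K R = KR" by (simp add: K_def KR_def)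
      have d: "d = 300000 * KR ^ 13 * s n * r" by (simp add: d_def \<delta>2_def r_def m_def)
      have "1 - 26 / real n ^ 10 \<le> PP {\<omega>. \<forall>i<n. \<bar>?t \<omega> i\<bar> \<le> \<delta>1 n * \<bar>?\<beta> \<omega> i\<bar> + d}"
        using expansion_prob N0[OF \<open>n \<ge> N0\<close>] unfolding K sigma[OF n3] d \<delta>1_def by simp
      also have "\<dots> \<le> PP {\<omega>. \<forall>i<n. \<bar>\<epsilon>1 \<omega> i\<bar> \<le> \<delta>1 n \<and> \<bar>\<epsilon>2 \<omega> i\<bar> \<le> d}"
        using e(2) by (intro measure_pmf.finite_measure_mono) auto
      finally have "1 - 26 / real n ^ 10 \<le> PP {\<omega>. \<forall>i<n. \<bar>\<epsilon>1 \<omega> i\<bar> \<le> \<delta>1 n \<and> \<bar>\<epsilon>2 \<omega> i\<bar> \<le> d}" .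
      moreover have "26 / real n ^ 10 \<le> C / real n ^ 10" using n10 by (intro divide_right_mono) (auto simp: C_def)
      ultimately show ?thesis by linarith
    qed
    then show ?thesis using eq unfolding d_def by blast
  qed
  show ?thesis using \<delta>1_lim \<delta>2_lim main by blast
qed


end
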